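(* Let $\overline{\sigma}\in\mathcal{P}_{+}$ with $\overline{\sigma}\neq\delta_0$, let $\sigma=\overline{\sigma}\boxtimes\overline{\sigma}$, let $\mathrm{w}$ be the standard Wigner measure and let $\mu=\overline{\sigma}\boxtimes\mathrm{w}$. Then $\mu^{(2)}=\sigma\boxtimes\mathrm{m}$, and $\mu^{(2)}$ is free infinitely divisible. Moreover, $\mu^{(2)}$ is a free compound Poisson distribution in $I_{r+}^{\boxplus}$.
   Context: $\mathcal{P}_+$ is the set of Borel probability measures supported in $\mathbb{R}_+=[0,\infty)$; $\mathcal{P}_s$ is the set of symmetric Borel probability measures on $\mathbb{R}$. $\mathrm{w}(\mathrm{d}x)=\frac{1}{2\pi}\sqrt{4-x^2}\,1_{(-2,2)}(x)\mathrm{d}x$; $\mathrm{m}(\mathrm{d}x)=\frac{1}{2\pi x}\sqrt{4-(x-2)^2}\,1_{[0,4]}(x)\mathrm{d}x$ is the Marchenko–Pastur (free Poisson) distribution of parameter $1$. $\mu^{(2)}$ is the image of $\mu$ under $x\mapsto|x|^2$. Free cumulant transform and free infinite divisibility: $F_\mu=1/G_\mu$ with $G_\mu(z)=\int\frac{1}{z-x}\mu(\mathrm{d}x)$, $z\in\mathbb{C}^+$, and $\mathcal{C}_\mu^{\boxplus}(z)=zF_\mu^{-1}(z^{-1})-1$ where the right inverse $F_\mu^{-1}$ exists on a region $\{|\mathrm{Re}\,z|<\eta\,\mathrm{Im}\,z,\ \mathrm{Im}\,z>M\}$. $\mu_1\boxplus\mu_2$ is defined by $\mathcal{C}_{\mu_1\boxplus\mu_2}^{\boxplus}=\mathcal{C}_{\mu_1}^{\boxplus}+\mathcal{C}_{\mu_2}^{\boxplus}$.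 $\mu$ is free infinitely divisible ($\mu\in I^{\boxplus}$) if for every $n$ it is an $n$-fold $\boxplus$-convolution of some probability measure; then $\mathcal{C}_\mu^{\boxplus}$ extends analytically to $\mathbb{C}^-$. $I_{r+}^{\boxplus}$ (free regular measures) is the set of $\sigma\in I^{\boxplus}$ with $\mathcal{C}_\sigma^{\boxplus}(z)=b_\sigma z+\int_{\mathbb{R}_+}(\frac{1}{1-zx}-1)\nu_\sigma(\mathrm{d}x)$, $z\in\mathbb{C}^-$, where $b_\sigma\ge0$, $\nu_\sigma((-\infty,0])=0$, $\int_0^\infty\min(1,x)\nu_\sigma(\mathrm{d}x)<\infty$. A probability measure $\mu$ is a free compound Poisson distribution if there are $c>0$ and a probability measure $\rho$ on $\mathbb{R}$ with $\rho(\{0\})=0$ such that $\mathcal{C}_\mu^{\boxplus}(z)=c\int_{\mathbb{R}}(\frac{1}{1-zx}-1)\rho(\mathrm{d}x)$, $z\in\mathbb{C}^-$. Free multiplicative convolution: let $\Psi_\mu(z)=\int\frac{zx}{1-zx}\mu(\mathrm{d}x)$. If $\mu\in\mathcal{P}_+$, $\mu\ne\delta_0$, $\Psi_\mu$ has an inverse $\chi_\mu$ on $\Psi_\mu(i\mathbb{C}^+)$ with values in the left half-plane $i\mathbb{C}^+$; if $\mu\in\mathcal{P}_s$, $\mu\neq\delta_0$, $\Psi_\mu$ has an inverse $\chi_\mu:\Psi_\mu(H)\to H$, $H=\{z\in\mathbb{C}^-:|\mathrm{Re}\,z|<|\mathrm{Im}\,z|\}$. In both cases the $S$-transform is $S_\mu(z)=\chi_\mu(z)\frac{1+z}{z}$.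 For $\mu_1\in\mathcal{P}_+$ and $\mu_2\in\mathcal{P}_+$ (resp. $\mu_2\in\mathcal{P}_s$), $\mu_1\boxtimes\mu_2$ is the measure in $\mathcal{P}_+$ (resp. $\mathcal{P}_s$) with $S_{\mu_1\boxtimes\mu_2}=S_{\mu_1}S_{\mu_2}$ on a common domain; equivalently, the spectral distribution of $X^{1/2}YX^{1/2}$ for free $X\ge0$ and $Y$ with distributions $\mu_1,\mu_2$. *)

theory Defs
  imports "HOL-Probability.Probability" "HOL-Complex_Analysis.Complex_Analysis"
begin

definition P_plus :: "real measure set" where
  "P_plus = {\<mu>. real_distribution \<mu> \<and> (AE x in \<mu>. 0 \<le> x)}"

definition P_sym :: "real measure set" where
  "P_sym = {\<mu>. real_distribution \<mu> \<and> distr \<mu> borel (\<lambda>x. - x) = \<mu>}"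

abbreviation dirac0 :: "real measure" where
  "dirac0 \<equiv> return borel 0"

definition wigner :: "real measure" where
  "wigner = density lborel
     (\<lambda>x. ennreal (1 / (2 * pi) * sqrt (4 - x\<^sup>2) * indicator {-2<..<2} x))"

definition marchenko_pastur :: "real measure" where
  "marchenko_pastur = density lborel
     (\<lambda>x. ennreal (1 / (2 * pi * x) * sqrt (4 - (x - 2)\<^sup>2) * indicator {0..4} x))"

definition square_image :: "real measure \<Rightarrow> real measure" where
  "square_image \<mu> = distr \<mu> borel (\<lambda>x. \<bar>x\<bar>\<^sup>2)"


section \<open>Free additive convolution and free infinite divisibility\<close>

definition upper_half_plane :: "complex set" where
  "upper_half_plane = {z. 0 < Im z}"

definition lower_half_plane :: "complex set" where
  "lower_half_plane = {z. Im z < 0}"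

definition cauchy_transform :: "real measure \<Rightarrow> complex \<Rightarrow> complex" where
  "cauchy_transform \<mu> z = (LINT x|\<mu>. 1 / (z - of_real x))"

definition F_transform :: "real measure \<Rightarrow> complex \<Rightarrow> complex" where
  "F_transform \<mu> z = 1 / cauchy_transform \<mu> z"

definition trunc_cone :: "real \<Rightarrow> real \<Rightarrow> complex set" where
  "trunc_cone \<eta> M = {z. \<bar>Re z\<bar> < \<eta> * Im z \<and> M < Im z}"

text \<open>
  A right inverse of the F-transform alone need not be unique: for the symmetric Bernoulli law the
  F-transform is \<open>w - 1/w\<close>, which has two analytic right inverses into the upper half-plane. The
  relevant one is asymptotic to the identity at infinity inside the cone; this determines it
  uniquely, and different choices of the cone agree on the intersection.
\<close>

definition F_right_inverse ::
    "real measure \<Rightarrow> real \<Rightarrow> real \<Rightarrow> (complex \<Rightarrow> complex) \<Rightarrow> bool" where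
  "F_right_inverse \<mu> \<eta> M K \<longleftrightarrow>
     K holomorphic_on trunc_cone \<eta> M \<and>
     K ` trunc_cone \<eta> M \<subseteq> upper_half_plane \<and>
     (\<forall>w\<in>trunc_cone \<eta> M. F_transform \<mu> (K w) = w) \<and>
     ((\<lambda>w. K w / w) \<longlongrightarrow> 1) (inf at_infinity (principal (trunc_cone \<eta> M)))"

definition free_cumulant_on ::
    "real measure \<Rightarrow> real \<Rightarrow> real \<Rightarrow> (complex \<Rightarrow> complex) \<Rightarrow> bool" where
  "free_cumulant_on \<mu> \<eta> M C \<longleftrightarrow>
     0 < \<eta> \<and> 0 < M \<and>
     (\<exists>K. F_right_inverse \<mu> \<eta> M K \<and>
          (\<forall>z. 1 / z \<in> trunc_cone \<eta> M \<longrightarrow> C z = z * K (1 / z) - 1))"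

text \<open>\<open>C\<close> is the analytic extension of the free cumulant transform to the lower half-plane.\<close>

definition free_cumulant_ext :: "real measure \<Rightarrow> (complex \<Rightarrow> complex) \<Rightarrow> bool" where
  "free_cumulant_ext \<mu> C \<longleftrightarrow>
     C holomorphic_on lower_half_plane \<and> (\<exists>\<eta> M. free_cumulant_on \<mu> \<eta> M C)"

definition is_free_add_conv :: "real measure \<Rightarrow> real measure \<Rightarrow> real measure \<Rightarrow> bool" where
  "is_free_add_conv \<mu>1 \<mu>2 \<rho> \<longleftrightarrow>
     real_distribution \<mu>1 \<and> real_distribution \<mu>2 \<and> real_distribution \<rho> \<and>
     (\<exists>\<eta> M C1 C2. free_cumulant_on \<mu>1 \<eta> M C1 \<and> free_cumulant_on \<mu>2 \<eta> M C2 \<and>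
        free_cumulant_on \<rho> \<eta> M (\<lambda>z. C1 z + C2 z))"

inductive is_free_add_power :: "real measure \<Rightarrow> nat \<Rightarrow> real measure \<Rightarrow> bool" for \<nu> where
  one: "is_free_add_power \<nu> 1 \<nu>"
| Suc: "is_free_add_power \<nu> n \<tau> \<Longrightarrow> is_free_add_conv \<tau> \<nu> \<rho> \<Longrightarrow> is_free_add_power \<nu> (Suc n) \<rho>"

definition free_infinitely_divisible :: "real measure \<Rightarrow> bool" where
  "free_infinitely_divisible \<mu> \<longleftrightarrow>
     real_distribution \<mu> \<and>
     (\<forall>n\<ge>1. \<exists>\<nu>. real_distribution \<nu> \<and> is_free_add_power \<nu> n \<mu>)"

definition free_regular :: "real measure \<Rightarrow> bool" where
  "free_regular \<sigma> \<longleftrightarrow>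
     free_infinitely_divisible \<sigma> \<and>
     (\<exists>(b::real) (\<nu> :: real measure).
        0 \<le> b \<and> sets \<nu> = sets borel \<and> emeasure \<nu> {..0} = 0 \<and>
        (\<integral>\<^sup>+x\<in>{0<..}. ennreal (min 1 x) \<partial>\<nu>) < \<infinity> \<and>
        free_cumulant_ext \<sigma>
          (\<lambda>z. of_real b * z + (LINT x:{0..}|\<nu>. (1 / (1 - z * of_real x) - 1))))"

definition free_compound_poisson :: "real measure \<Rightarrow> bool" where
  "free_compound_poisson \<mu> \<longleftrightarrow>
     real_distribution \<mu> \<and>
     (\<exists>(c::real) \<rho>. 0 < c \<and> real_distribution \<rho> \<and> measure \<rho> {0} = 0 \<and>
        free_cumulant_ext \<mu>
          (\<lambda>z. of_real c * (LINT x|\<rho>. (1 / (1 - z * of_real x) - 1))))"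


section \<open>Free multiplicative convolution\<close>

definition Psi :: "real measure \<Rightarrow> complex \<Rightarrow> complex" where
  "Psi \<mu> z = (LINT x|\<mu>. z * of_real x / (1 - z * of_real x))"

text \<open>
  The only element of both \<open>P_plus\<close> and \<open>P_sym\<close> is the Dirac mass at 0, which has no S-transform, so
  the case distinction is unambiguous.
\<close>

definition Psi_region :: "real measure \<Rightarrow> complex set" where
  "Psi_region \<mu> =
     (if \<mu> \<in> P_plus then {z. Re z < 0} else {z. Im z < 0 \<and> \<bar>Re z\<bar> < \<bar>Im z\<bar>})"

definition chi :: "real measure \<Rightarrow> complex \<Rightarrow> complex" where
  "chi \<mu> = inv_into (Psi_region \<mu>) (Psi \<mu>)"

definition S_domain :: "real measure \<Rightarrow> complex set" where
  "S_domain \<mu> = Psi \<mu> ` Psi_region \<mu>"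

definition S_transform :: "real measure \<Rightarrow> complex \<Rightarrow> complex" where
  "S_transform \<mu> z = chi \<mu> z * ((1 + z) / z)"

text \<open>
  The intersection of the three domains of definition always contains some interval \<open>(-e, 0)\<close>, but
  it may be disconnected; the product formula is required on a domain containing such an interval.
  By analyticity its truth does not depend on the choice of that domain.
\<close>

definition is_free_mult_conv :: "real measure \<Rightarrow> real measure \<Rightarrow> real measure \<Rightarrow> bool" where
  "is_free_mult_conv \<mu>1 \<mu>2 \<rho> \<longleftrightarrow>
     \<mu>1 \<in> P_plus \<and> (\<mu>2 \<in> P_plus \<and> \<rho> \<in> P_plus \<or> \<mu>2 \<in> P_sym \<and> \<rho> \<in> P_sym) \<and>
     (if \<mu>1 = dirac0 \<or> \<mu>2 = dirac0 then \<rho> = dirac0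
      else \<rho> \<noteq> dirac0 \<and>
        (\<exists>D e. 0 < e \<and> open D \<and> connected D \<and>
           of_real ` {-e<..<0::real} \<subseteq> D \<and>
           D \<subseteq> S_domain \<mu>1 \<inter> S_domain \<mu>2 \<inter> S_domain \<rho> \<and>
           (\<forall>z\<in>D. S_transform \<rho> z = S_transform \<mu>1 z * S_transform \<mu>2 z)))"

end

theory Submission
  imports Defs
begin

text \<open>
  Let \<open>\<mu>(2)\<close> be the image of \<open>\<mu>\<close> under squaring. For symmetric \<open>\<mu>\<close> one has \<open>\<Psi>\<^bsub>\<mu>\<^esub>(z) = \<Psi>\<^bsub>\<mu>(2)\<^esub>(z\<^sup>2)\<close>, hence
  \<open>S\<^bsub>\<mu>(2)\<^esub>(z) = z / (1 + z) * S\<^bsub>\<mu>\<^esub>(z)\<^sup>2\<close>. Applied to \<open>\<mu>\<close> and to the semicircle law, whose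
  image under squaring is the Marchenko-Pastur law, this gives the product formula.

  Since \<open>S(z) = 1 / (1 + z)\<close> for the Marchenko-Pastur law, the product formula says that
  \<open>w (1 + \<Psi>\<^bsub>\<sigma>\<^esub>(1 / w))\<close> is a right inverse of the F-transform of \<open>\<mu>(2)\<close>, first for large
  negative \<open>w\<close> and then, by analytic continuation through a half-plane, on a truncated cone. So
  the free cumulant transform is \<open>\<Psi>\<^bsub>\<sigma>\<^esub>\<close>, that of a free compound Poisson law.

  For infinite divisibility one needs, for \<open>0 < t < 1\<close>, a probability measure with free cumulant
  transform \<open>t \<Psi>\<^bsub>\<sigma>\<^esub>\<close>. The map \<open>w (1 + t \<Psi>\<^bsub>\<sigma>\<^esub>(1 / w))\<close> is a proper injection from the part of the
  upper half-plane which it sends into the upper half-plane, so it has a global analytic inverse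
  there, and by Nevanlinna's theorem this inverse is the F-transform of a probability measure.
\<close>

section \<open>The Cauchy transform\<close>

text \<open>The S-transform identity is guaranteed only on some domain containing an interval
  \<open>(-e, 0)\<close>, which corresponds to large negative \<open>w\<close>, whereas a free
  cumulant transform is determined on a cone around the positive imaginary axis. The half-plane
  \<open>Im w - Re w > M\<close> meets both the negative axis and the cone and avoids the cut
  \<open>[0, \<infinity>)\<close>; for large \<open>M\<close>, \<open>Psi \<sigma> (1 / w)\<close>
  is uniformly small on it by dominated convergence, even if \<sigma> has no moments. The rate
  \<open>t = 1\<close> is special: the lower bound that makes the map proper carries the factor
  \<open>(1 - t) / 2\<close>. So measures are constructed for \<open>t < 1\<close> only, and at
  \<open>t = 1\<close> the given law itself takes over. Nevanlinna's theorem is obtained by shifting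
  the function upwards by \<epsilon>, reading a density off the real axis, and passing to a weak
  limit.\<close>

lemma borel_measurable_real_distribution:
  assumes "real_distribution \<mu>" "f \<in> borel_measurable borel"
  shows "f \<in> borel_measurable \<mu>"
proof -
  interpret real_distribution \<mu> by fact
  show ?thesis using assms(2) by simp
qed

lemma integrable_bounded_real_distribution:
  fixes f :: "real \<Rightarrow> 'b::{banach, second_countable_topology}"
  assumes "real_distribution \<mu>" "f \<in> borel_measurable borel" "AE x in \<mu>. norm (f x) \<le> B"
  shows "integrable \<mu> f"
proof -
  interpret real_distribution \<mu> by fact
  show ?thesis
    by (rule integrable_const_bound[OF assms(3)]) (use assms(2) in simp)
qed

lemma integral_norm_bound_real_distribution:
  fixes f :: "real \<Rightarrow> 'b::{banach, second_countable_topology}"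
  assumes "real_distribution \<mu>" "f \<in> borel_measurable borel" "AE x in \<mu>. norm (f x) \<le> B"
  shows "norm (LINT x|\<mu>. f x) \<le> B"
proof -
  interpret real_distribution \<mu> by fact
  have "norm (LINT x|\<mu>. f x) \<le> (LINT x|\<mu>. norm (f x))"
    by (rule integral_norm_bound)
  also have "\<dots> \<le> (LINT x|\<mu>. B)"
    using integrable_bounded_real_distribution[OF assms] assms(3)
    by (intro integral_mono_AE) auto
  also have "\<dots> = B" using prob_space by simp
  finally show ?thesis .
qed

lemma integrable_cauchy_kernel:
  assumes "real_distribution \<mu>" "0 < d" "AE x in \<mu>. d \<le> cmod (w - of_real x)"
  shows "integrable \<mu> (\<lambda>x. 1 / (w - of_real x))"
proof (rule integrable_bounded_real_distribution[OF assms(1), where B = "1 / d"])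
  show "AE x in \<mu>. norm (1 / (w - of_real x)) \<le> 1 / d"
    using assms(3) by eventually_elim (use assms(2) in \<open>auto simp: norm_divide frac_le\<close>)
qed simp

text \<open>The remainder of the difference quotient is the integral of
  \<open>h / ((w - x)^2 (w + h - x))\<close>, uniformly of order \<open>h\<close> because a shift by
  less than \<open>d / 2\<close> keeps half of the separation. Asking for separation only almost
  surely serves both the upper half-plane and, for measures in \<open>P_plus\<close>, the complement
  of \<open>[0, \<infinity>)\<close>.\<close>

lemma cauchy_transform_field_differentiable:
  assumes \<mu>: "real_distribution \<mu>" and d: "0 < d" "AE x in \<mu>. d \<le> cmod (w - of_real x)"
  shows "cauchy_transform \<mu> field_differentiable at w"
proof -
  define D where "D = (LINT x|\<mu>. - 1 / (w - of_real x)\<^sup>2)"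
  have intD: "integrable \<mu> (\<lambda>x. - 1 / (w - of_real x)\<^sup>2)"
  proof (rule integrable_bounded_real_distribution[OF \<mu>, where B = "1 / d\<^sup>2"])
    show "AE x in \<mu>. norm (- 1 / (w - complex_of_real x)\<^sup>2) \<le> 1 / d\<^sup>2"
      using d(2) by eventually_elim
        (use d(1) in \<open>auto simp: norm_divide norm_power intro!: frac_le power_mono\<close>)
  qed simp
  have bound: "norm ((cauchy_transform \<mu> (w + h) - cauchy_transform \<mu> w) / h - D) \<le> 2 / d ^ 3 * norm h"
    if h: "h \<noteq> 0" "norm h < d / 2" for h
  proof -
    have sep: "AE x in \<mu>. d / 2 \<le> cmod (w + h - of_real x)"
      using d(2)
    proof eventually_elim
      case (elim x)
      have "cmod (w - of_real x) \<le> cmod (w + h - of_real x) + cmod h"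
        using norm_triangle_ineq4[of "w + h - of_real x" h] by simp
      then show ?case using elim h by simp
    qed
    have int1: "integrable \<mu> (\<lambda>x. 1 / (w + h - of_real x))"
      by (rule integrable_cauchy_kernel[OF \<mu> _ sep]) (use d in simp)
    have int2: "integrable \<mu> (\<lambda>x. 1 / (w - of_real x))"
      by (rule integrable_cauchy_kernel[OF \<mu> d])
    have "(cauchy_transform \<mu> (w + h) - cauchy_transform \<mu> w) / h - D =
        (LINT x|\<mu>. (1 / (w + h - of_real x) - 1 / (w - of_real x)) / h - (- 1 / (w - of_real x)\<^sup>2))"
      unfolding cauchy_transform_def D_def using int1 int2 intD
      by (subst Bochner_Integration.integral_diff)
         (auto simp: Bochner_Integration.integral_diff)
    also have "norm \<dots> \<le> 2 / d ^ 3 * norm h"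
    proof (rule integral_norm_bound_real_distribution[OF \<mu>])
      show "AE x in \<mu>. norm ((1 / (w + h - of_real x) - 1 / (w - of_real x)) / h
              - (- 1 / (w - of_real x)\<^sup>2)) \<le> 2 / d ^ 3 * norm h"
        using d(2) sep
      proof eventually_elim
        case (elim x)
        define a where "a = w - complex_of_real x"
        define b where "b = w + h - complex_of_real x"
        have ab: "b = a + h" by (simp add: a_def b_def)
        have na: "d \<le> norm a" and nb: "d / 2 \<le> norm b" using elim by (auto simp: a_def b_def)
        have nz: "a \<noteq> 0" "b \<noteq> 0" using na nb d by auto
        have "1 / b - 1 / a = - h / (a * b)"
          using nz by (simp add: diff_frac_eq ab mult.commute)
        then have "(1 / b - 1 / a) / h - (- 1 / a\<^sup>2) = 1 / a\<^sup>2 - 1 / (a * b)"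
          using h(1) by simp
        also have "\<dots> = h / (a\<^sup>2 * b)"
          using nz by (simp add: divide_simps power2_eq_square) (simp add: ab algebra_simps)
        also have "norm \<dots> = norm h / (norm a ^ 2 * norm b)"
          by (simp add: norm_divide norm_mult norm_power)
        also have "\<dots> \<le> norm h / (d ^ 2 * (d / 2))"
          using na nb d by (intro divide_left_mono mult_mono power_mono mult_pos_pos) auto
        also have "\<dots> = 2 / d ^ 3 * norm h"
          using d(1) by (simp add: power2_eq_square power3_eq_cube)
        finally show ?case by (simp add: a_def b_def)
      qed
    qed simp
    finally show ?thesis .
  qed
  have "((\<lambda>h. (cauchy_transform \<mu> (w + h) - cauchy_transform \<mu> w) / h - D) \<longlongrightarrow> 0) (at 0)"
  proof (rule Lim_null_comparison)
    show "\<forall>\<^sub>F h in at 0. norm ((cauchy_transform \<mu> (w + h) - cauchy_transform \<mu> w) / h - D)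
            \<le> 2 / d ^ 3 * norm h"
      unfolding eventually_at using bound d(1)
      by (intro exI[of _ "d / 2"]) (auto simp: dist_norm)
    show "((\<lambda>h. 2 / d ^ 3 * norm h) \<longlongrightarrow> 0) (at (0::complex))"
      by (rule tendsto_eq_intros refl tendsto_norm_zero tendsto_ident_at)+ simp
  qed
  then have "(cauchy_transform \<mu> has_field_derivative D) (at w)"
    unfolding DERIV_def by (simp add: LIM_zero_iff)
  then show ?thesis by (auto simp: field_differentiable_def)
qed

lemma abs_Im_le_norm_diff_of_real: "\<bar>Im w\<bar> \<le> cmod (w - of_real x)"
  using abs_Im_le_cmod[of "w - of_real x"] by simp

lemma upper_half_plane_open: "open upper_half_plane"
  and upper_half_plane_connected: "connected upper_half_plane"
  by (simp_all add: upper_half_plane_def open_halfspace_Im_gt convex_halfspace_Im_gt convex_connected)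

lemma cauchy_transform_holomorphic_upper:
  assumes "real_distribution \<mu>"
  shows "cauchy_transform \<mu> holomorphic_on upper_half_plane"
  unfolding holomorphic_on_def
proof
  fix w assume "w \<in> upper_half_plane"
  then have "0 < Im w" by (simp add: upper_half_plane_def)
  moreover have "AE x in \<mu>. Im w \<le> cmod (w - of_real x)"
    using abs_Im_le_norm_diff_of_real[of w] \<open>0 < Im w\<close> by auto
  ultimately show "cauchy_transform \<mu> field_differentiable at w within upper_half_plane"
    using assms cauchy_transform_field_differentiable field_differentiable_at_within by blast
qed

lemma P_plusD:
  assumes "\<mu> \<in> P_plus" shows "real_distribution \<mu>" "AE x in \<mu>. 0 \<le> x"
  using assms by (auto simp: P_plus_def)

lemma nonneg_Reals_separation:
  assumes "w \<notin> \<real>\<^sub>\<ge>\<^sub>0"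
  obtains d where "0 < d" "\<And>x. 0 \<le> x \<Longrightarrow> d \<le> cmod (w - of_real x)"
proof (cases "Im w = 0")
  case True
  then have "Re w < 0" using assms by (auto simp: complex_nonneg_Reals_iff)
  moreover have "- Re w \<le> cmod (w - of_real x)" if "0 \<le> x" for x
    using abs_Re_le_cmod[of "w - of_real x"] that \<open>Re w < 0\<close> by simp
  ultimately show ?thesis using that[of "- Re w"] by simp
next
  case False
  then show ?thesis using that[of "\<bar>Im w\<bar>"] abs_Im_le_norm_diff_of_real by simp
qed

lemma cauchy_transform_holomorphic_P_plus:
  assumes "\<mu> \<in> P_plus" and "S \<inter> \<real>\<^sub>\<ge>\<^sub>0 = {}"
  shows "cauchy_transform \<mu> holomorphic_on S"
  unfolding holomorphic_on_def
proof
  fix w assume "w \<in> S"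
  with assms have "w \<notin> \<real>\<^sub>\<ge>\<^sub>0" by auto
  then obtain d where d: "0 < d" "\<And>x. 0 \<le> x \<Longrightarrow> d \<le> cmod (w - of_real x)"
    by (rule nonneg_Reals_separation) blast
  have "AE x in \<mu>. d \<le> cmod (w - of_real x)"
    using P_plusD(2)[OF assms(1)] by eventually_elim (rule d(2))
  then show "cauchy_transform \<mu> field_differentiable at w within S"
    using d(1) P_plusD(1)[OF assms(1)] cauchy_transform_field_differentiable
      field_differentiable_at_within by blast
qed

lemma Im_cauchy_kernel:
  "Im (1 / (w - complex_of_real x)) = - Im w / (cmod (w - of_real x))\<^sup>2"
  by (simp add: Im_divide cmod_power2)

lemma Im_cauchy_transform:
  assumes "real_distribution \<mu>" "0 < Im w"
  shows "Im (cauchy_transform \<mu> w) = - (LINT x|\<mu>. Im w / (cmod (w - of_real x))\<^sup>2)"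
proof -
  have "integrable \<mu> (\<lambda>x. 1 / (w - of_real x))"
    by (rule integrable_cauchy_kernel[OF assms]) (use abs_Im_le_norm_diff_of_real[of w] assms(2) in auto)
  then have "Im (cauchy_transform \<mu> w) = (LINT x|\<mu>. Im (1 / (w - of_real x)))"
    unfolding cauchy_transform_def by simp
  then show ?thesis by (simp add: Im_cauchy_kernel)
qed

lemma norm_cauchy_transform_le:
  assumes "real_distribution \<mu>" "0 < Im w"
  shows "cmod (cauchy_transform \<mu> w) \<le> 1 / Im w"
  unfolding cauchy_transform_def
proof (rule integral_norm_bound_real_distribution[OF assms(1)])
  show "AE x in \<mu>. norm (1 / (w - complex_of_real x)) \<le> 1 / Im w"
  proof (rule AE_I2)
    fix x
    show "norm (1 / (w - complex_of_real x)) \<le> 1 / Im w"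
      using abs_Im_le_norm_diff_of_real[of w x] assms(2) by (auto simp: norm_divide intro!: frac_le)
  qed
qed simp

section \<open>The transform \<open>Psi\<close> and its inverse\<close>

lemma dirac0_if_AE_zero:
  assumes "real_distribution \<mu>" "AE x in \<mu>. x = 0"
  shows "\<mu> = dirac0"
proof (rule measure_eqI)
  interpret real_distribution \<mu> by fact
  show "sets \<mu> = sets dirac0" by simp
  fix A assume A: "A \<in> sets \<mu>"
  show "emeasure \<mu> A = emeasure dirac0 A"
  proof (cases "0 \<in> A")
    case True
    have "AE x in \<mu>. x \<in> A" using assms(2) by eventually_elim (use True in simp)
    then have "emeasure \<mu> A = 1" using A by (simp add: emeasure_eq_1_AE)
    then show ?thesis using True A by simp
  next
    case False
    have "AE x in \<mu>. x \<notin> A" using assms(2) by eventually_elim (use False in simp)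
    then have "emeasure \<mu> A = 0" using A by (simp add: AE_iff_measurable[of A])
    then show ?thesis using False A by simp
  qed
qed

text \<open>Excluding the point mass at 0 puts mass on the open half-line, where the integrand is
  strictly positive. The sign arguments below use nondegeneracy in this form.\<close>

lemma P_plus_integral_pos:
  assumes \<mu>: "\<mu> \<in> P_plus" "\<mu> \<noteq> dirac0"
    and f: "integrable \<mu> f" "f 0 = (0::real)" "\<And>x. 0 < x \<Longrightarrow> 0 < f x"
  shows "0 < (LINT x|\<mu>. f x)"
proof -
  have nn: "AE x in \<mu>. 0 \<le> f x"
    using P_plusD(2)[OF \<mu>(1)] by eventually_elim (metis f(2,3) less_eq_real_def)
  have "(LINT x|\<mu>. f x) \<noteq> 0"
  proof
    assume "(LINT x|\<mu>. f x) = 0"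
    then have "AE x in \<mu>. f x = 0"
      using integral_nonneg_eq_0_iff_AE[OF f(1) nn] by simp
    then have "AE x in \<mu>. x = 0"
      using P_plusD(2)[OF \<mu>(1)] by eventually_elim (metis f(3) less_eq_real_def less_irrefl)
    then show False using dirac0_if_AE_zero[OF P_plusD(1)[OF \<mu>(1)]] \<mu>(2) by simp
  qed
  moreover have "0 \<le> (LINT x|\<mu>. f x)" by (rule integral_nonneg_AE[OF nn])
  ultimately show ?thesis by simp
qed

text \<open>At \<open>w = x\<close> both denominators vanish and both quotients are 0 by convention,
  so there is no exceptional point.\<close>

lemma Psi_kernel_eq:
  fixes w :: complex
  assumes "w \<noteq> 0"
  shows "1 / w * x / (1 - 1 / w * x) = x / (w - x)"
  using assms by (cases "w = x") (auto simp: field_simps)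

lemma Psi_inverse: "w \<noteq> 0 \<Longrightarrow> Psi \<mu> (1 / w) = (LINT x|\<mu>. of_real x / (w - of_real x))"
  unfolding Psi_def by (subst Psi_kernel_eq) simp_all

text \<open>From \<open>x / (w - x) = w / (w - x) - 1\<close>. Through this bridge
  \<open>Psi\<close> inherits holomorphy from the Cauchy transform, and S-transform data about
  \<open>Psi\<close> become data about the F-transform.\<close>

lemma one_plus_Psi:
  assumes \<mu>: "real_distribution \<mu>" and "w \<noteq> 0"
    and d: "0 < d" "AE x in \<mu>. d \<le> cmod (w - of_real x)"
  shows "1 + Psi \<mu> (1 / w) = w * cauchy_transform \<mu> w"
proof -
  interpret real_distribution \<mu> by fact
  have int: "integrable \<mu> (\<lambda>x. 1 / (w - of_real x))"
    by (rule integrable_cauchy_kernel[OF \<mu> d])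
  have "Psi \<mu> (1 / w) = (LINT x|\<mu>. w * (1 / (w - of_real x)) - 1)"
    unfolding Psi_inverse[OF \<open>w \<noteq> 0\<close>]
  proof (rule integral_cong_AE)
    show "AE x in \<mu>. of_real x / (w - of_real x) = w * (1 / (w - of_real x)) - 1"
      using d(2)
    proof eventually_elim
      case (elim x)
      then have "w - of_real x \<noteq> 0" using d(1) by auto
      then show ?case by (simp add: field_simps)
    qed
  qed simp_all
  also have "\<dots> = (LINT x|\<mu>. w * (1 / (w - of_real x))) - (LINT x|\<mu>. 1)"
    by (rule Bochner_Integration.integral_diff) (intro integrable_mult_right int, simp)
  also have "\<dots> = w * cauchy_transform \<mu> w - 1"
    unfolding cauchy_transform_def integral_mult_right_zero using prob_space by simp
  finally show ?thesis by simp
qed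

lemma one_plus_Psi_P_plus:
  assumes "\<mu> \<in> P_plus" "w \<notin> \<real>\<^sub>\<ge>\<^sub>0"
  shows "1 + Psi \<mu> (1 / w) = w * cauchy_transform \<mu> w"
proof -
  obtain d where d: "0 < d" "\<And>x. 0 \<le> x \<Longrightarrow> d \<le> cmod (w - of_real x)"
    by (rule nonneg_Reals_separation[OF assms(2)]) blast
  have "AE x in \<mu>. d \<le> cmod (w - of_real x)"
    using P_plusD(2)[OF assms(1)] by eventually_elim (rule d(2))
  then show ?thesis
    using one_plus_Psi[OF P_plusD(1)[OF assms(1)] _ d(1)] assms(2) by (cases "w = 0") auto
qed

lemma norm_one_minus_mult_ge_1:
  assumes "Re z < 0" "0 \<le> x"
  shows "1 \<le> cmod (1 - z * of_real x)"
proof -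
  have "1 \<le> Re (1 - z * of_real x)" using assms by (simp add: mult_nonpos_nonneg)
  then show ?thesis using complex_Re_le_cmod order_trans by blast
qed

lemma integrable_Psi_kernel:
  assumes "\<mu> \<in> P_plus" "Re z < 0"
  shows "integrable \<mu> (\<lambda>x. z * of_real x / (1 - z * of_real x))"
proof (rule integrable_bounded_real_distribution[OF P_plusD(1)[OF assms(1)], where B = 2])
  show "AE x in \<mu>. norm (z * of_real x / (1 - z * of_real x)) \<le> 2"
    using P_plusD(2)[OF assms(1)]
  proof eventually_elim
    case (elim x)
    define u where "u = 1 - z * of_real x"
    have u: "1 \<le> norm u" using norm_one_minus_mult_ge_1[OF assms(2) elim] by (simp add: u_def)
    have "norm (1 - u) \<le> 1 + norm u" using norm_triangle_ineq4[of 1 u] by simp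
    also have "\<dots> \<le> 2 * norm u" using u by simp
    finally have "norm ((1 - u) / u) \<le> 2" using u by (simp add: norm_divide divide_le_eq)
    then show ?case by (simp add: u_def)
  qed
qed simp

text \<open>
  The difference quotient of \<open>Psi\<close> at two points is the integral of \<open>x / ((1 - z\<^sub>1 x) (1 - z\<^sub>2 x))\<close>.
  If the imaginary parts of the two points have the same sign, then so do the imaginary parts of
  all values of the integrand; otherwise all these values have positive real part.
\<close>

lemma Psi_inj_on_left_half_plane:
  assumes \<mu>: "\<mu> \<in> P_plus" "\<mu> \<noteq> dirac0"
  shows "inj_on (Psi \<mu>) {z. Re z < 0}"
proof (rule inj_onI, rule ccontr)
  fix a b assume "a \<in> {z. Re z < 0}" "b \<in> {z. Re z < 0}"
    and eq: "Psi \<mu> a = Psi \<mu> b" and "a \<noteq> b"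
  then have ab: "Re a < 0" "Re b < 0" by auto
  define P where "P x = (1 - a * of_real x) * (1 - b * of_real x)" for x :: real
  define f where "f x = of_real x / P x" for x :: real
  have P_norm: "1 \<le> norm (P x)" if "0 \<le> x" for x
    unfolding P_def norm_mult
    using norm_one_minus_mult_ge_1[OF ab(1) that] norm_one_minus_mult_ge_1[OF ab(2) that]
    by (metis mult_mono' mult_1_left zero_le_one)
  have kernel_diff: "a * of_real x / (1 - a * of_real x) - b * of_real x / (1 - b * of_real x)
      = (a - b) * f x" if "0 \<le> x" for x
  proof -
    have "1 - a * of_real x \<noteq> 0" "1 - b * of_real x \<noteq> 0"
      using P_norm[OF that] by (auto simp: P_def)
    then show ?thesis
      by (simp add: f_def P_def diff_frac_eq) (simp add: algebra_simps)
  qed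
  have int_f: "integrable \<mu> f"
  proof -
    have "integrable \<mu> (\<lambda>x. (a * of_real x / (1 - a * of_real x) - b * of_real x / (1 - b * of_real x)) / (a - b))"
      using integrable_Psi_kernel[OF \<mu>(1) ab(1)] integrable_Psi_kernel[OF \<mu>(1) ab(2)] by simp
    then show ?thesis
    proof (rule integrable_cong_AE_imp)
      show "f \<in> borel_measurable \<mu>"
        unfolding f_def P_def
        by (rule borel_measurable_real_distribution[OF P_plusD(1)[OF \<mu>(1)]]) simp
      show "AE x in \<mu>. (a * of_real x / (1 - a * of_real x) - b * of_real x / (1 - b * of_real x)) / (a - b) = f x"
        using P_plusD(2)[OF \<mu>(1)] by eventually_elim (use kernel_diff \<open>a \<noteq> b\<close> in auto)
    qed
  qed
  have "0 = Psi \<mu> a - Psi \<mu> b" using eq by simp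
  also have "\<dots> = (LINT x|\<mu>. a * of_real x / (1 - a * of_real x) - b * of_real x / (1 - b * of_real x))"
    unfolding Psi_def using integrable_Psi_kernel[OF \<mu>(1) ab(1)] integrable_Psi_kernel[OF \<mu>(1) ab(2)]
    by simp
  also have "\<dots> = (LINT x|\<mu>. (a - b) * f x)"
  proof (rule integral_cong_AE)
    show "(\<lambda>x. a * of_real x / (1 - a * of_real x) - b * of_real x / (1 - b * of_real x)) \<in> borel_measurable \<mu>"
      by (rule borel_measurable_real_distribution[OF P_plusD(1)[OF \<mu>(1)]]) simp
    show "AE x in \<mu>. a * of_real x / (1 - a * of_real x) - b * of_real x / (1 - b * of_real x) = (a - b) * f x"
      using P_plusD(2)[OF \<mu>(1)] by eventually_elim (rule kernel_diff)
  qed (use int_f in auto)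
  finally have zero: "(LINT x|\<mu>. f x) = 0" using \<open>a \<noteq> b\<close> by simp
  have f_eq: "f x = of_real x * cnj (P x) / of_real ((norm (P x))\<^sup>2)" for x
    unfolding f_def by (subst complex_div_cnj) simp
  \<comment> \<open>For \<open>x > 0\<close>, \<open>Re (f x)\<close> has the sign of
    \<open>Re (P x)\<close> and \<open>Im (f x)\<close> the sign opposite to
    \<open>Im (P x)\<close>, so the case analysis can work with the polynomial
    \<open>P\<close>.\<close>
  have f_parts: "Re (f x) = x * Re (P x) / (norm (P x))\<^sup>2" "Im (f x) = - x * Im (P x) / (norm (P x))\<^sup>2" for x
    unfolding f_eq by (simp_all add: Re_divide_of_real Im_divide_of_real)
  have Re_P: "Re (P x) = (1 - x * Re a) * (1 - x * Re b) - x\<^sup>2 * (Im a * Im b)"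
    and Im_P: "Im (P x) = - x * (Im a * (1 - x * Re b) + Im b * (1 - x * Re a))" for x
    by (simp_all add: P_def power2_eq_square algebra_simps)
  have pos: "0 < 1 - x * Re a" "0 < 1 - x * Re b" if "0 < x" for x
    using mult_pos_neg[OF that ab(1)] mult_pos_neg[OF that ab(2)] by auto
  have sq: "0 < (norm (P x))\<^sup>2" if "0 < x" for x
    using P_norm[of x] that by (intro zero_less_power) linarith
  have int_parts: "(LINT x|\<mu>. Re (f x)) = 0" "(LINT x|\<mu>. Im (f x)) = 0"
    using int_f zero by simp_all
  have int_Re: "integrable \<mu> (\<lambda>x. Re (f x))" and int_Im: "integrable \<mu> (\<lambda>x. Im (f x))"
    using int_f by simp_all
  \<comment> \<open>A vanishing imaginary part belongs to the first case.\<close>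
  consider "Im a * Im b \<le> 0" | "0 < Im a" "0 < Im b" | "Im a < 0" "Im b < 0"
    by (metis linorder_not_less mult_neg_neg mult_pos_pos not_less_iff_gr_or_eq zero_less_mult_iff)
  then show False
  proof cases
    case 1
    have "0 < Re (f x)" if x: "0 < x" for x
    proof -
      have "x\<^sup>2 * (Im a * Im b) \<le> 0" using 1 by (simp add: mult_nonneg_nonpos)
      then have "0 < Re (P x)" using mult_pos_pos[OF pos[OF x]] by (simp add: Re_P)
      then show ?thesis using sq[OF x] x by (simp add: f_parts)
    qed
    then show False
      using P_plus_integral_pos[OF \<mu> int_Re] int_parts by (simp add: f_def)
  next
    case 2
    have "0 < Im (f x)" if x: "0 < x" for x
    proof -
      have "0 < Im a * (1 - x * Re b) + Im b * (1 - x * Re a)"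
        using 2 pos[OF x] by (simp add: add_pos_pos)
      then have "0 < x * (x * (Im a * (1 - x * Re b) + Im b * (1 - x * Re a)))" using x by simp
      then show ?thesis using sq[OF x] by (simp add: f_parts Im_P)
    qed
    then show False
      using P_plus_integral_pos[OF \<mu> int_Im] int_parts by (simp add: f_def)
  next
    case 3
    have "0 < - Im (f x)" if x: "0 < x" for x
    proof -
      have "Im a * (1 - x * Re b) + Im b * (1 - x * Re a) < 0"
        using 3 pos[OF x] by (simp add: add_neg_neg mult_neg_pos)
      then have "x * (x * (Im a * (1 - x * Re b) + Im b * (1 - x * Re a))) < 0"
        using x by (simp add: mult_pos_neg)
      then show ?thesis using sq[OF x] by (simp add: f_parts Im_P divide_neg_pos)
    qed
    then show False
      using P_plus_integral_pos[OF \<mu>, of "\<lambda>x. - Im (f x)"] int_Im int_parts by (simp add: f_def)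
  qed
qed

text \<open>Dominated convergence, uniform over the region where \<open>cmod w\<close> is at most
  \<open>C\<close> times the distance to every nonnegative \<open>x\<close>. The constant stays free
  because it is 2 on the half-plane \<open>Re w < Im w\<close> but \<open>2 / (1 - t)\<close> along
  the inverse of \<open>poisson_K t \<sigma>\<close>.\<close>

lemma Psi_inverse_tendsto_0:
  assumes \<mu>: "\<mu> \<in> P_plus" and "0 < C" "0 < \<delta>"
  obtains M where "0 < M"
    "\<And>w. M < cmod w \<Longrightarrow> (\<And>x. 0 \<le> x \<Longrightarrow> cmod w \<le> C * cmod (w - of_real x)) \<Longrightarrow> cmod (Psi \<mu> (1 / w)) < \<delta>"
proof -
  interpret real_distribution \<mu> by (rule P_plusD(1)[OF \<mu>])
  \<comment> \<open>\<open>1 + C\<close> bounds the kernel because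
    \<open>x \<le> cmod w + cmod (w - x)\<close>; the second term uses \<open>cmod w > 1 + n\<close>
    and decays pointwise. The majorant depends on \<open>w\<close> only through
    \<open>n\<close>.\<close>
  define h where "h n x = min (1 + C) (C * \<bar>x\<bar> / (1 + real n))" for n x
  have h_nonneg: "0 \<le> h n x" and h_le: "h n x \<le> 1 + C" for n x
    using \<open>0 < C\<close> by (auto simp: h_def)
  have h_meas: "h n \<in> borel_measurable borel" for n unfolding h_def by simp
  have "(\<lambda>n. LINT x|\<mu>. h n x) \<longlonglongrightarrow> (LINT x|\<mu>. 0)"
  proof (rule integral_dominated_convergence[where w = "\<lambda>_. 1 + C"])
    show "AE x in \<mu>. (\<lambda>n. h n x) \<longlonglongrightarrow> 0"
    proof (rule AE_I2)
      fix x
      have "(\<lambda>n. C * \<bar>x\<bar> / (1 + real n)) \<longlonglongrightarrow> 0" by real_asymp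
      then have "(\<lambda>n. min (1 + C) (C * \<bar>x\<bar> / (1 + real n))) \<longlonglongrightarrow> min (1 + C) 0"
        by (intro tendsto_min tendsto_const)
      then show "(\<lambda>n. h n x) \<longlonglongrightarrow> 0" using \<open>0 < C\<close> by (simp add: h_def)
    qed
    show "AE x in \<mu>. norm (h n x) \<le> 1 + C" for n
      using h_nonneg h_le by simp
  qed (use h_meas in simp_all)
  then have "(\<lambda>n. LINT x|\<mu>. h n x) \<longlonglongrightarrow> 0" by simp
  then obtain n where n: "(LINT x|\<mu>. h n x) < \<delta>"
    using order_tendstoD(2)[OF _ \<open>0 < \<delta>\<close>] by (metis eventually_sequentially order_refl)
  have int_h: "integrable \<mu> (h n)"
    using h_nonneg h_le h_meas
    by (intro integrable_bounded_real_distribution[OF real_distribution_axioms, where B = "1 + C"]) auto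
  show thesis
  proof (rule that[of "1 + real n"])
    fix w assume w: "1 + real n < cmod w"
      and sector: "\<And>x. 0 \<le> x \<Longrightarrow> cmod w \<le> C * cmod (w - of_real x)"
    have "w \<noteq> 0" using w by auto
    have "cmod (Psi \<mu> (1 / w)) \<le> (LINT x|\<mu>. cmod (of_real x / (w - of_real x)))"
      unfolding Psi_inverse[OF \<open>w \<noteq> 0\<close>] by (rule integral_norm_bound)
    also have "\<dots> \<le> (LINT x|\<mu>. h n x)"
    proof (rule integral_mono_AE')
      show "AE x in \<mu>. cmod (of_real x / (w - of_real x)) \<le> h n x"
        using P_plusD(2)[OF \<mu>]
      proof eventually_elim
        case (elim x)
        have cw: "cmod w \<le> C * cmod (w - of_real x)" by (rule sector[OF elim])
        have pos: "0 < cmod (w - of_real x)"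
          using cw \<open>w \<noteq> 0\<close> by (cases "w = of_real x") auto
        have "x = cmod (w - (w - of_real x))" using elim by simp
        also have "\<dots> \<le> cmod w + cmod (w - of_real x)" by (rule norm_triangle_ineq4)
        finally have 1: "x / cmod (w - of_real x) \<le> 1 + C"
          using cw pos by (simp add: divide_le_eq algebra_simps)
        have "1 + real n \<le> C * cmod (w - of_real x)" using w cw by simp
        then have "x * (1 + real n) \<le> x * (C * cmod (w - of_real x))"
          using elim by (rule mult_left_mono)
        then have 2: "x / cmod (w - of_real x) \<le> C * x / (1 + real n)"
          using pos by (simp add: field_simps)
        show ?case using 1 2 elim by (simp add: h_def norm_divide)
      qed
    qed (use int_h h_nonneg in auto)
    also have "\<dots> < \<delta>" by (rule n)
    finally show "cmod (Psi \<mu> (1 / w)) < \<delta>" .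
  qed simp
qed

section \<open>Images under squaring\<close>

lemma square_image_P_plus:
  assumes "real_distribution \<mu>"
  shows "square_image \<mu> \<in> P_plus"
proof -
  interpret real_distribution \<mu> by fact
  have "real_distribution (square_image \<mu>)"
    unfolding square_image_def by (rule real_distribution_distr) simp
  moreover have "AE x in square_image \<mu>. 0 \<le> x"
    unfolding square_image_def by (subst AE_distr_iff) auto
  ultimately show ?thesis by (simp add: P_plus_def)
qed

lemma square_image_neq_dirac0:
  assumes "real_distribution \<mu>" "\<mu> \<noteq> dirac0"
  shows "square_image \<mu> \<noteq> dirac0"
proof
  interpret real_distribution \<mu> by fact
  assume eq: "square_image \<mu> = dirac0"
  have "AE x in square_image \<mu>. x = 0" unfolding eq by (subst AE_return) auto
  then have "AE x in \<mu>. x = 0"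
    unfolding square_image_def by (subst (asm) AE_distr_iff) auto
  then show False using dirac0_if_AE_zero assms by blast
qed

lemma P_sym_integral_uminus:
  fixes f :: "real \<Rightarrow> 'b::{banach, second_countable_topology}"
  assumes "\<mu> \<in> P_sym" and "f \<in> borel_measurable borel"
  shows "(LINT x|\<mu>. f (- x)) = (LINT x|\<mu>. f x)"
proof -
  have rd: "real_distribution \<mu>" and sym: "distr \<mu> borel (\<lambda>x. - x) = \<mu>"
    using assms by (auto simp: P_sym_def)
  interpret real_distribution \<mu> by fact
  have "(LINT x|distr \<mu> borel (\<lambda>x. - x). f x) = (LINT x|\<mu>. f (- x))"
    by (rule integral_distr) (use assms(2) in simp_all)
  then show ?thesis by (simp add: sym)
qed

lemma P_plus_inter_P_sym:
  assumes "\<mu> \<in> P_plus" "\<mu> \<in> P_sym"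
  shows "\<mu> = dirac0"
proof (rule dirac0_if_AE_zero[OF P_plusD(1)[OF assms(1)]])
  have rd: "real_distribution \<mu>" and sym: "distr \<mu> borel (\<lambda>x. - x) = \<mu>"
    using assms by (auto simp: P_sym_def)
  interpret real_distribution \<mu> by fact
  have "AE x in distr \<mu> borel (\<lambda>x. - x). 0 \<le> x"
    using P_plusD(2)[OF assms(1)] unfolding sym .
  then have "AE x in \<mu>. 0 \<le> - x" by (subst (asm) AE_distr_iff) auto
  with P_plusD(2)[OF assms(1)] show "AE x in \<mu>. x = 0" by eventually_elim auto
qed

text \<open>The real part of \<open>z^2\<close> is \<open>(Re z)^2 - (Im z)^2\<close>, so the
  preimage of the left half-plane consists of this sector and its negative, with exactly one square
  root in each.\<close>

lemma square_bij_sector: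
  "bij_betw (\<lambda>z. z\<^sup>2) {z. Im z < 0 \<and> \<bar>Re z\<bar> < \<bar>Im z\<bar>} {z. Re z < 0}"
  unfolding bij_betw_def
proof (intro conjI inj_onI equalityI subsetI)
  fix a b :: complex
  assume "a \<in> {z. Im z < 0 \<and> \<bar>Re z\<bar> < \<bar>Im z\<bar>}" "b \<in> {z. Im z < 0 \<and> \<bar>Re z\<bar> < \<bar>Im z\<bar>}" "a\<^sup>2 = b\<^sup>2"
  then show "a = b" by (auto simp: power2_eq_iff)
next
  fix z assume "z \<in> (\<lambda>z. z\<^sup>2) ` {z. Im z < 0 \<and> \<bar>Re z\<bar> < \<bar>Im z\<bar>}"
  then obtain a where a: "z = a\<^sup>2" "\<bar>Re a\<bar> < \<bar>Im a\<bar>" by auto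
  then have "(Re a)\<^sup>2 < (Im a)\<^sup>2" by (simp add: abs_less_iff power2_strict_mono flip: abs_le_square_iff not_le)
  then show "z \<in> {z. Re z < 0}" using a by (simp add: Re_power2)
next
  fix z :: complex assume z: "z \<in> {z. Re z < 0}"
  define a where "a = csqrt z"
  have az: "a\<^sup>2 = z" by (simp add: a_def)
  then have "(Re a)\<^sup>2 - (Im a)\<^sup>2 < 0" using z by (simp add: Re_power2 flip: az)
  then have lt: "\<bar>Re a\<bar> < \<bar>Im a\<bar>" by (simp flip: abs_le_square_iff not_le)
  \<comment> \<open>The principal root satisfies the modulus condition but may lie in the upper
    sector; then its negative is the witness.\<close>
  show "z \<in> (\<lambda>z. z\<^sup>2) ` {z. Im z < 0 \<and> \<bar>Re z\<bar> < \<bar>Im z\<bar>}"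
  proof (cases "Im a < 0")
    case True
    then show ?thesis using lt az by (intro image_eqI[of _ _ a]) auto
  next
    case False
    then show ?thesis using lt az by (intro image_eqI[of _ _ "- a"]) auto
  qed
qed

text \<open>By symmetry the kernel may be averaged over \<open>x\<close> and \<open>- x\<close>.
  With \<open>p = z x\<close>, the sum \<open>p / (1 - p) - p / (1 + p)\<close> equals
  \<open>2 p^2 / (1 - p^2)\<close>, twice the kernel of the squared law at
  \<open>z^2\<close>.\<close>

lemma Psi_square_image:
  assumes \<mu>: "\<mu> \<in> P_sym" and z: "Im z < 0" "\<bar>Re z\<bar> < \<bar>Im z\<bar>"
  shows "Psi \<mu> z = Psi (square_image \<mu>) (z\<^sup>2)"
proof -
  have rd: "real_distribution \<mu>" using \<mu> by (simp add: P_sym_def)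
  interpret real_distribution \<mu> by fact
  have nz: "1 - z * of_real x \<noteq> 0" for x
  proof
    assume "1 - z * of_real x = 0"
    then have "Re z * x = 1" "Im z * x = 0" by (simp_all add: complex_eq_iff)
    then show False using z by auto
  qed
  have "z \<noteq> 0" using z by auto
  have Im_inv: "Im (1 / z) \<noteq> 0" using z by (auto simp: Im_divide)
  define d where "d = \<bar>Im (1 / z)\<bar>"
  have d: "0 < d" "d \<le> cmod (1 / z - of_real x)" for x
    using Im_inv abs_Im_le_norm_diff_of_real[of "1 / z"] by (auto simp: d_def)
  define f where "f x = z * of_real x / (1 - z * of_real x)" for x :: real
  have f_eq: "f x = 1 / z * (1 / (1 / z - of_real x)) - 1" for x
    using nz[of x] \<open>z \<noteq> 0\<close> by (simp add: f_def field_simps)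
  have "integrable \<mu> (\<lambda>x. 1 / (1 / z - of_real x))"
    by (rule integrable_cauchy_kernel[OF rd d(1)]) (use d in auto)
  then have int_f: "integrable \<mu> f" unfolding f_eq[abs_def] by (intro Bochner_Integration.integrable_diff integrable_mult_right) auto
  have meas_f: "f \<in> borel_measurable borel" unfolding f_def by simp
  have int_f': "integrable \<mu> (\<lambda>x. f (- x))"
  proof -
    have "integrable (distr \<mu> borel (\<lambda>x. - x)) f" using int_f \<mu> by (simp add: P_sym_def)
    then show ?thesis by (rule integrable_distr[rotated]) simp
  qed
  have "2 * Psi \<mu> z = (LINT x|\<mu>. f x) + (LINT x|\<mu>. f (- x))"
    using P_sym_integral_uminus[OF \<mu> meas_f] by (simp add: Psi_def f_def)
  also have "\<dots> = (LINT x|\<mu>. f x + f (- x))" using int_f int_f' by simp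
  also have "\<dots> = (LINT x|\<mu>. 2 * (z\<^sup>2 * of_real (\<bar>x\<bar>\<^sup>2) / (1 - z\<^sup>2 * of_real (\<bar>x\<bar>\<^sup>2))))"
  proof (rule Bochner_Integration.integral_cong[OF refl])
    fix x
    define p where "p = z * of_real x"
    have p: "1 - p \<noteq> 0" "1 + p \<noteq> 0" using nz[of x] nz[of "- x"] by (simp_all add: p_def)
    have "f x + f (- x) = p / (1 - p) - p / (1 + p)" by (simp add: f_def p_def)
    also have "\<dots> = 2 * (p\<^sup>2 / ((1 - p) * (1 + p)))"
      using p by (simp add: diff_frac_eq) (simp add: power2_eq_square algebra_simps)
    also have "\<dots> = 2 * (z\<^sup>2 * of_real (\<bar>x\<bar>\<^sup>2) / (1 - z\<^sup>2 * of_real (\<bar>x\<bar>\<^sup>2)))"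
      by (simp add: p_def power2_eq_square algebra_simps)
    finally show "f x + f (- x) = 2 * (z\<^sup>2 * of_real (\<bar>x\<bar>\<^sup>2) / (1 - z\<^sup>2 * of_real (\<bar>x\<bar>\<^sup>2)))" .
  qed
  also have "\<dots> = 2 * Psi (square_image \<mu>) (z\<^sup>2)"
    unfolding Psi_def square_image_def integral_mult_right_zero
    by (subst integral_distr) simp_all
  finally show ?thesis by simp
qed

section \<open>S-transforms of a symmetric law and of its image under squaring\<close>

lemma Psi_region_P_plus: "\<mu> \<in> P_plus \<Longrightarrow> Psi_region \<mu> = {z. Re z < 0}"
  by (simp add: Psi_region_def)

lemma Psi_region_P_sym:
  "\<mu> \<in> P_sym \<Longrightarrow> \<mu> \<noteq> dirac0 \<Longrightarrow> Psi_region \<mu> = {z. Im z < 0 \<and> \<bar>Re z\<bar> < \<bar>Im z\<bar>}"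
  using P_plus_inter_P_sym by (auto simp: Psi_region_def)

lemma chi_Psi:
  assumes "\<mu> \<in> P_plus" "\<mu> \<noteq> dirac0" "Re z < 0"
  shows "chi \<mu> (Psi \<mu> z) = z"
  unfolding chi_def using Psi_inj_on_left_half_plane[OF assms(1,2)] assms(3)
  by (simp add: Psi_region_P_plus[OF assms(1)] inv_into_f_f)

lemma S_domain_square_image:
  assumes "\<mu> \<in> P_sym" "\<mu> \<noteq> dirac0"
  shows "S_domain (square_image \<mu>) = S_domain \<mu>"
proof -
  define H where "H = {z::complex. Im z < 0 \<and> \<bar>Re z\<bar> < \<bar>Im z\<bar>}"
  have "real_distribution \<mu>" using assms by (simp add: P_sym_def)
  then have "S_domain (square_image \<mu>) = Psi (square_image \<mu>) ` {z. Re z < 0}"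
    by (simp add: S_domain_def Psi_region_P_plus square_image_P_plus)
  also have "\<dots> = Psi (square_image \<mu>) ` (\<lambda>z. z\<^sup>2) ` H"
    using square_bij_sector by (simp add: bij_betw_def H_def)
  also have "\<dots> = Psi \<mu> ` H"
    unfolding image_image using Psi_square_image[OF assms(1)] by (intro image_cong) (auto simp: H_def)
  also have "\<dots> = S_domain \<mu>"
    by (simp add: S_domain_def Psi_region_P_sym[OF assms] H_def)
  finally show ?thesis .
qed

text \<open>Injectivity is invoked for the squared law only: whichever preimage
  \<open>inv_into\<close> picks in the sector, its square is the unique preimage in the left
  half-plane.\<close>

lemma chi_square_image:
  assumes "\<mu> \<in> P_sym" "\<mu> \<noteq> dirac0" "z \<in> S_domain \<mu>"
  shows "chi (square_image \<mu>) z = (chi \<mu> z)\<^sup>2"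
proof -
  define v where "v = chi \<mu> z"
  have v: "v \<in> Psi_region \<mu>" "Psi \<mu> v = z"
    using assms(3) unfolding v_def chi_def S_domain_def by (rule inv_into_into, rule f_inv_into_f)
  then have v': "Im v < 0" "\<bar>Re v\<bar> < \<bar>Im v\<bar>" by (auto simp: Psi_region_P_sym[OF assms(1,2)])
  have rd: "real_distribution \<mu>" using assms by (simp add: P_sym_def)
  have "Re (v\<^sup>2) < 0" using square_bij_sector v' by (auto simp: bij_betw_def)
  then have "chi (square_image \<mu>) (Psi (square_image \<mu>) (v\<^sup>2)) = v\<^sup>2"
    by (intro chi_Psi square_image_P_plus square_image_neq_dirac0 rd assms)
  then show ?thesis using Psi_square_image[OF assms(1) v'] v by (simp add: v_def)
qed

text \<open>The inverse is squared while \<open>(1 + z) / z\<close> occurs only once on the left,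
  whence the factor \<open>z / (1 + z)\<close>. At \<open>z = 0\<close> and \<open>z = -1\<close>
  both sides are 0 by the division convention.\<close>

lemma S_transform_square_image:
  assumes "\<mu> \<in> P_sym" "\<mu> \<noteq> dirac0" "z \<in> S_domain \<mu>"
  shows "S_transform (square_image \<mu>) z = z / (1 + z) * (S_transform \<mu> z)\<^sup>2"
  unfolding S_transform_def chi_square_image[OF assms] power_mult_distrib
  by (cases "z = 0"; cases "1 + z = 0") (simp_all add: power2_eq_square)

section \<open>The semicircle law and the Marchenko-Pastur law\<close>

lemma nn_integral_lborel_uminus:
  assumes "f \<in> borel_measurable (borel :: real measure)"
  shows "(\<integral>\<^sup>+x. f (- x) \<partial>lborel) = (\<integral>\<^sup>+x. f x \<partial>lborel)"
proof -
  have "(\<integral>\<^sup>+x. f x \<partial>distr lborel borel uminus) = (\<integral>\<^sup>+x. f (- x) \<partial>lborel)"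
    by (rule nn_integral_distr) (use assms in simp_all)
  then show ?thesis by (simp add: lborel_distr_uminus)
qed

lemma nn_integral_lborel_even:
  assumes [measurable]: "f \<in> borel_measurable (borel :: real measure)" and even: "\<And>x. f (- x) = f x"
  shows "(\<integral>\<^sup>+x. f x \<partial>lborel) = 2 * (\<integral>\<^sup>+x. f x * indicator {0..} x \<partial>lborel)"
proof -
  have "(\<integral>\<^sup>+x. f x \<partial>lborel) = (\<integral>\<^sup>+x. f x * indicator {0..} x + f x * indicator {..0} x \<partial>lborel)"
  proof (rule nn_integral_cong_AE)
    show "AE x in lborel. f x = f x * indicator {0..} x + f x * indicator {..0} x"
      using AE_lborel_singleton[of 0] by eventually_elim (auto split: split_indicator)
  qed
  also have "\<dots> = (\<integral>\<^sup>+x. f x * indicator {0..} x \<partial>lborel) + (\<integral>\<^sup>+x. f x * indicator {..0} x \<partial>lborel)"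
    by (rule nn_integral_add) auto
  also have "(\<integral>\<^sup>+x. f x * indicator {..0} x \<partial>lborel) = (\<integral>\<^sup>+x. f (- x) * indicator {..0} (- x) \<partial>lborel)"
    by (rule nn_integral_lborel_uminus[symmetric]) auto
  also have "\<dots> = (\<integral>\<^sup>+x. f x * indicator {0..} x \<partial>lborel)"
    by (rule nn_integral_cong) (auto simp: even split: split_indicator)
  finally show ?thesis by (simp add: mult_2)
qed

lemma sets_wigner [simp]: "sets wigner = sets borel" and space_wigner [simp]: "space wigner = UNIV"
  by (simp_all add: wigner_def)

lemma four_minus_square_pos: "-2 < x \<Longrightarrow> x < 2 \<Longrightarrow> 0 < 4 - (x::real)\<^sup>2"
  using power2_strict_mono[of x 2] by (simp add: abs_less_iff)

text \<open>Evenness folds the line onto \<open>[0, 2]\<close>, and \<open>y = x^2\<close> matches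
  the densities because \<open>4 - (x^2 - 2)^2 = x^2 (4 - x^2)\<close>: the root \<open>x\<close>
  and the Jacobian \<open>2 x\<close> cancel the pole \<open>1 / x^2\<close> and leave the factor 2
  from the folding.\<close>

lemma square_image_wigner: "square_image wigner = marchenko_pastur"
proof (rule measure_eqI)
  show "sets (square_image wigner) = sets marchenko_pastur"
    by (simp add: square_image_def marchenko_pastur_def)
  fix A assume "A \<in> sets (square_image wigner)"
  then have A[measurable]: "A \<in> sets borel" by (simp add: square_image_def)
  have [measurable]: "power2 -` A \<in> sets borel"
    using measurable_sets[of power2 borel borel A] by simp
  define f where "f x = 1 / (2 * pi) * sqrt (4 - x\<^sup>2) * indicator {-2<..<2} x" for x :: real
  define g where "g x = 1 / (2 * pi * x) * sqrt (4 - (x - 2)\<^sup>2)" for x :: real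
  have [measurable]: "f \<in> borel_measurable borel" unfolding f_def by measurable
  have [measurable]: "g \<in> borel_measurable borel" unfolding g_def by measurable
  have "emeasure (square_image wigner) A = (\<integral>\<^sup>+x. ennreal (f x) * indicator A (x\<^sup>2) \<partial>lborel)"
    unfolding square_image_def wigner_def
    by (subst emeasure_distr, simp, simp, subst emeasure_density)
       (auto intro!: nn_integral_cong simp: f_def split: split_indicator)
  also have "\<dots> = 2 * (\<integral>\<^sup>+x. ennreal (f x) * indicator A (x\<^sup>2) * indicator {0..} x \<partial>lborel)"
    by (rule nn_integral_lborel_even) (auto simp: f_def split: split_indicator)
  also have "\<dots> = (\<integral>\<^sup>+x. 2 * (ennreal (f x) * indicator A (x\<^sup>2) * indicator {0..} x) \<partial>lborel)"
    by (rule nn_integral_cmult[symmetric]) simp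
  also have "\<dots> = (\<integral>\<^sup>+x. ennreal (g (x\<^sup>2) * indicator A (x\<^sup>2) * (2 * x) * indicator {0..2} x) \<partial>lborel)"
  proof (rule nn_integral_cong_AE)
    show "AE x in lborel. 2 * (ennreal (f x) * indicator A (x\<^sup>2) * indicator {0..} x) =
       ennreal (g (x\<^sup>2) * indicator A (x\<^sup>2) * (2 * x) * indicator {0..2} x)"
      using AE_lborel_singleton[of 0] AE_lborel_singleton[of 2]
    proof eventually_elim
      case (elim x)
      show ?case
      proof (cases "0 < x \<and> x < 2")
        case True
        have "4 - (x\<^sup>2 - 2)\<^sup>2 = x\<^sup>2 * (4 - x\<^sup>2)" by (simp add: power2_eq_square algebra_simps)
        then have "sqrt (4 - (x\<^sup>2 - 2)\<^sup>2) = x * sqrt (4 - x\<^sup>2)"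
          using True by (simp add: real_sqrt_mult)
        then have "g (x\<^sup>2) * (2 * x) = 2 * f x"
          using True by (simp add: g_def f_def power2_eq_square)
        moreover have "0 \<le> f x" using True four_minus_square_pos[of x] by (simp add: f_def)
        ultimately have "ennreal (g (x\<^sup>2) * (2 * x)) = 2 * ennreal (f x)"
          by (metis ennreal_mult ennreal_numeral zero_le_numeral)
        then show ?thesis using True by (cases "x\<^sup>2 \<in> A") simp_all
      next
        case False
        then show ?thesis using elim by (auto simp: f_def split: split_indicator)
      qed
    qed
  qed
  also have "\<dots> = (\<integral>\<^sup>+y. ennreal (g y * indicator A y * indicator {0\<^sup>2..2\<^sup>2} y) \<partial>lborel)"
    by (rule nn_integral_substitution[symmetric])
       (auto simp: set_borel_measurable_def intro!: derivative_eq_intros continuous_intros)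
  also have "\<dots> = emeasure marchenko_pastur A"
    unfolding marchenko_pastur_def
    by (subst emeasure_density) (auto intro!: nn_integral_cong simp: g_def split: split_indicator)
  finally show "emeasure (square_image wigner) A = emeasure marchenko_pastur A" .
qed

text \<open>For \<open>c = 1\<close> the derivative is \<open>1 / sqrt (4 - x^2)\<close>; a general
  \<open>c\<close> adds a quadratic in \<open>x\<close> to the denominator. The total mass and the
  Stieltjes integral of the semicircle law are both assembled from this family.\<close>

lemma DERIV_arctan_over_sqrt:
  fixes c x :: real
  assumes "-2 < x" "x < 2"
  shows "DERIV (\<lambda>x. arctan (c * x / sqrt (4 - x\<^sup>2))) x :>
    4 * c / (sqrt (4 - x\<^sup>2) * (4 - x\<^sup>2 + c\<^sup>2 * x\<^sup>2))"
proof -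
  define r where "r = sqrt (4 - x\<^sup>2)"
  have pos: "0 < 4 - x\<^sup>2" by (rule four_minus_square_pos[OF assms])
  have r: "0 < r" and r2: "r\<^sup>2 = 4 - x\<^sup>2" using pos by (auto simp: r_def)
  have "DERIV (\<lambda>x. sqrt (4 - x\<^sup>2)) x :> - x / r"
    using pos by (auto intro!: derivative_eq_intros simp: r_def field_simps)
  moreover have "DERIV (\<lambda>x. c * x) x :> c" by (auto intro!: derivative_eq_intros)
  ultimately have "DERIV (\<lambda>x. c * x / sqrt (4 - x\<^sup>2)) x :> (c * r - c * x * (- x / r)) / (r * r)"
    using DERIV_divide[of "\<lambda>x. c * x" c x UNIV "\<lambda>x. sqrt (4 - x\<^sup>2)" "- x / r"] r
    by (simp add: r_def[symmetric])
  also have "(c * r - c * x * (- x / r)) / (r * r) = c * (r\<^sup>2 + x\<^sup>2) / r ^ 3"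
    using r by (simp add: field_simps power2_eq_square power3_eq_cube)
  also have "\<dots> = 4 * c / r ^ 3" by (simp add: r2)
  finally have "DERIV (\<lambda>x. arctan (c * x / sqrt (4 - x\<^sup>2))) x :>
      inverse (1 + (c * x / r)\<^sup>2) * (4 * c / r ^ 3)"
    unfolding r_def by (rule DERIV_chain2[OF DERIV_arctan])
  also have "inverse (1 + (c * x / r)\<^sup>2) = r\<^sup>2 / (r\<^sup>2 + c\<^sup>2 * x\<^sup>2)"
    using r by (simp add: field_simps power_mult_distrib)
  also have "r\<^sup>2 / (r\<^sup>2 + c\<^sup>2 * x\<^sup>2) * (4 * c / r ^ 3) = 4 * c / (r * (r\<^sup>2 + c\<^sup>2 * x\<^sup>2))"
    using r by (simp add: power2_eq_square power3_eq_cube)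
  finally show ?thesis by (simp add: r2 flip: r_def)
qed

lemma real_distribution_wigner: "real_distribution wigner"
proof -
  define F where "F x = (x * sqrt (4 - x\<^sup>2) / 2 + 2 * arctan (1 * x / sqrt (4 - x\<^sup>2))) / (2 * pi)"
    for x
  define f where "f x = 1 / (2 * pi) * sqrt (4 - x\<^sup>2)" for x :: real
  have F: "DERIV F x :> f x" if "-2 < x" "x < 2" for x
  proof -
    define r where "r = sqrt (4 - x\<^sup>2)"
    have pos: "0 < 4 - x\<^sup>2" by (rule four_minus_square_pos[OF that])
    have r: "0 < r" and r2: "r\<^sup>2 = 4 - x\<^sup>2" using pos by (auto simp: r_def)
    have "DERIV (\<lambda>x. sqrt (4 - x\<^sup>2)) x :> - x / r"
      using pos by (auto intro!: derivative_eq_intros simp: r_def field_simps)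
    then have "DERIV F x :> ((1 * r + - x / r * x) / 2 + 2 * (4 * 1 / (r * (4 - x\<^sup>2 + 1\<^sup>2 * x\<^sup>2)))) / (2 * pi)"
      unfolding F_def r_def
      by (intro DERIV_cdivide DERIV_add DERIV_cmult DERIV_mult DERIV_ident DERIV_arctan_over_sqrt[OF that])
    also have "((1 * r + - x / r * x) / 2 + 2 * (4 * 1 / (r * (4 - x\<^sup>2 + 1\<^sup>2 * x\<^sup>2)))) / (2 * pi)
        = (r\<^sup>2 + (4 - x\<^sup>2)) / (2 * r) / (2 * pi)"
      using r by (simp add: field_simps power2_eq_square)
    also have "\<dots> = f x" using r r2[symmetric] by (simp add: f_def r_def[symmetric] power2_eq_square)
    finally show ?thesis .
  qed
  \<comment> \<open>At \<open>- 2\<close> and \<open>2\<close> the argument of \<open>arctan\<close>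
    is 0 by the division convention, so \<open>F\<close> jumps there. The one-sided limits are the
    correct boundary values, and their difference is the total mass 1.\<close>
  have "((\<lambda>x. F x) \<longlongrightarrow> - 1 / 2) (at_right (- 2))" unfolding F_def by real_asymp
  then have A: "((F \<circ> real_of_ereal) \<longlongrightarrow> - 1 / 2) (at_right (ereal (- 2)))"
    by (simp add: ereal_tendsto_simps)
  have "((\<lambda>x. F x) \<longlongrightarrow> 1 / 2) (at_left 2)" unfolding F_def by real_asymp
  then have B: "((F \<circ> real_of_ereal) \<longlongrightarrow> 1 / 2) (at_left (ereal 2))"
    by (simp add: ereal_tendsto_simps)
  have f_nonneg: "0 \<le> f x" if "-2 < x" "x < 2" for x
    using four_minus_square_pos[OF that] by (simp add: f_def)
  have cont: "isCont f x" for x unfolding f_def by (intro continuous_intros)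
  have int: "set_integrable lborel {-2<..<2} f"
    and val: "(LINT x:{-2<..<2}|lborel. f x) = 1"
    using interval_integral_FTC_nonneg[OF _ _ _ _ A B, of f] F cont f_nonneg
    by (auto simp: interval_lebesgue_integral_def)
  have "emeasure wigner (space wigner) = (\<integral>\<^sup>+x. ennreal (indicator {-2<..<2} x *\<^sub>R f x) \<partial>lborel)"
    unfolding space_wigner unfolding wigner_def
    by (subst emeasure_density) (auto simp: f_def intro!: nn_integral_cong split: split_indicator)
  also have "\<dots> = ennreal (LINT x:{-2<..<2}|lborel. f x)"
    unfolding set_lebesgue_integral_def
    by (rule nn_integral_eq_integral)
       (use int f_nonneg in \<open>auto simp: set_integrable_def split: split_indicator\<close>)
  finally have "prob_space wigner" by (intro prob_spaceI) (simp add: val)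
  then show ?thesis by (simp add: real_distribution_def real_distribution_axioms_def)
qed

lemma wigner_P_sym: "wigner \<in> P_sym"
proof -
  have "distr wigner borel uminus = wigner"
  proof (rule measure_eqI)
    fix A assume "A \<in> sets (distr wigner borel uminus)"
    then have [measurable]: "A \<in> sets borel" by simp
    have [measurable]: "uminus -` A \<in> sets borel"
      using measurable_sets[of uminus borel borel A] by simp
    define f where "f x = 1 / (2 * pi) * sqrt (4 - x\<^sup>2) * indicator {-2<..<2} x" for x :: real
    have [measurable]: "f \<in> borel_measurable borel" unfolding f_def by measurable
    have even: "f (- x) = f x" for x by (auto simp: f_def split: split_indicator)
    have "emeasure (distr wigner borel uminus) A = (\<integral>\<^sup>+x. ennreal (f x) * indicator A (- x) \<partial>lborel)"
      unfolding wigner_def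
      by (subst emeasure_distr, simp, simp, subst emeasure_density)
         (auto intro!: nn_integral_cong simp: f_def split: split_indicator)
    also have "\<dots> = (\<integral>\<^sup>+x. ennreal (f (- x)) * indicator A (- (- x)) \<partial>lborel)"
      by (rule nn_integral_lborel_uminus[symmetric]) simp
    also have "\<dots> = emeasure wigner A"
      unfolding wigner_def even minus_minus by (subst emeasure_density) (simp_all add: f_def)
    finally show "emeasure (distr wigner borel uminus) A = emeasure wigner A" .
  qed simp
  then show ?thesis using real_distribution_wigner by (simp add: P_sym_def)
qed

lemma wigner_neq_dirac0: "wigner \<noteq> dirac0"
proof
  assume eq: "wigner = dirac0"
  have "emeasure wigner {0} = 1" unfolding eq by simp
  moreover have "emeasure wigner {0} = (\<integral>\<^sup>+x. 0 \<partial>(lborel :: real measure))"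
    unfolding wigner_def
  proof (subst emeasure_density, simp, simp, rule nn_integral_cong_AE)
    show "AE x in lborel. ennreal (1 / (2 * pi) * sqrt (4 - x\<^sup>2) * indicator {-2<..<2} x) *
        indicator {0} x = 0"
      using AE_lborel_singleton[of 0] by eventually_elim auto
  qed
  ultimately show False by simp
qed

text \<open>The substitution \<open>s = z / (1 + z)^2\<close> makes \<open>1 - 4 s\<close> the
  square of \<open>k = (1 - z) / (1 + z)\<close>, which removes the square root from the solution of
  the quadratic equation for the transform.\<close>

lemma semicircle_stieltjes:
  fixes z :: real
  assumes z: "-1 < z" "z < 0"
  shows "(LINT x|wigner. 1 / (1 - z / (1 + z)\<^sup>2 * x\<^sup>2)) = 1 + z"
proof -
  define s where "s = z / (1 + z)\<^sup>2"
  define k where "k = (1 - z) / (1 + z)"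
  have k: "0 < k" and s: "s < 0" using z by (auto simp: k_def s_def divide_neg_pos)
  have "k\<^sup>2 = (1 - z)\<^sup>2 / (1 + z)\<^sup>2" by (simp add: k_def power_divide)
  also have "\<dots> = ((1 + z)\<^sup>2 - 4 * z) / (1 + z)\<^sup>2" by (simp add: power2_eq_square algebra_simps)
  also have "\<dots> = 1 - 4 * s" using z by (simp add: s_def diff_divide_distrib)
  finally have ks: "k\<^sup>2 = 1 - 4 * s" .
  define f where "f x = sqrt (4 - x\<^sup>2) / (1 - s * x\<^sup>2)" for x
  \<comment> \<open>Partial fractions: since \<open>1 - k^2 = 4 s\<close>, the integrand is
    \<open>1 / s\<close> times \<open>1 / r - k^2 / (r (1 - s x^2))\<close> with
    \<open>r = sqrt (4 - x^2)\<close>. The two terms are the derivatives of the arctan with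
    \<open>c = 1\<close> and of \<open>k\<close> times the arctan with \<open>c = k\<close>.\<close>
  define F where "F x = (arctan (1 * x / sqrt (4 - x\<^sup>2)) - k * arctan (k * x / sqrt (4 - x\<^sup>2))) / s" for x
  have den: "0 < 1 - s * x\<^sup>2" for x using s by (smt (verit) mult_nonpos_nonneg zero_le_power2)
  have F: "DERIV F x :> f x" if "-2 < x" "x < 2" for x
  proof -
    define r where "r = sqrt (4 - x\<^sup>2)"
    have pos: "0 < 4 - x\<^sup>2" by (rule four_minus_square_pos[OF that])
    have r: "0 < r" and r2: "r\<^sup>2 = 4 - x\<^sup>2" using pos by (auto simp: r_def)
    have "DERIV F x :> (4 * 1 / (r * (4 - x\<^sup>2 + 1\<^sup>2 * x\<^sup>2)) - k * (4 * k / (r * (4 - x\<^sup>2 + k\<^sup>2 * x\<^sup>2)))) / s"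
      unfolding F_def r_def
      by (intro DERIV_cdivide DERIV_diff DERIV_cmult DERIV_arctan_over_sqrt[OF that])
    also have "4 - x\<^sup>2 + k\<^sup>2 * x\<^sup>2 = 4 * (1 - s * x\<^sup>2)" by (simp add: ks algebra_simps)
    also have "(4 * 1 / (r * (4 - x\<^sup>2 + 1\<^sup>2 * x\<^sup>2)) - k * (4 * k / (r * (4 * (1 - s * x\<^sup>2))))) / s
        = (1 / r - k\<^sup>2 / (r * (1 - s * x\<^sup>2))) / s"
    proof -
      have *: "k * (4 * k / (r * (4 * u))) = k\<^sup>2 / (r * u)" for u by (simp add: power2_eq_square)
      show ?thesis unfolding * by simp
    qed
    also have "\<dots> = (1 - s * x\<^sup>2 - k\<^sup>2) / (r * (1 - s * x\<^sup>2)) / s"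
    proof -
      have "1 / r - k\<^sup>2 / (r * u) = (u - k\<^sup>2) / (r * u)" if "0 < u" for u
        using r that by (simp add: field_simps)
      then show ?thesis using den[of x] by simp
    qed
    also have "1 - s * x\<^sup>2 - k\<^sup>2 = s * r\<^sup>2" by (simp add: r2 ks algebra_simps)
    also have "s * r\<^sup>2 / (r * (1 - s * x\<^sup>2)) / s = r\<^sup>2 / (r * (1 - s * x\<^sup>2))"
      using s by simp
    also have "\<dots> = f x" using r unfolding f_def r_def[symmetric] by (simp add: power2_eq_square)
    finally show ?thesis .
  qed
  have "((\<lambda>x. F x) \<longlongrightarrow> (k * pi / 2 - pi / 2) * inverse s) (at_right (- 2))"
    unfolding F_def using k s by real_asymp
  then have A: "((F \<circ> real_of_ereal) \<longlongrightarrow> (k * pi / 2 - pi / 2) * inverse s) (at_right (ereal (- 2)))"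
    by (simp add: ereal_tendsto_simps)
  have "((\<lambda>x. F x) \<longlongrightarrow> (pi / 2 - k * pi / 2) * inverse s) (at_left 2)"
    unfolding F_def using k s by real_asymp
  then have B: "((F \<circ> real_of_ereal) \<longlongrightarrow> (pi / 2 - k * pi / 2) * inverse s) (at_left (ereal 2))"
    by (simp add: ereal_tendsto_simps)
  have f_nonneg: "0 \<le> f x" if "-2 < x" "x < 2" for x
    using four_minus_square_pos[OF that] den[of x] by (simp add: f_def)
  have cont: "isCont f x" for x
    unfolding f_def using den[of x] by (intro continuous_intros) auto
  have "(LINT x:{-2<..<2}|lborel. f x) = (pi / 2 - k * pi / 2) * inverse s - (k * pi / 2 - pi / 2) * inverse s"
    using interval_integral_FTC_nonneg(2)[OF _ _ _ _ A B, of f] F cont f_nonneg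
    by (simp add: interval_lebesgue_integral_def)
  also have "\<dots> = pi * (1 - k) / s" using s by (simp add: field_simps)
  finally have val: "(LINT x:{-2<..<2}|lborel. f x) = pi * (1 - k) / s" .
  have dens_nonneg: "0 \<le> 1 / (2 * pi) * sqrt (4 - x\<^sup>2) * indicator {-2<..<2} x" for x :: real
    using four_minus_square_pos[of x] by (cases "x \<in> {-2<..<2}") simp_all
  have "(LINT x|wigner. 1 / (1 - s * x\<^sup>2)) = (LINT x|lborel. 1 / (2 * pi) * (indicator {-2<..<2} x *\<^sub>R f x))"
    unfolding wigner_def
    by (subst integral_density[OF _ _ AE_I2[OF dens_nonneg]])
       (auto simp: f_def intro!: Bochner_Integration.integral_cong split: split_indicator)
  also have "\<dots> = 1 / (2 * pi) * (LINT x:{-2<..<2}|lborel. f x)"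
    unfolding set_lebesgue_integral_def by (rule integral_mult_right_zero)
  also have "\<dots> = (1 - k) / (2 * s)" by (simp add: val)
  also have "\<dots> = 1 + z"
  proof -
    have "1 - k = 2 * z / (1 + z)" using z by (simp add: k_def field_simps)
    also have "\<dots> = 2 * s * (1 + z)" using z by (simp add: s_def power2_eq_square)
    finally show ?thesis using s by simp
  qed
  finally show ?thesis by (simp add: s_def)
qed

text \<open>Transported along \<open>square_image_wigner\<close>, the kernel becomes
  \<open>1 / (1 - s x^2) - 1\<close>, whose semicircle integral is known.\<close>

lemma Psi_marchenko_pastur:
  fixes z :: real
  assumes "-1 < z" "z < 0"
  shows "Psi marchenko_pastur (of_real (z / (1 + z)\<^sup>2)) = of_real z"
proof -
  define s where "s = z / (1 + z)\<^sup>2"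
  interpret W: real_distribution wigner by (rule real_distribution_wigner)
  have "s < 0" using assms by (simp add: s_def divide_neg_pos)
  then have den: "1 \<le> 1 - s * x\<^sup>2" for x by (simp add: mult_nonpos_nonneg)
  have int: "integrable wigner (\<lambda>x. 1 / (1 - s * x\<^sup>2))"
  proof (rule integrable_bounded_real_distribution[OF real_distribution_wigner, where B = 1])
    show "AE x in wigner. norm (1 / (1 - s * x\<^sup>2)) \<le> 1"
    proof (rule AE_I2)
      fix x show "norm (1 / (1 - s * x\<^sup>2)) \<le> 1" using den[of x] by simp
    qed
  qed simp
  have "Psi marchenko_pastur (of_real s) = (LINT x|wigner. complex_of_real (1 / (1 - s * x\<^sup>2) - 1))"
    unfolding Psi_def square_image_wigner[symmetric] square_image_def
  proof (subst integral_distr, simp, simp, rule Bochner_Integration.integral_cong[OF refl])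
    fix x
    have "s * \<bar>x\<bar>\<^sup>2 / (1 - s * \<bar>x\<bar>\<^sup>2) = 1 / (1 - s * x\<^sup>2) - 1"
      using den[of x] by (simp add: field_simps)
    then show "complex_of_real s * complex_of_real (\<bar>x\<bar>\<^sup>2) / (1 - complex_of_real s * complex_of_real (\<bar>x\<bar>\<^sup>2)) =
        complex_of_real (1 / (1 - s * x\<^sup>2) - 1)"
      by (metis of_real_1 of_real_diff of_real_divide of_real_mult)
  qed
  also have "\<dots> = of_real (LINT x|wigner. 1 / (1 - s * x\<^sup>2) - 1)"
    by (rule integral_complex_of_real)
  also have "(LINT x|wigner. 1 / (1 - s * x\<^sup>2) - 1) = z"
    using int semicircle_stieltjes[OF assms] W.prob_space by (simp flip: s_def)
  finally show ?thesis by (simp add: s_def)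
qed

lemma marchenko_pastur_P_plus: "marchenko_pastur \<in> P_plus"
  and marchenko_pastur_neq_dirac0: "marchenko_pastur \<noteq> dirac0"
  using square_image_P_plus[OF real_distribution_wigner]
    square_image_neq_dirac0[OF real_distribution_wigner wigner_neq_dirac0]
  by (simp_all add: square_image_wigner)

lemma chi_marchenko_pastur:
  fixes z :: real
  assumes "-1 < z" "z < 0"
  shows "chi marchenko_pastur (of_real z) = of_real (z / (1 + z)\<^sup>2)"
proof -
  have "z / (1 + z)\<^sup>2 < 0" using assms by (simp add: divide_neg_pos)
  then have "Re (complex_of_real (z / (1 + z)\<^sup>2)) < 0" by (simp only: Re_complex_of_real)
  then show ?thesis
    using chi_Psi[OF marchenko_pastur_P_plus marchenko_pastur_neq_dirac0]
      Psi_marchenko_pastur[OF assms] by metis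
qed

section \<open>The product formula for the law of the square\<close>

lemma is_free_mult_conv_wigner:
  assumes conv: "is_free_mult_conv \<tau> wigner \<mu>" and \<tau>: "\<tau> \<noteq> dirac0"
  shows "\<mu> \<in> P_sym" "\<mu> \<noteq> dirac0"
  using assms wigner_neq_dirac0 wigner_P_sym P_plus_inter_P_sym[of wigner]
  by (auto simp: is_free_mult_conv_def)

text \<open>\<open>is_free_mult_conv\<close> allows a positive or a symmetric second factor. A law
  in both classes is the point mass at 0, so nondegeneracy selects the positive alternative.\<close>

lemma is_free_mult_conv_P_plus:
  assumes "is_free_mult_conv \<tau> \<tau>' \<rho>" "\<tau>' \<in> P_plus" "\<tau> \<noteq> dirac0" "\<tau>' \<noteq> dirac0"
  shows "\<rho> \<in> P_plus" "\<rho> \<noteq> dirac0"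
  using assms P_plus_inter_P_sym[of \<tau>'] by (auto simp: is_free_mult_conv_def)

lemma is_free_mult_conv_square_image:
  assumes \<tau>: "\<tau> \<noteq> dirac0"
    and conv1: "is_free_mult_conv \<tau> \<tau> \<sigma>" and conv2: "is_free_mult_conv \<tau> wigner \<mu>"
  shows "is_free_mult_conv \<sigma> marchenko_pastur (square_image \<mu>)"
proof -
  note \<mu> = is_free_mult_conv_wigner[OF conv2 \<tau>]
  have rd: "real_distribution \<mu>" using \<mu> by (simp add: P_sym_def)
  have "\<tau> \<in> P_plus" using conv1 by (simp add: is_free_mult_conv_def)
  note \<sigma> = is_free_mult_conv_P_plus[OF conv1 this \<tau> \<tau>]
  obtain D1 e1 where D1: "0 < e1" "open D1" "of_real ` {-e1<..<0::real} \<subseteq> D1"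
    "D1 \<subseteq> S_domain \<sigma>" "\<And>z. z \<in> D1 \<Longrightarrow> S_transform \<sigma> z = S_transform \<tau> z * S_transform \<tau> z"
    using conv1 \<tau> unfolding is_free_mult_conv_def by auto
  obtain D2 e2 where D2: "0 < e2" "open D2" "of_real ` {-e2<..<0::real} \<subseteq> D2"
    "D2 \<subseteq> S_domain wigner \<inter> S_domain \<mu>"
    "\<And>z. z \<in> D2 \<Longrightarrow> S_transform \<mu> z = S_transform \<tau> z * S_transform wigner z"
    using conv2 \<tau> wigner_neq_dirac0 unfolding is_free_mult_conv_def by auto
  define e where "e = min e1 e2"
  define I where "I = complex_of_real ` {-e<..<0}"
  \<comment> \<open>\<open>D1 \<inter> D2\<close> may be disconnected; the component through one
    point of the interval is still open and contains the whole interval.\<close>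
  define D where "D = connected_component_set (D1 \<inter> D2) (of_real (- e / 2))"
  have e: "0 < e" using D1 D2 by (simp add: e_def)
  have "I \<subseteq> D1 \<inter> D2" using D1(3) D2(3) by (force simp: I_def e_def)
  moreover have "connected I" unfolding I_def
    by (intro connected_continuous_image continuous_intros) simp
  moreover have "of_real (- e / 2) \<in> I" unfolding I_def by (rule imageI) (use e in simp)
  ultimately have "I \<subseteq> D" unfolding D_def by (intro connected_component_maximal)
  have D_sub: "D \<subseteq> D1 \<inter> D2" unfolding D_def by (rule connected_component_subset)
  have "open D" "connected D"
    using D1(2) D2(2) by (auto simp: D_def open_connected_component open_Int)
  have dom: "D \<subseteq> S_domain \<sigma> \<inter> S_domain marchenko_pastur \<inter> S_domain (square_image \<mu>)"
    using D_sub D1(4) D2(4) S_domain_square_image[OF \<mu>]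
      S_domain_square_image[OF wigner_P_sym wigner_neq_dirac0]
    by (auto simp: square_image_wigner)
  have "S_transform (square_image \<mu>) z = S_transform \<sigma> z * S_transform marchenko_pastur z" if "z \<in> D" for z
  proof -
    have z: "z \<in> D1" "z \<in> D2" "z \<in> S_domain wigner" "z \<in> S_domain \<mu>" using that D_sub D2(4) by auto
    have "S_transform (square_image \<mu>) z = z / (1 + z) * (S_transform \<tau> z * S_transform wigner z)\<^sup>2"
      by (simp add: S_transform_square_image[OF \<mu> z(4)] D2(5)[OF z(2)])
    also have "\<dots> = (S_transform \<tau> z)\<^sup>2 * (z / (1 + z) * (S_transform wigner z)\<^sup>2)"
      by (simp add: power_mult_distrib)
    also have "z / (1 + z) * (S_transform wigner z)\<^sup>2 = S_transform marchenko_pastur z"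
      using S_transform_square_image[OF wigner_P_sym wigner_neq_dirac0 z(3)]
      by (simp add: square_image_wigner)
    finally show ?thesis by (simp add: D1(5)[OF z(1)] power2_eq_square)
  qed
  then have "\<exists>D e. 0 < e \<and> open D \<and> connected D \<and> of_real ` {-e<..<0::real} \<subseteq> D \<and>
       D \<subseteq> S_domain \<sigma> \<inter> S_domain marchenko_pastur \<inter> S_domain (square_image \<mu>) \<and>
       (\<forall>z\<in>D. S_transform (square_image \<mu>) z = S_transform \<sigma> z * S_transform marchenko_pastur z)"
    using e \<open>open D\<close> \<open>connected D\<close> \<open>I \<subseteq> D\<close> dom unfolding I_def by blast
  then show ?thesis
    using \<sigma> marchenko_pastur_P_plus marchenko_pastur_neq_dirac0 square_image_P_plus[OF rd]
      square_image_neq_dirac0[OF rd \<mu>(2)]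
    by (simp add: is_free_mult_conv_def)
qed

section \<open>The free cumulant transform of a free compound Poisson law\<close>

text \<open>Solving \<open>C z = z * K (1 / z) - 1\<close> for \<open>K\<close>, with
  \<open>C z = of_real t * Psi \<sigma> z\<close>, gives this function.\<close>

definition poisson_K :: "real \<Rightarrow> real measure \<Rightarrow> complex \<Rightarrow> complex" where
  "poisson_K t \<sigma> w = w * (1 + of_real t * Psi \<sigma> (1 / w))"

lemma poisson_K_holomorphic:
  assumes "\<sigma> \<in> P_plus" "S \<inter> \<real>\<^sub>\<ge>\<^sub>0 = {}"
  shows "poisson_K t \<sigma> holomorphic_on S"
proof -
  have "(\<lambda>w. w * (1 + of_real t * (w * cauchy_transform \<sigma> w - 1))) holomorphic_on S"
    by (intro holomorphic_intros cauchy_transform_holomorphic_P_plus assms)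
  then show ?thesis
  proof (rule holomorphic_transform)
    fix w assume "w \<in> S"
    then have "1 + Psi \<sigma> (1 / w) = w * cauchy_transform \<sigma> w"
      using assms by (intro one_plus_Psi_P_plus) auto
    then have "Psi \<sigma> (1 / w) = w * cauchy_transform \<sigma> w - 1" by (simp add: algebra_simps)
    then show "w * (1 + of_real t * (w * cauchy_transform \<sigma> w - 1)) = poisson_K t \<sigma> w"
      by (simp add: poisson_K_def)
  qed
qed

text \<open>This half-plane keeps a fixed angle from the positive axis: for
  \<open>Re w \<le> 0\<close> the distance to \<open>x\<close> is at least \<open>cmod w\<close>,
  and otherwise \<open>0 < Re w < Im w\<close> bounds \<open>cmod w\<close> by twice the imaginary
  part.\<close>

lemma norm_le_twice_norm_diff:
  assumes "Re w < Im w" "0 \<le> x"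
  shows "cmod w \<le> 2 * cmod (w - of_real x)"
proof (cases "Re w \<le> 0")
  case True
  have "(Re w)\<^sup>2 \<le> (Re w - x)\<^sup>2" using True assms by (simp add: abs_le_square_iff[symmetric])
  then have "cmod w \<le> cmod (w - of_real x)" by (simp add: cmod_def)
  then show ?thesis using norm_ge_zero[of "w - of_real x"] by linarith
next
  case False
  have "cmod w \<le> \<bar>Re w\<bar> + \<bar>Im w\<bar>" by (rule cmod_le)
  also have "\<dots> \<le> 2 * \<bar>Im w\<bar>" using False assms by simp
  also have "\<dots> \<le> 2 * cmod (w - of_real x)" using abs_Im_le_norm_diff_of_real[of w x] by simp
  finally show ?thesis .
qed

text \<open>Secures that the Cauchy transform of a positive law can be composed with
  \<open>poisson_K 1 \<sigma>\<close>. If \<open>w (1 + p) = r\<close> with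
  \<open>r \<ge> 0\<close>, then \<open>w\<close> is a nonnegative multiple of
  \<open>cnj (1 + p)\<close>, and \<open>cmod p < 1 / 2\<close> forces
  \<open>Re w \<ge> Im w\<close>.\<close>

lemma poisson_K_notin_nonneg_Reals:
  assumes "Re w < Im w" "cmod (Psi \<sigma> (1 / w)) < 1 / 2" "w \<noteq> 0"
  shows "poisson_K 1 \<sigma> w \<notin> \<real>\<^sub>\<ge>\<^sub>0"
proof
  define p where "p = Psi \<sigma> (1 / w)"
  assume "poisson_K 1 \<sigma> w \<in> \<real>\<^sub>\<ge>\<^sub>0"
  then obtain r where r: "0 \<le> r" "w * (1 + p) = of_real r"
    by (auto simp: poisson_K_def p_def nonneg_Reals_def)
  have p: "\<bar>Re p\<bar> < 1 / 2" "\<bar>Im p\<bar> < 1 / 2"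
    using abs_Re_le_cmod[of p] abs_Im_le_cmod[of p] assms(2) by (auto simp: p_def)
  have nz: "1 + p \<noteq> 0" using p by (auto simp: complex_eq_iff)
  define q where "q = r / (cmod (1 + p))\<^sup>2"
  have "0 \<le> q" using r by (simp add: q_def)
  have "w = of_real r / (1 + p)" using r nz by (simp add: eq_divide_eq)
  also have "\<dots> = of_real q * cnj (1 + p)"
    by (subst complex_div_cnj) (simp add: q_def)
  finally have "Re w = q * (1 + Re p)" "Im w = - q * Im p" by (simp_all add: complex_eq_iff)
  then have "0 < - (q * (1 + Re p + Im p))" using assms(1) by (simp add: algebra_simps)
  moreover have "0 \<le> q * (1 + Re p + Im p)" using \<open>0 \<le> q\<close> p by (intro mult_nonneg_nonneg) auto
  ultimately show False by simp
qed

section \<open>The right inverse of the F-transform, from the negative axis to a cone\<close>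

lemma Psi_negative_real:
  assumes \<mu>: "\<mu> \<in> P_plus" "\<mu> \<noteq> dirac0" and "s < 0"
  obtains r where "r < 0" "Psi \<mu> (of_real s) = of_real r"
proof -
  define f where "f x = s * x / (1 - s * x)" for x
  have eq: "Psi \<mu> (of_real s) = (LINT x|\<mu>. of_real (f x))"
    unfolding Psi_def f_def by simp
  have "integrable \<mu> (\<lambda>x. complex_of_real (f x))"
    using integrable_Psi_kernel[OF \<mu>(1), of "of_real s"] \<open>s < 0\<close> by (simp add: f_def)
  then have int: "integrable \<mu> f" by (simp add: complex_of_real_integrable_eq)
  have "0 < (LINT x|\<mu>. - f x)"
  proof (rule P_plus_integral_pos[OF \<mu>])
    fix x :: real assume "0 < x"
    then have "s * x < 0" using \<open>s < 0\<close> by (simp add: mult_neg_pos)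
    then show "0 < - f x" by (simp add: f_def divide_neg_pos)
  qed (use int in \<open>simp_all add: f_def[abs_def]\<close>)
  then show thesis using that[of "LINT x|\<mu>. f x"] eq by (simp add: integral_complex_of_real)
qed

text \<open>For \<open>w = - x\<close> far out, \<open>r = Psi \<sigma> (1 / w)\<close> lies in the
  interval of the product formula, which yields \<open>chi \<rho> r = 1 / (w (1 + r))\<close>. Hence
  \<open>Psi \<rho> (1 / u) = r\<close> at \<open>u = w (1 + r)\<close>, that is at
  \<open>u = poisson_K 1 \<sigma> w\<close>, and
  \<open>1 + r = u * cauchy_transform \<rho> u\<close> gives the claim.\<close>

lemma cauchy_transform_poisson_K_negative:
  assumes \<sigma>: "\<sigma> \<in> P_plus" "\<sigma> \<noteq> dirac0"
    and conv: "is_free_mult_conv \<sigma> marchenko_pastur \<rho>"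
  obtains M where "0 < M"
    "\<And>x. M < x \<Longrightarrow> cauchy_transform \<rho> (poisson_K 1 \<sigma> (of_real (- x))) = 1 / of_real (- x)"
proof -
  note \<rho> = is_free_mult_conv_P_plus(1)[OF conv marchenko_pastur_P_plus \<sigma>(2) marchenko_pastur_neq_dirac0]
  obtain D e where D: "0 < e" "of_real ` {-e<..<0::real} \<subseteq> D" "D \<subseteq> S_domain \<rho>"
    "\<And>z. z \<in> D \<Longrightarrow> S_transform \<rho> z = S_transform \<sigma> z * S_transform marchenko_pastur z"
    using conv \<sigma> marchenko_pastur_neq_dirac0 by (auto simp: is_free_mult_conv_def)
  \<comment> \<open>\<open>e\<close> keeps \<open>r\<close> inside the interval of the product
    formula; 1 keeps \<open>r > -1\<close>, where the inverse for the Marchenko-Pastur law is known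
    and \<open>1 + r\<close> is positive.\<close>
  obtain M where M: "0 < M"
    "\<And>w. M < cmod w \<Longrightarrow> (\<And>x. 0 \<le> x \<Longrightarrow> cmod w \<le> 2 * cmod (w - of_real x)) \<Longrightarrow> cmod (Psi \<sigma> (1 / w)) < min e 1"
    using Psi_inverse_tendsto_0[OF \<sigma>(1), of 2 "min e 1"] D(1) by auto
  show thesis
  proof (rule that[OF M(1)])
    fix x assume x: "M < x"
    define w where "w = complex_of_real (- x)"
    define s where "s = - 1 / x"
    have w: "1 / w = of_real s" "w \<noteq> 0" and s: "s < 0" using x M(1) by (auto simp: w_def s_def)
    obtain r where r: "r < 0" "Psi \<sigma> (of_real s) = of_real r"
      by (rule Psi_negative_real[OF \<sigma> s])
    have "cmod (Psi \<sigma> (1 / w)) < min e 1"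
      using x M(1) by (intro M(2) norm_le_twice_norm_diff) (auto simp: w_def)
    then have re: "- e < r" "- 1 < r" using r w by auto
    then have rD: "of_real r \<in> D" using D(2) r(1) by auto
    have chi_\<sigma>: "chi \<sigma> (of_real r) = of_real s"
      using chi_Psi[OF \<sigma>, of "of_real s"] s r by simp
    have nz: "1 + complex_of_real r \<noteq> 0" "complex_of_real r \<noteq> 0" using re r by (auto simp: complex_eq_iff)
    have chi_\<rho>: "chi \<rho> (of_real r) = of_real s / (1 + of_real r)"
    proof -
      have "chi \<rho> (of_real r) * ((1 + of_real r) / of_real r) =
         of_real s * ((1 + of_real r) / of_real r) * (of_real r / (1 + of_real r)\<^sup>2 * ((1 + of_real r) / of_real r))"
        using D(4)[OF rD] by (simp add: S_transform_def chi_\<sigma> chi_marchenko_pastur[OF re(2) r(1)])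
      moreover have "of_real r / (1 + of_real r)\<^sup>2 * ((1 + of_real r) / of_real r) = 1 / (1 + complex_of_real r)"
        using nz by (simp add: power2_eq_square)
      ultimately show ?thesis using nz by (simp add: power2_eq_square)
    qed
    have "of_real r \<in> Psi \<rho> ` Psi_region \<rho>" using D(3) rD by (auto simp: S_domain_def)
    then have "Psi \<rho> (chi \<rho> (of_real r)) = of_real r" unfolding chi_def by (rule f_inv_into_f)
    then have Psi_\<rho>: "Psi \<rho> (of_real s / (1 + of_real r)) = of_real r" by (simp add: chi_\<rho>)
    define u where "u = poisson_K 1 \<sigma> w"
    have u: "u = w * (1 + of_real r)" by (simp add: u_def poisson_K_def w r)
    have u': "1 / u = of_real s / (1 + of_real r)" by (simp add: u w flip: w(1))
    have "u = of_real (- x * (1 + r))" by (simp add: u w_def)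
    moreover have "- x * (1 + r) < 0" using x M(1) re by (simp add: mult_neg_pos)
    ultimately have "u \<notin> \<real>\<^sub>\<ge>\<^sub>0" by (simp add: complex_nonneg_Reals_iff)
    moreover define G where "G = cauchy_transform \<rho> u"
    ultimately have "1 + of_real r = u * G"
      using one_plus_Psi_P_plus[OF \<rho>] Psi_\<rho> u' by metis
    also have "u * G = (1 + of_real r) * (w * G)" by (simp add: u)
    finally have "w * G = 1" using nz(1) by simp
    then have "cauchy_transform \<rho> u = 1 / w" using w by (simp add: G_def field_simps)
    then show "cauchy_transform \<rho> (poisson_K 1 \<sigma> (of_real (- x))) = 1 / of_real (- x)"
      by (simp add: u_def w_def)
  qed
qed

lemma F_transform_poisson_K:
  assumes \<sigma>: "\<sigma> \<in> P_plus" "\<sigma> \<noteq> dirac0"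
    and conv: "is_free_mult_conv \<sigma> marchenko_pastur \<rho>"
    and M: "0 < M" "\<And>w. M < Im w - Re w \<Longrightarrow> cmod (Psi \<sigma> (1 / w)) < 1 / 2"
    and w: "M < Im w - Re w"
  shows "F_transform \<rho> (poisson_K 1 \<sigma> w) = w"
proof -
  note \<rho> = is_free_mult_conv_P_plus(1)[OF conv marchenko_pastur_P_plus \<sigma>(2) marchenko_pastur_neq_dirac0]
  obtain M' where M': "0 < M'"
    "\<And>x. M' < x \<Longrightarrow> cauchy_transform \<rho> (poisson_K 1 \<sigma> (of_real (- x))) = 1 / of_real (- x)"
    by (rule cauchy_transform_poisson_K_negative[OF \<sigma> conv]) blast
  define A where "A = {w. M < Im w - Re w}"
  define U where "U = (\<lambda>x. complex_of_real (- x)) ` {max M M'<..}"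
  \<comment> \<open>A point inside the ray \<open>U\<close>, hence an accumulation point of
    \<open>U\<close> that lies in \<open>A\<close>.\<close>
  define \<xi> where "\<xi> = complex_of_real (- (max M M' + 1))"
  have A_eq: "A = {w. M < inner (- 1 + \<i>) w}" by (simp add: A_def inner_complex_def)
  have A: "open A" "connected A"
    unfolding A_eq by (simp_all add: open_halfspace_gt convex_halfspace_gt convex_connected)
  have nz: "w \<noteq> 0" if "w \<in> A" for w using that M(1) by (auto simp: A_def)
  have A_nonneg: "A \<inter> \<real>\<^sub>\<ge>\<^sub>0 = {}" using M(1) by (auto simp: A_def complex_nonneg_Reals_iff)
  have K_A: "poisson_K 1 \<sigma> ` A \<inter> \<real>\<^sub>\<ge>\<^sub>0 = {}"
    using poisson_K_notin_nonneg_Reals M nz by (fastforce simp: A_def)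
  \<comment> \<open>The identity is continued for the Cauchy transform and not for its reciprocal:
    this difference is holomorphic on \<open>A\<close> before the Cauchy transform is known to have
    no zeros on the image.\<close>
  have hol: "(\<lambda>w. cauchy_transform \<rho> (poisson_K 1 \<sigma> w) - 1 / w) holomorphic_on A"
  proof (intro holomorphic_intros)
    have "(cauchy_transform \<rho> \<circ> poisson_K 1 \<sigma>) holomorphic_on A"
      by (rule holomorphic_on_compose poisson_K_holomorphic cauchy_transform_holomorphic_P_plus \<sigma> \<rho> A_nonneg K_A)+
    then show "(\<lambda>w. cauchy_transform \<rho> (poisson_K 1 \<sigma> w)) holomorphic_on A" by (simp add: o_def)
  qed (use nz in auto)
  have "\<xi> \<in> A" "U \<subseteq> A" using M(1) by (auto simp: A_def U_def \<xi>_def)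
  have limpt: "\<xi> islimpt U"
    unfolding islimpt_approachable
  proof (intro allI impI)
    fix e :: real assume "0 < e"
    moreover have "complex_of_real (- (max M M' + 1 + e / 2)) \<in> U"
      unfolding U_def by (rule imageI) (use \<open>0 < e\<close> in \<open>simp add: max_def\<close>)
    ultimately show "\<exists>x'\<in>U. x' \<noteq> \<xi> \<and> dist x' \<xi> < e"
      by (intro bexI[of _ "complex_of_real (- (max M M' + 1 + e / 2))"])
         (auto simp: \<xi>_def dist_norm simp flip: of_real_add of_real_diff of_real_minus)
  qed
  have "cauchy_transform \<rho> (poisson_K 1 \<sigma> w) - 1 / w = 0"
  proof (rule analytic_continuation[OF hol A \<open>U \<subseteq> A\<close> \<open>\<xi> \<in> A\<close> limpt])
    show "cauchy_transform \<rho> (poisson_K 1 \<sigma> z) - 1 / z = 0" if "z \<in> U" for z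
      using that M'(2) by (auto simp: U_def)
    show "w \<in> A" using w by (simp add: A_def)
  qed
  then show ?thesis by (simp add: F_transform_def)
qed

text \<open>On this cone \<open>cmod w < 2 * Im w\<close>, so the perturbation
  \<open>w * (of_real t * p)\<close>, of size at most \<open>cmod w / 2\<close>, is smaller than
  \<open>Im w\<close>. The aperture \<open>1 / 2\<close> and the bound \<open>1 / 2\<close> on
  \<open>Psi\<close> are matched for this.\<close>

lemma poisson_K_upper:
  assumes "w \<in> trunc_cone (1 / 2) M" "0 < M" "0 \<le> t" "t \<le> 1" "cmod (Psi \<sigma> (1 / w)) < 1 / 2"
  shows "poisson_K t \<sigma> w \<in> upper_half_plane"
proof -
  define p where "p = Psi \<sigma> (1 / w)"
  have w: "\<bar>Re w\<bar> < Im w / 2" "0 < Im w" using assms by (auto simp: trunc_cone_def)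
  have "cmod w \<le> \<bar>Re w\<bar> + \<bar>Im w\<bar>" by (rule cmod_le)
  then have cw: "cmod w < 2 * Im w" using w by simp
  have "cmod (w * (of_real t * p)) = cmod w * (t * cmod p)" using assms by (simp add: norm_mult)
  also have "\<dots> \<le> cmod w * (1 * (1 / 2))"
    using assms by (intro mult_left_mono mult_mono) (auto simp: p_def)
  also have "\<dots> < Im w" using cw by simp
  finally have "- Im w < Im (w * (of_real t * p))"
    using abs_Im_le_cmod[of "w * (of_real t * p)"] by linarith
  moreover have "poisson_K t \<sigma> w = w + w * (of_real t * p)"
    by (simp add: poisson_K_def p_def algebra_simps)
  ultimately show ?thesis by (simp add: upper_half_plane_def)
qed

text \<open>\<open>Re w < Im w / 2\<close> leaves more than half of the height, which is why a cone
  inside the half-plane \<open>Im w - Re w > M\<close> is later started at height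
  \<open>2 * M\<close>.\<close>

lemma trunc_cone_half:
  assumes "w \<in> trunc_cone (1 / 2) M" "0 < M"
  shows "M / 2 < Im w - Re w" "Re w < Im w" "0 < Im w"
  using assms by (auto simp: trunc_cone_def)

text \<open>\<open>C\<close> is constrained only on the lower half-plane, so that the various
  integral expressions for the cumulant transform can be inserted later, each as it stands.\<close>

lemma free_cumulant_on_poisson:
  assumes \<sigma>: "\<sigma> \<in> P_plus" and t: "0 \<le> t" "t \<le> 1" and "0 < M"
    and small: "\<And>w. w \<in> trunc_cone (1 / 2) M \<Longrightarrow> cmod (Psi \<sigma> (1 / w)) < 1 / 2"
    and F: "\<And>w. w \<in> trunc_cone (1 / 2) M \<Longrightarrow> F_transform \<tau> (poisson_K t \<sigma> w) = w"
    and C: "\<And>z. Im z < 0 \<Longrightarrow> C z = of_real t * Psi \<sigma> z"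
  shows "free_cumulant_on \<tau> (1 / 2) M C"
proof -
  define T where "T = trunc_cone (1 / 2) M"
  have T_Im: "Re w < Im w" "0 < Im w" if "w \<in> T" for w
    using trunc_cone_half that \<open>0 < M\<close> by (auto simp: T_def)
  have hol: "poisson_K t \<sigma> holomorphic_on T"
    using T_Im(2) by (intro poisson_K_holomorphic \<sigma>) (fastforce simp: complex_nonneg_Reals_iff)
  have lim: "((\<lambda>w. poisson_K t \<sigma> w / w) \<longlongrightarrow> 1) (inf at_infinity (principal T))"
  proof (rule tendstoI)
    fix e :: real assume "0 < e"
    then obtain R where R: "0 < R"
      "\<And>w. R < cmod w \<Longrightarrow> (\<And>x. 0 \<le> x \<Longrightarrow> cmod w \<le> 2 * cmod (w - of_real x)) \<Longrightarrow> cmod (Psi \<sigma> (1 / w)) < e"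
      using Psi_inverse_tendsto_0[OF \<sigma>, of 2 e] by auto
    have "dist (poisson_K t \<sigma> w / w) 1 < e" if "R + 1 \<le> cmod w" "w \<in> T" for w
    proof -
      have "w \<noteq> 0" using T_Im(2)[OF that(2)] by auto
      then have "dist (poisson_K t \<sigma> w / w) 1 = t * cmod (Psi \<sigma> (1 / w))"
        using t by (simp add: poisson_K_def dist_norm norm_mult)
      also have "\<dots> \<le> cmod (Psi \<sigma> (1 / w))" using t by (simp add: mult_left_le_one_le)
      also have "\<dots> < e"
        using that T_Im by (intro R(2) norm_le_twice_norm_diff) auto
      finally show ?thesis .
    qed
    then show "\<forall>\<^sub>F w in inf at_infinity (principal T). dist (poisson_K t \<sigma> w / w) 1 < e"
      unfolding eventually_inf_principal eventually_at_infinity by blast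
  qed
  have "F_right_inverse \<tau> (1 / 2) M (poisson_K t \<sigma>)"
    unfolding F_right_inverse_def
    using hol lim F poisson_K_upper[OF _ \<open>0 < M\<close> t small] by (auto simp: T_def)
  moreover have "C z = z * poisson_K t \<sigma> (1 / z) - 1" if "1 / z \<in> trunc_cone (1 / 2) M" for z
  proof -
    have "0 < Im (1 / z)" using that T_Im by (simp add: T_def)
    \<comment> \<open>\<open>z = 0\<close> is excluded because \<open>1 / 0 = 0\<close> has
      imaginary part 0.\<close>
    then have "Im z < 0" "z \<noteq> 0" by (auto simp: Im_divide divide_simps not_sum_power2_lt_zero split: if_splits)
    then show ?thesis by (simp add: C poisson_K_def)
  qed
  ultimately show ?thesis using \<open>0 < M\<close> unfolding free_cumulant_on_def by auto
qed

section \<open>Cauchy transforms from analytic functions on the upper half-plane\<close>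

text \<open>
  Dividing the increment of \<open>g\<close> by \<open>\<zeta> - z\<close> removes the singularity at \<open>z\<close>, so that Cauchy's
  theorem on a half-disc applies without any winding number.
\<close>

lemma half_disc_cauchy_bound:
  assumes \<epsilon>: "0 < \<epsilon>" and hol: "g holomorphic_on {\<zeta>. - \<epsilon> < Im \<zeta>}"
    and B: "\<And>\<zeta>. 0 \<le> Im \<zeta> \<Longrightarrow> cmod (g \<zeta>) \<le> B"
    and z: "0 < Im z" and R: "cmod z < R"
  shows "cmod (integral {-R..R} (\<lambda>x. (g (of_real x) - g z) / of_real ((cmod (of_real x - z))\<^sup>2)))
     \<le> 2 * B / (R - cmod z)\<^sup>2 * R * pi"
proof -
  define S where "S = {\<zeta>. - min \<epsilon> (Im z) < Im \<zeta>}"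
  \<comment> \<open>On the real axis the two denominators multiply to the squared distance from
    \<open>z\<close>, which is the Poisson kernel up to the factor \<open>Im z\<close>. The pole at
    \<open>cnj z\<close> stays outside \<open>S\<close> because of the \<open>Im z\<close> in the
    definition of \<open>S\<close>.\<close>
  define q where "q \<zeta> = (if \<zeta> = z then deriv g z else (g \<zeta> - g z) / (\<zeta> - z)) / (\<zeta> - cnj z)" for \<zeta>
  have R0: "0 < R" using R norm_ge_zero[of z] by linarith
  have "0 \<le> B" using B[of 0] norm_ge_zero[of "g 0"] by (metis order_trans order_refl zero_complex.simps(2))
  have S: "open S" "convex S" unfolding S_def by (simp_all add: open_halfspace_Im_gt convex_halfspace_Im_gt)
  have nz: "\<zeta> - cnj z \<noteq> 0" if "\<zeta> \<in> S" for \<zeta> using that by (auto simp: S_def complex_eq_iff)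
  have "g holomorphic_on S" by (rule holomorphic_on_subset[OF hol]) (auto simp: S_def)
  then have holq: "q holomorphic_on S"
    unfolding q_def by (intro holomorphic_on_divide pole_lemma_open S holomorphic_intros) (use nz in auto)
  define c where "c = part_circlepath 0 R 0 pi"
  define l where "l = linepath (complex_of_real (- R)) (complex_of_real R)"
  have ends: "pathfinish c = pathstart l" "pathfinish l = pathstart c"
    by (auto simp: c_def l_def)
  have img_c: "path_image c = {R * exp (\<i> * of_real t) |t. 0 \<le> t \<and> t \<le> pi}"
    by (auto simp: c_def path_image_part_circlepath)
  have c_pts: "0 \<le> Im \<zeta> \<and> cmod \<zeta> = R" if "\<zeta> \<in> path_image c" for \<zeta>
    using that R0 unfolding img_c by (auto simp: norm_mult Im_exp sin_ge_zero)
  have img_c_S: "path_image c \<subseteq> S" using c_pts \<epsilon> z by (force simp: S_def)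
  have img_l_S: "path_image l \<subseteq> S"
    unfolding l_def path_image_linepath
    by (rule closed_segment_subset[OF _ _ S(2)]) (use \<epsilon> z in \<open>auto simp: S_def\<close>)
  have "(q has_contour_integral 0) (c +++ l)"
    using ends img_c_S img_l_S
    by (intro Cauchy_theorem_convex_simple[OF holq S(2)])
       (auto simp: c_def l_def path_image_join intro!: valid_path_join)
  moreover have cont: "continuous_on (path_image c) q" "continuous_on (path_image l) q"
    using holomorphic_on_imp_continuous_on[OF holq] img_c_S img_l_S continuous_on_subset by blast+
  have int: "q contour_integrable_on c" "q contour_integrable_on l"
    using cont by (auto simp: c_def l_def intro: contour_integrable_continuous_part_circlepath contour_integrable_continuous_linepath)
  ultimately have "contour_integral c q + contour_integral l q = 0"
    using contour_integral_join[of q c l] ends by (auto simp: c_def l_def contour_integral_unique)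
  then have "contour_integral l q = - contour_integral c q" by (simp add: eq_neg_iff_add_eq_0 add.commute)
  then have "cmod (contour_integral l q) = cmod (contour_integral c q)" by simp
  \<comment> \<open>On the arc both factors of the denominator are at least
    \<open>R - cmod z\<close> and the length is \<open>pi * R\<close>, so the contribution is of
    order \<open>1 / R\<close>.\<close>
  also have "\<dots> \<le> 2 * B / (R - cmod z)\<^sup>2 * R * \<bar>pi - 0\<bar>"
    unfolding c_def
  proof (rule contour_integral_bound_part_circlepath)
    fix \<zeta> assume "\<zeta> \<in> path_image (part_circlepath 0 R 0 pi)"
    then have \<zeta>: "0 \<le> Im \<zeta>" "cmod \<zeta> = R" using c_pts by (auto simp: c_def)
    have "R - cmod z \<le> cmod (\<zeta> - z)" "R - cmod z \<le> cmod (\<zeta> - cnj z)"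
      using norm_triangle_ineq2[of \<zeta> z] norm_triangle_ineq2[of \<zeta> "cnj z"] \<zeta> by auto
    then have den: "(R - cmod z)\<^sup>2 \<le> cmod (\<zeta> - z) * cmod (\<zeta> - cnj z)"
      using R by (simp add: power2_eq_square mult_mono)
    have num: "cmod (g \<zeta> - g z) \<le> 2 * B"
      using norm_triangle_ineq4[of "g \<zeta>" "g z"] B[OF \<zeta>(1)] B[of z] z by simp
    have "\<zeta> \<noteq> z" using \<zeta> R by auto
    then have "cmod (q \<zeta>) = cmod (g \<zeta> - g z) / (cmod (\<zeta> - z) * cmod (\<zeta> - cnj z))"
      by (simp add: q_def norm_divide norm_mult)
    also have "\<dots> \<le> 2 * B / (R - cmod z)\<^sup>2"
      using num den R \<open>0 \<le> B\<close> by (intro frac_le) auto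
    finally show "cmod (q \<zeta>) \<le> 2 * B / (R - cmod z)\<^sup>2" .
  qed (use int R0 \<open>0 \<le> B\<close> in \<open>auto simp: c_def\<close>)
  also have "contour_integral l q = integral {-R..R} (\<lambda>x. q (of_real x))"
    unfolding l_def using R0 by (subst contour_integral_linepath_Reals_eq) auto
  also have "\<dots> = integral {-R..R} (\<lambda>x. (g (of_real x) - g z) / of_real ((cmod (of_real x - z))\<^sup>2))"
  proof (rule Henstock_Kurzweil_Integration.integral_cong)
    fix x :: real
    have "complex_of_real x \<noteq> z" using z by auto
    moreover have "(of_real x - z) * (of_real x - cnj z) = of_real ((cmod (of_real x - z))\<^sup>2)"
      unfolding complex_norm_square by simp
    ultimately show "q (of_real x) = (g (of_real x) - g z) / of_real ((cmod (of_real x - z))\<^sup>2)"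
      by (simp add: q_def del: of_real_power)
  qed
  finally show ?thesis by simp
qed

lemma integral_poisson_kernel:
  assumes "0 < y" "0 \<le> R"
  shows "integral {-R..R} (\<lambda>x. y / ((x - a)\<^sup>2 + y\<^sup>2)) = arctan ((R - a) / y) - arctan ((- R - a) / y)"
proof (rule integral_unique, rule fundamental_theorem_of_calculus)
  fix x
  have pos: "0 < (x - a)\<^sup>2 + y\<^sup>2" using assms by (simp add: add_nonneg_pos)
  have "DERIV (\<lambda>x. (x - a) / y) x :> 1 / y" using assms by (auto intro!: derivative_eq_intros)
  then have "DERIV (\<lambda>x. arctan ((x - a) / y)) x :> inverse (1 + ((x - a) / y)\<^sup>2) * (1 / y)"
    by (rule DERIV_chain2[OF DERIV_arctan])
  also have "inverse (1 + ((x - a) / y)\<^sup>2) * (1 / y) = y / ((x - a)\<^sup>2 + y\<^sup>2)"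
  proof -
    have "1 + ((x - a) / y)\<^sup>2 = ((x - a)\<^sup>2 + y\<^sup>2) / y\<^sup>2"
      using assms by (simp add: power_divide add_divide_distrib)
    then have "inverse (1 + ((x - a) / y)\<^sup>2) * (1 / y) = y\<^sup>2 / ((x - a)\<^sup>2 + y\<^sup>2) * (1 / y)" by simp
    also have "\<dots> = y / ((x - a)\<^sup>2 + y\<^sup>2)" using assms by (simp add: power2_eq_square)
    finally show ?thesis .
  qed
  finally show "((\<lambda>x. arctan ((x - a) / y)) has_vector_derivative y / ((x - a)\<^sup>2 + y\<^sup>2)) (at x within {- R..R})"
    by (simp add: has_real_derivative_iff_has_vector_derivative has_vector_derivative_at_within)
qed (use assms in auto)

text \<open>Imaginary parts of the half-disc estimate give the Poisson formula for
  \<open>- Im g\<close>: the integral of \<open>u x + Im (g z)\<close> against the kernel vanishes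
  in the limit, while the kernel alone integrates to \<open>pi\<close>. Nonnegativity of
  \<open>u\<close> allows monotone convergence over \<open>[-n, n]\<close>, so finiteness of the
  integral comes out as part of the result.\<close>

lemma half_plane_poisson:
  assumes \<epsilon>: "0 < \<epsilon>" and hol: "g holomorphic_on {\<zeta>. - \<epsilon> < Im \<zeta>}"
    and B: "\<And>\<zeta>. 0 \<le> Im \<zeta> \<Longrightarrow> cmod (g \<zeta>) \<le> B"
    and z: "0 < Im z" and nonneg: "\<And>x. 0 \<le> u x" and u: "\<And>x. u x = - Im (g (of_real x))"
  shows "(\<integral>\<^sup>+x. ennreal (Im z / (cmod (z - of_real x))\<^sup>2) * ennreal (u x) \<partial>lborel) = ennreal (pi * - Im (g z))"
proof -
  define p where "p x = Im z / (cmod (z - of_real x))\<^sup>2" for x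
  have p_eq: "p x = Im z / ((x - Re z)\<^sup>2 + (Im z)\<^sup>2)" for x
    by (simp add: p_def cmod_power2 power2_commute)
  have den: "(x - Re z)\<^sup>2 + (Im z)\<^sup>2 \<noteq> 0" for x using z by (simp add: sum_power2_eq_zero_iff)
  have p_nonneg: "0 \<le> p x" for x using z by (simp add: p_def)
  have cont_p: "continuous_on A p" for A
    unfolding p_eq[abs_def] using den by (intro continuous_intros) auto
  have cont_g: "continuous_on A (\<lambda>x. g (of_real x))" for A
    by (rule continuous_on_compose2[OF holomorphic_on_imp_continuous_on[OF hol]])
       (use \<epsilon> in \<open>auto intro!: continuous_intros\<close>)
  have cont_u: "continuous_on A u" for A
    unfolding u[abs_def] by (intro continuous_intros cont_g)
  define k where "k x = (g (of_real x) - g z) / of_real ((cmod (of_real x - z))\<^sup>2)" for x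
  have k_eq: "Im z * - Im (k x) = p x * u x - p x * - Im (g z)" for x
    by (simp add: k_def p_def u Im_divide_of_real norm_minus_commute diff_divide_distrib algebra_simps)
  have cont_k: "continuous_on A k" for A
  proof -
    have "cmod (of_real x - z) \<noteq> 0" for x using z by auto
    then show ?thesis unfolding k_def by (intro continuous_intros cont_g) auto
  qed
  define J where "J n = integral {- real n..real n} (\<lambda>x. p x * u x)" for n
  have J_eq: "J n = Im z * - Im (integral {- real n..real n} k)
      + - Im (g z) * integral {- real n..real n} p" for n
  proof -
    have k_int: "k integrable_on {- real n..real n}" and p_int: "p integrable_on {- real n..real n}"
      by (intro integrable_continuous_interval cont_k cont_p)+
    have "Im (integral {- real n..real n} k) = integral {- real n..real n} (\<lambda>x. Im (k x))"
      using integral_linear[OF k_int bounded_linear_Im] by (simp add: o_def)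
    then have "Im z * - Im (integral {- real n..real n} k) = integral {- real n..real n} (\<lambda>x. Im z * - Im (k x))"
      by simp
    also have "\<dots> = J n - integral {- real n..real n} (\<lambda>x. p x * - Im (g z))"
      unfolding k_eq J_def
      by (intro Henstock_Kurzweil_Integration.integral_diff integrable_continuous_interval continuous_intros cont_p cont_u)
    finally show ?thesis by simp
  qed
  have "(\<lambda>n. integral {- real n..real n} k) \<longlonglongrightarrow> 0"
  proof (rule Lim_null_comparison)
    show "\<forall>\<^sub>F n in sequentially. norm (integral {- real n..real n} k)
        \<le> 2 * B / (real n - cmod z)\<^sup>2 * real n * pi"
      using eventually_gt_at_top[of "nat \<lceil>cmod z\<rceil>"]
    proof eventually_elim
      case (elim n)
      then have "cmod z < real n" by linarith
      with B show ?case unfolding k_def by (intro half_disc_cauchy_bound[OF \<epsilon> hol _ z]) auto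
    qed
    show "(\<lambda>n. 2 * B / (real n - cmod z)\<^sup>2 * real n * pi) \<longlonglongrightarrow> 0" by real_asymp
  qed
  then have 1: "(\<lambda>n. Im z * - Im (integral {- real n..real n} k)) \<longlonglongrightarrow> Im z * - Im 0"
    by (intro tendsto_intros)
  have 2: "(\<lambda>n. integral {- real n..real n} p) \<longlonglongrightarrow> pi"
  proof -
    have "(\<lambda>n. arctan ((real n - Re z) / Im z) - arctan ((- real n - Re z) / Im z)) \<longlonglongrightarrow> pi"
      using z by real_asymp
    then show ?thesis unfolding p_eq[abs_def] using z by (simp add: integral_poisson_kernel)
  qed
  have "(\<lambda>n. J n) \<longlonglongrightarrow> Im z * - Im 0 + - Im (g z) * pi"
    unfolding J_eq by (intro tendsto_intros 1 2)
  then have J_lim: "J \<longlonglongrightarrow> pi * - Im (g z)" by (simp add: mult.commute)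
  define f where "f n x = ennreal (p x * u x) * indicator {- real n..real n} x" for n x
  have meas: "p \<in> borel_measurable borel" "u \<in> borel_measurable borel"
    using cont_p cont_u by (auto intro: borel_measurable_continuous_onI)
  have "(\<lambda>n. integral\<^sup>N lborel (f n)) \<longlonglongrightarrow> (\<integral>\<^sup>+x. ennreal (p x * u x) \<partial>lborel)"
  proof (rule nn_integral_LIMSEQ)
    show "incseq f" by (auto simp: incseq_def le_fun_def f_def split: split_indicator)
    show "f n \<in> borel_measurable lborel" for n using meas by (simp add: f_def[abs_def])
    fix x
    have "\<forall>\<^sub>F n in sequentially. f n x = ennreal (p x * u x)"
      using eventually_ge_at_top[of "nat \<lceil>\<bar>x\<bar>\<rceil>"]
    proof eventually_elim
      case (elim n)
      then have "\<bar>x\<bar> \<le> real n" by linarith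
      then show ?case by (simp add: f_def abs_le_iff)
    qed
    then show "(\<lambda>n. f n x) \<longlonglongrightarrow> ennreal (p x * u x)" by (rule tendsto_eventually)
  qed
  moreover have "integral\<^sup>N lborel (f n) = ennreal (J n)" for n
  proof -
    have si: "set_integrable lborel {- real n..real n} (\<lambda>x. p x * u x)"
      by (intro borel_integrable_atLeastAtMost' continuous_intros cont_p cont_u)
    have "integral\<^sup>N lborel (f n) = (\<integral>\<^sup>+x. ennreal (indicator {- real n..real n} x *\<^sub>R (p x * u x)) \<partial>lborel)"
      by (intro nn_integral_cong) (auto simp: f_def split: split_indicator)
    also have "\<dots> = ennreal (LINT x:{- real n..real n}|lborel. p x * u x)"
      unfolding set_lebesgue_integral_def
      by (rule nn_integral_eq_integral)
         (use si p_nonneg nonneg in \<open>auto simp: set_integrable_def split: split_indicator\<close>)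
    also have "\<dots> = ennreal (J n)"
      unfolding J_def by (simp add: set_borel_integral_eq_integral(2)[OF si])
    finally show ?thesis .
  qed
  ultimately have "(\<lambda>n. ennreal (J n)) \<longlonglongrightarrow> (\<integral>\<^sup>+x. ennreal (p x * u x) \<partial>lborel)" by simp
  moreover have "(\<lambda>n. ennreal (J n)) \<longlonglongrightarrow> ennreal (pi * - Im (g z))"
    using J_lim by (rule tendsto_ennrealI)
  ultimately have "(\<integral>\<^sup>+x. ennreal (p x * u x) \<partial>lborel) = ennreal (pi * - Im (g z))"
    by (rule LIMSEQ_unique)
  then show ?thesis unfolding p_def[symmetric] by (simp add: ennreal_mult p_nonneg nonneg)
qed

lemma Im_cauchy_kernel_bounds:
  assumes "0 < Im z"
  shows "0 \<le> Im z / (cmod (z - complex_of_real x))\<^sup>2" "Im z / (cmod (z - complex_of_real x))\<^sup>2 \<le> 1 / Im z"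
proof -
  have "(Im z)\<^sup>2 \<le> (cmod (z - complex_of_real x))\<^sup>2"
    using abs_Im_le_norm_diff_of_real[of z x] assms by (intro power_mono) auto
  then have "Im z / (cmod (z - complex_of_real x))\<^sup>2 \<le> Im z / (Im z)\<^sup>2"
    using assms by (intro divide_left_mono) (auto intro!: mult_pos_pos)
  then show "Im z / (cmod (z - complex_of_real x))\<^sup>2 \<le> 1 / Im z"
    using assms by (simp add: power2_eq_square)
qed (use assms in simp)

text \<open>Stieltjes inversion on the line at height \<epsilon>: there \<open>- Im G / pi\<close>
  is a nonnegative continuous density, and the Poisson formula recovers the imaginary part of the
  shifted function from it. The normalisation on the imaginary axis gives total mass 1.\<close>

lemma ex_distribution_of_shifted_function:
  assumes hol: "G holomorphic_on upper_half_plane"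
    and neg: "\<And>z. 0 < Im z \<Longrightarrow> Im (G z) \<le> 0"
    and bound: "\<And>z. 0 < Im z \<Longrightarrow> cmod (G z) \<le> 1 / Im z"
    and lim: "((\<lambda>y. y * - Im (G (\<i> * of_real y))) \<longlongrightarrow> 1) at_top"
    and \<epsilon>: "0 < \<epsilon>"
  obtains \<nu> where "real_distribution \<nu>"
    "\<And>z. 0 < Im z \<Longrightarrow> (LINT x|\<nu>. Im z / (cmod (z - of_real x))\<^sup>2) = - Im (G (z + \<i> * of_real \<epsilon>))"
proof -
  define g where "g z = G (z + \<i> * of_real \<epsilon>)" for z
  define u where "u x = - Im (g (of_real x))" for x
  have u_nonneg: "0 \<le> u x" for x using neg[of "of_real x + \<i> * of_real \<epsilon>"] \<epsilon> by (simp add: u_def g_def)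
  have hol_g: "g holomorphic_on {\<zeta>. - \<epsilon> < Im \<zeta>}"
  proof -
    have "(G \<circ> (\<lambda>z. z + \<i> * of_real \<epsilon>)) holomorphic_on {\<zeta>. - \<epsilon> < Im \<zeta>}"
      by (intro holomorphic_on_compose_gen[OF _ hol] holomorphic_intros) (auto simp: upper_half_plane_def)
    then show ?thesis by (simp add: g_def[abs_def] o_def)
  qed
  have bound_g: "cmod (g \<zeta>) \<le> 1 / \<epsilon>" if "0 \<le> Im \<zeta>" for \<zeta>
  proof -
    have "cmod (g \<zeta>) \<le> 1 / (Im \<zeta> + \<epsilon>)" using bound[of "\<zeta> + \<i> * of_real \<epsilon>"] that \<epsilon> by (simp add: g_def)
    also have "\<dots> \<le> 1 / \<epsilon>" using that \<epsilon> by (intro frac_le) auto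
    finally show ?thesis .
  qed
  have "continuous_on UNIV (\<lambda>x. g (of_real x))"
    by (rule continuous_on_compose2[OF holomorphic_on_imp_continuous_on[OF hol_g]])
       (use \<epsilon> in \<open>auto intro!: continuous_intros\<close>)
  then have u_meas[measurable]: "u \<in> borel_measurable borel"
    unfolding u_def[abs_def] by (intro borel_measurable_continuous_onI continuous_intros)
  define \<nu> where "\<nu> = density lborel (\<lambda>x. ennreal (u x / pi))"
  have sets_\<nu>[simp]: "sets \<nu> = sets borel" and space_\<nu>[simp]: "space \<nu> = UNIV" by (simp_all add: \<nu>_def)
  have nn: "(\<integral>\<^sup>+x. ennreal (Im z / (cmod (z - of_real x))\<^sup>2) \<partial>\<nu>) = ennreal (- Im (g z))" if z: "0 < Im z" for z
  proof -
    have "(\<integral>\<^sup>+x. ennreal (Im z / (cmod (z - of_real x))\<^sup>2) \<partial>\<nu>) =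
       (\<integral>\<^sup>+x. ennreal (1 / pi) * (ennreal (Im z / (cmod (z - of_real x))\<^sup>2) * ennreal (u x)) \<partial>lborel)"
      unfolding \<nu>_def
      by (subst nn_integral_density)
         (auto intro!: nn_integral_cong simp: u_nonneg z less_imp_le simp flip: ennreal_mult)
    also have "\<dots> = ennreal (1 / pi) * ennreal (pi * - Im (g z))"
      by (subst nn_integral_cmult, simp)
         (subst half_plane_poisson[OF \<epsilon> hol_g bound_g z u_nonneg u_def], simp_all)
    also have "\<dots> = ennreal (1 / pi * (pi * - Im (g z)))"
      using neg[of "z + \<i> * of_real \<epsilon>"] z \<epsilon>
      by (intro ennreal_mult[symmetric]) (auto simp: g_def mult_le_0_iff)
    also have "\<dots> = ennreal (- Im (g z))" by simp
    finally show ?thesis .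
  qed
  have "emeasure \<nu> (space \<nu>) = 1"
  proof -
    \<comment> \<open>The kernel at \<open>\<i> * y\<close>, multiplied by \<open>y = n + 1\<close>,
      is \<open>y^2 / (x^2 + y^2)\<close>. It increases to 1 with \<open>n\<close>, so its integrals
      increase to the total mass.\<close>
    define f where "f n x = (real (Suc n))\<^sup>2 / (x\<^sup>2 + (real (Suc n))\<^sup>2)" for n and x :: real
    have f_eq: "f n x = real (Suc n) * (Im z / (cmod (z - of_real x))\<^sup>2)" if "z = \<i> * of_real (real (Suc n))" for n x z
    proof -
      have "(cmod (z - of_real x))\<^sup>2 = x\<^sup>2 + (real (Suc n))\<^sup>2" "Im z = real (Suc n)"
        by (simp_all add: that cmod_power2 del: of_nat_Suc)
      then show ?thesis by (simp add: f_def power2_eq_square del: of_nat_Suc)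
    qed
    have f_eq': "f n x = 1 - x\<^sup>2 / (x\<^sup>2 + (real (Suc n))\<^sup>2)" for n x
    proof -
      have "x\<^sup>2 + (real (Suc n))\<^sup>2 \<noteq> 0" by (simp add: sum_power2_eq_zero_iff del: of_nat_Suc)
      then show ?thesis by (simp add: f_def field_simps)
    qed
    have "(\<lambda>n. \<integral>\<^sup>+x. ennreal (f n x) \<partial>\<nu>) \<longlonglongrightarrow> (\<integral>\<^sup>+x. 1 \<partial>\<nu>)"
    proof (rule nn_integral_LIMSEQ)
      show "incseq (\<lambda>n x. ennreal (f n x))"
      proof (intro incseq_SucI le_funI ennreal_leI)
        fix n x
        have "x\<^sup>2 / (x\<^sup>2 + (real (Suc (Suc n)))\<^sup>2) \<le> x\<^sup>2 / (x\<^sup>2 + (real (Suc n))\<^sup>2)"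
          by (intro divide_left_mono add_left_mono power_mono mult_pos_pos add_nonneg_pos) auto
        then show "f n x \<le> f (Suc n) x" by (simp add: f_eq' del: of_nat_Suc)
      qed
      show "(\<lambda>x. ennreal (f n x)) \<in> borel_measurable \<nu>" for n
        unfolding f_def by (simp add: measurable_cong_sets[OF sets_\<nu> refl])
      fix x
      have "(\<lambda>n. f n x) \<longlonglongrightarrow> 1" unfolding f_def by real_asymp
      then show "(\<lambda>n. ennreal (f n x)) \<longlonglongrightarrow> 1" using tendsto_ennrealI by fastforce
    qed
    moreover have "(\<integral>\<^sup>+x. ennreal (f n x) \<partial>\<nu>) = ennreal (real (Suc n) * - Im (g (\<i> * of_real (real (Suc n)))))" for n
    proof -
      define z where "z = \<i> * complex_of_real (real (Suc n))"
      have z: "0 < Im z" by (simp add: z_def)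
      have "(\<integral>\<^sup>+x. ennreal (f n x) \<partial>\<nu>) = (\<integral>\<^sup>+x. ennreal (real (Suc n)) * ennreal (Im z / (cmod (z - of_real x))\<^sup>2) \<partial>\<nu>)"
        using Im_cauchy_kernel_bounds(1)[OF z]
        unfolding f_eq[OF z_def] by (intro nn_integral_cong ennreal_mult) auto
      also have "\<dots> = ennreal (real (Suc n)) * ennreal (- Im (g z))"
        by (subst nn_integral_cmult) (simp_all add: nn[OF z] measurable_cong_sets[OF sets_\<nu> refl])
      also have "\<dots> = ennreal (real (Suc n) * - Im (g z))"
        using neg[of "z + \<i> * of_real \<epsilon>"] z \<epsilon> by (intro ennreal_mult[symmetric]) (auto simp: g_def)
      finally show ?thesis by (simp only: z_def)
    qed
    moreover have "(\<lambda>n. ennreal (real (Suc n) * - Im (g (\<i> * of_real (real (Suc n)))))) \<longlonglongrightarrow> ennreal 1"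
    proof (rule tendsto_ennrealI)
      have top: "filterlim (\<lambda>n. real (Suc n) + \<epsilon>) at_top sequentially" by real_asymp
      have "(\<lambda>n. (real (Suc n) + \<epsilon>) * - Im (G (\<i> * of_real (real (Suc n) + \<epsilon>)))) \<longlonglongrightarrow> 1"
        by (rule filterlim_compose[OF lim top])
      moreover have "(\<lambda>n. real (Suc n) / (real (Suc n) + \<epsilon>)) \<longlonglongrightarrow> 1" by real_asymp
      ultimately have "(\<lambda>n. real (Suc n) / (real (Suc n) + \<epsilon>) *
          ((real (Suc n) + \<epsilon>) * - Im (G (\<i> * of_real (real (Suc n) + \<epsilon>))))) \<longlonglongrightarrow> 1 * 1"
        by (intro tendsto_mult)
      moreover have "real (Suc n) / (real (Suc n) + \<epsilon>) *
          ((real (Suc n) + \<epsilon>) * - Im (G (\<i> * of_real (real (Suc n) + \<epsilon>)))) =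
          real (Suc n) * - Im (g (\<i> * of_real (real (Suc n))))" for n
      proof -
        have "real (Suc n) + \<epsilon> \<noteq> 0" using \<epsilon> by (simp add: add_pos_pos less_imp_neq[symmetric] del: of_nat_Suc)
        moreover have "\<i> * of_real (real (Suc n) + \<epsilon>) = \<i> * of_real (real (Suc n)) + \<i> * of_real \<epsilon>"
          by (simp only: of_real_add distrib_left)
        ultimately show ?thesis by (simp add: g_def del: of_nat_Suc of_real_add of_real_of_nat_eq)
      qed
      ultimately show "(\<lambda>n. real (Suc n) * - Im (g (\<i> * of_real (real (Suc n))))) \<longlonglongrightarrow> 1" by simp
    qed
    ultimately have "(\<lambda>n. ennreal (real (Suc n) * - Im (g (\<i> * of_real (real (Suc n)))))) \<longlonglongrightarrow> (\<integral>\<^sup>+x. 1 \<partial>\<nu>)"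
      by simp
    then have "(\<integral>\<^sup>+x. 1 \<partial>\<nu>) = ennreal 1" using \<open>_ \<longlonglongrightarrow> ennreal 1\<close> by (rule LIMSEQ_unique)
    then show ?thesis by simp
  qed
  then have rd: "real_distribution \<nu>"
    by (auto simp: real_distribution_def real_distribution_axioms_def intro: prob_spaceI)
  show thesis
  proof (rule that[OF rd])
    fix z :: complex assume z: "0 < Im z"
    show "(LINT x|\<nu>. Im z / (cmod (z - of_real x))\<^sup>2) = - Im (G (z + \<i> * of_real \<epsilon>))"
    proof (subst integral_eq_nn_integral)
      show "(\<lambda>x. Im z / (cmod (z - of_real x))\<^sup>2) \<in> borel_measurable \<nu>"
        by (simp add: measurable_cong_sets[OF sets_\<nu> refl])
      show "AE x in \<nu>. 0 \<le> Im z / (cmod (z - of_real x))\<^sup>2" using z by simp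
      show "enn2real (\<integral>\<^sup>+x. ennreal (Im z / (cmod (z - of_real x))\<^sup>2) \<partial>\<nu>) = - Im (G (z + \<i> * of_real \<epsilon>))"
        using neg[of "z + \<i> * of_real \<epsilon>"] z \<epsilon> by (simp add: nn[OF z] g_def)
    qed
  qed
qed

text \<open>Nevanlinna's theorem for Cauchy transforms. The normalisation at infinity makes the laws
  of the shifted functions tight, and a weak limit has the right imaginary part because the Poisson
  kernel is bounded and continuous.\<close>

theorem ex_cauchy_transform_eq:
  assumes hol: "G holomorphic_on upper_half_plane"
    and neg: "\<And>z. 0 < Im z \<Longrightarrow> Im (G z) \<le> 0"
    and bound: "\<And>z. 0 < Im z \<Longrightarrow> cmod (G z) \<le> 1 / Im z"
    and lim: "((\<lambda>y. y * - Im (G (\<i> * of_real y))) \<longlongrightarrow> 1) at_top"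
  obtains \<nu> where "real_distribution \<nu>" "\<And>z. 0 < Im z \<Longrightarrow> cauchy_transform \<nu> z = G z"
proof -
  define e where "e n = 1 / real (Suc n)" for n
  have e: "0 < e n" "e n \<le> 1" for n by (simp_all add: e_def)
  have "\<exists>\<nu>. real_distribution \<nu> \<and> (\<forall>z. 0 < Im z \<longrightarrow>
      (LINT x|\<nu>. Im z / (cmod (z - of_real x))\<^sup>2) = - Im (G (z + \<i> * of_real (e n))))" for n
    by (rule ex_distribution_of_shifted_function[OF hol neg bound lim e(1)]) blast+
  then obtain N where N: "\<And>n. real_distribution (N n)"
    "\<And>n z. 0 < Im z \<Longrightarrow> (LINT x|N n. Im z / (cmod (z - of_real x))\<^sup>2) = - Im (G (z + \<i> * of_real (e n)))"
    by metis
  have "tight N"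
    unfolding tight_def
  proof (intro conjI allI impI N(1))
    fix \<delta> :: real assume "0 < \<delta>"
    \<comment> \<open>The estimate below has the form \<open>1 - 2 * d \<le> 1 / 2 + m / 2\<close>,
      so the mass \<open>m\<close> of the interval is at least \<open>1 - 4 * d\<close>, hence at
      least \<open>1 - \<delta> / 2\<close>.\<close>
    define d where "d = min (\<delta> / 8) (1 / 2)"
    have d: "0 < d" "d \<le> \<delta> / 8" "d < 1" using \<open>0 < \<delta>\<close> by (auto simp: d_def)
    \<comment> \<open>The shifts are at most 1, so \<open>y / (y + 1)\<close> controls the loss from
      replacing \<open>y\<close> by \<open>y + e n\<close> for all \<open>n\<close> at once.\<close>
    have "((\<lambda>y::real. y / (y + 1)) \<longlongrightarrow> 1) at_top" by real_asymp
    then have "\<forall>\<^sub>F y in at_top. 1 - d < y / (y + 1)" using d by (intro order_tendstoD) auto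
    moreover have "\<forall>\<^sub>F y in at_top. 1 - d < y * - Im (G (\<i> * of_real y))"
      using lim d by (intro order_tendstoD) auto
    moreover have "\<forall>\<^sub>F y::real in at_top. 0 < y" by (rule eventually_gt_at_top)
    ultimately have "\<forall>\<^sub>F y in at_top. 0 < y \<and> 1 - d < y / (y + 1) \<and> 1 - d < y * - Im (G (\<i> * of_real y))"
      by eventually_elim simp
    then obtain Y where Y: "\<And>y. Y \<le> y \<Longrightarrow> 0 < y \<and> 1 - d < y / (y + 1) \<and> 1 - d < y * - Im (G (\<i> * of_real y))"
      by (auto simp: eventually_at_top_linorder)
    have Y0: "0 < Y" using Y by simp
    show "\<exists>a b. a < b \<and> (\<forall>n. 1 - \<delta> < measure (N n) {a<..b})"
    proof (intro exI conjI allI)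
      show "- Y < Y" using Y0 by simp
      fix n
      interpret real_distribution "N n" by (rule N(1))
      define z where "z = \<i> * complex_of_real Y"
      have z: "0 < Im z" using Y0 by (simp add: z_def)
      define v where "v = (Y + e n) * - Im (G (\<i> * of_real (Y + e n)))"
      have v: "1 - d < v" using Y[of "Y + e n"] e(1)[of n] by (simp add: v_def)
      have "1 - 2 * d \<le> (1 - d) * (1 - d)" by (simp add: algebra_simps)
      also have "\<dots> \<le> Y / (Y + e n) * v"
      proof (rule mult_mono)
        have "1 - d < Y / (Y + 1)" using Y by simp
        also have "\<dots> \<le> Y / (Y + e n)" using Y0 e[of n] by (intro divide_left_mono) auto
        finally show "1 - d \<le> Y / (Y + e n)" by simp
      qed (use v d Y0 e[of n] in auto)
      also have "\<dots> = Y * - Im (G (z + \<i> * of_real (e n)))"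
      proof -
        have "\<i> * of_real (Y + e n) = z + \<i> * of_real (e n)" by (simp add: z_def ring_distribs)
        moreover have "Y + e n \<noteq> 0" using Y0 e(1)[of n] by simp
        ultimately show ?thesis by (simp add: v_def del: of_real_add)
      qed
      also have "\<dots> = (LINT x|N n. Y * (Im z / (cmod (z - of_real x))\<^sup>2))"
        by (subst integral_mult_right_zero) (simp add: N(2)[OF z])
      \<comment> \<open>\<open>Y^2 / (x^2 + Y^2)\<close> is at most 1 everywhere and at most
        \<open>1 / 2\<close> once \<open>\<bar>x\<bar> \<ge> Y\<close>.\<close>
      also have "\<dots> \<le> (LINT x|N n. 1 / 2 + 1 / 2 * indicator {-Y<..Y} x)"
      proof (rule integral_mono)
        show "integrable (N n) (\<lambda>x. Y * (Im z / (cmod (z - of_real x))\<^sup>2))"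
          using Im_cauchy_kernel_bounds[OF z] z
          by (intro integrable_mult_right integrable_bounded_real_distribution[OF N(1), where B = "1 / Im z"]) auto
        fix x
        show "Y * (Im z / (cmod (z - of_real x))\<^sup>2) \<le> 1 / 2 + 1 / 2 * indicator {-Y<..Y} x"
        proof (cases "x \<in> {-Y<..Y}")
          case True
          then show ?thesis using Im_cauchy_kernel_bounds(2)[OF z, of x] Y0 by (simp add: z_def field_simps)
        next
          case False
          then have "\<bar>Y\<bar> \<le> \<bar>x\<bar>" using Y0 by auto
          then have "Y\<^sup>2 \<le> x\<^sup>2" by (simp add: abs_le_square_iff)
          moreover have "Y * (Im z / (cmod (z - of_real x))\<^sup>2) = Y\<^sup>2 / (x\<^sup>2 + Y\<^sup>2)"
          proof -
            have "(cmod (z - of_real x))\<^sup>2 = x\<^sup>2 + Y\<^sup>2" by (simp add: z_def cmod_power2)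
            then show ?thesis by (simp add: z_def power2_eq_square)
          qed
          ultimately show ?thesis using False Y0 by (simp add: divide_le_eq add_nonneg_pos)
        qed
      qed (auto intro!: integrable_add integrable_mult_right simp: emeasure_eq_measure)
      also have "\<dots> = 1 / 2 + 1 / 2 * measure (N n) {-Y<..Y}"
        using prob_space by (subst Bochner_Integration.integral_add) (auto simp: emeasure_eq_measure)
      finally show "1 - \<delta> < measure (N n) {-Y<..Y}" using d \<open>0 < \<delta>\<close> by simp
    qed
  qed
  then obtain r \<nu> where r: "strict_mono r" and \<nu>: "real_distribution \<nu>" and weak: "weak_conv_m (N \<circ> id \<circ> r) \<nu>"
    using tight_imp_convergent_subsubsequence[of N id] by (auto simp: strict_mono_id)
  have Im_eq: "Im (cauchy_transform \<nu> z) = Im (G z)" if z: "0 < Im z" for z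
  proof -
    define f where "f x = Im z / (cmod (z - complex_of_real x))\<^sup>2" for x
    have "(\<lambda>n. LINT x|(N \<circ> id \<circ> r) n. f x) \<longlonglongrightarrow> (LINT x|\<nu>. f x)"
    proof (rule weak_conv_imp_integral_bdd_continuous_conv[OF _ \<nu> weak])
      show "norm (f x) \<le> 1 / Im z" for x using Im_cauchy_kernel_bounds[OF z, of x] by (simp add: f_def)
      have "cmod (z - complex_of_real x) \<noteq> 0" for x using z by auto
      then show "isCont f x" for x unfolding f_def by (intro continuous_intros) auto
    qed (use N(1) in simp)
    then have 1: "(\<lambda>n. - Im (G (z + \<i> * of_real (e (r n))))) \<longlonglongrightarrow> (LINT x|\<nu>. f x)"
      by (simp add: f_def N(2)[OF z])
    have "e \<longlonglongrightarrow> 0" unfolding e_def by real_asymp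
    then have "(\<lambda>n. e (r n)) \<longlonglongrightarrow> 0" using LIMSEQ_subseq_LIMSEQ[OF _ r, of e] by (simp add: o_def)
    then have "(\<lambda>n. z + \<i> * of_real (e (r n))) \<longlonglongrightarrow> z + \<i> * of_real 0" by (intro tendsto_intros)
    moreover have "isCont G z"
      using holomorphic_on_imp_continuous_on[OF hol] z
      by (simp add: continuous_on_eq_continuous_at upper_half_plane_def open_halfspace_Im_gt)
    ultimately have "(\<lambda>n. G (z + \<i> * of_real (e (r n)))) \<longlonglongrightarrow> G z"
      using isCont_tendsto_compose[of z G "\<lambda>n. z + \<i> * of_real (e (r n))" sequentially] by simp
    then have "(\<lambda>n. - Im (G (z + \<i> * of_real (e (r n))))) \<longlonglongrightarrow> - Im (G z)" by (intro tendsto_intros)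
    with 1 have "(LINT x|\<nu>. f x) = - Im (G z)" by (rule LIMSEQ_unique)
    then show ?thesis using Im_cauchy_transform[OF \<nu> z] by (simp add: f_def)
  qed
  define h where "h z = cauchy_transform \<nu> z - G z" for z
  have hol_h: "h holomorphic_on upper_half_plane"
    unfolding h_def by (intro holomorphic_intros cauchy_transform_holomorphic_upper \<nu> hol)
  \<comment> \<open>\<open>h\<close> takes only real values, and a set of real numbers has no
    interior in the plane, so the open mapping theorem leaves only a constant.\<close>
  have "h constant_on upper_half_plane"
  proof (rule ccontr)
    assume "\<not> h constant_on upper_half_plane"
    then have "open (h ` upper_half_plane)"
      using open_mapping_thm[OF hol_h upper_half_plane_open upper_half_plane_connected upper_half_plane_open] by simp
    moreover have hi: "h \<i> \<in> h ` upper_half_plane" by (simp add: upper_half_plane_def)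
    ultimately obtain \<delta> where \<delta>: "0 < \<delta>" "ball (h \<i>) \<delta> \<subseteq> h ` upper_half_plane"
      unfolding open_contains_ball by blast
    have "h \<i> + \<i> * of_real (\<delta> / 2) \<in> ball (h \<i>) \<delta>" using \<delta>(1) by (simp add: dist_norm norm_mult)
    then have hi': "h \<i> + \<i> * of_real (\<delta> / 2) \<in> h ` upper_half_plane" using \<delta>(2) by blast
    have real: "Im w = 0" if w: "w \<in> h ` upper_half_plane" for w
    proof -
      obtain z where "w = h z" "0 < Im z" using w by (auto simp: upper_half_plane_def)
      then show ?thesis using Im_eq[of z] by (simp add: h_def)
    qed
    show False using real[OF hi] real[OF hi'] \<delta>(1) by simp
  qed
  then obtain c where c: "\<And>z. 0 < Im z \<Longrightarrow> h z = c"
    by (auto simp: constant_on_def upper_half_plane_def)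
  have "c = 0"
  proof (rule ccontr)
    assume "c \<noteq> 0"
    \<comment> \<open>At this height the two bounds \<open>1 / y\<close> add up to half of
      \<open>cmod c\<close>.\<close>
    define y where "y = 4 / cmod c"
    have y: "0 < y" using \<open>c \<noteq> 0\<close> by (simp add: y_def)
    have "cmod c = cmod (cauchy_transform \<nu> (\<i> * of_real y) - G (\<i> * of_real y))"
      using c[of "\<i> * of_real y"] y by (simp add: h_def)
    also have "\<dots> \<le> 1 / y + 1 / y"
      using norm_triangle_ineq4[of "cauchy_transform \<nu> (\<i> * of_real y)" "G (\<i> * of_real y)"]
        norm_cauchy_transform_le[OF \<nu>, of "\<i> * of_real y"] bound[of "\<i> * of_real y"] y by simp
    also have "\<dots> = cmod c / 2" by (simp add: y_def)
    finally show False using \<open>c \<noteq> 0\<close> by simp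
  qed
  with c show thesis by (intro that[OF \<nu>]) (auto simp: h_def)
qed

section \<open>Free compound Poisson laws of rate less than one\<close>

text \<open>
  On the part of the upper half-plane where \<open>poisson_K t \<sigma>\<close> takes values in the upper half-plane, \<open>t * second_moment_kernel \<sigma> w < 1\<close>;
  this is the derivative bound which makes the map injective and proper there.
\<close>

definition second_moment_kernel :: "real measure \<Rightarrow> complex \<Rightarrow> real" where
  "second_moment_kernel \<sigma> w = (LINT x|\<sigma>. (cmod (of_real x / (w - of_real x)))\<^sup>2)"

lemma norm_kernel_le:
  assumes "0 < Im w"
  shows "cmod (of_real x / (w - of_real x)) \<le> 1 + cmod w / Im w"
proof -
  have le: "Im w \<le> cmod (w - of_real x)" using abs_Im_le_norm_diff_of_real[of w x] assms by simp
  then have pos: "0 < cmod (w - of_real x)" using assms by linarith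
  have "cmod (of_real x) = cmod (w - (w - of_real x))" by simp
  also have "\<dots> \<le> cmod w + cmod (w - of_real x)" by (rule norm_triangle_ineq4)
  finally have "cmod (of_real x / (w - of_real x)) \<le> (cmod w + cmod (w - of_real x)) / cmod (w - of_real x)"
    unfolding norm_divide by (rule divide_right_mono) simp
  also have "\<dots> = 1 + cmod w / cmod (w - of_real x)" using pos by (simp add: add_divide_distrib)
  also have "\<dots> \<le> 1 + cmod w / Im w" using le assms pos by (intro add_left_mono divide_left_mono mult_pos_pos) auto
  finally show ?thesis .
qed

lemma integrable_kernel:
  assumes "real_distribution \<sigma>" "0 < Im w"
  shows "integrable \<sigma> (\<lambda>x. of_real x / (w - of_real x))"
  by (rule integrable_bounded_real_distribution[OF assms(1)]) (use norm_kernel_le[OF assms(2)] in auto)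

lemma integrable_kernel_square:
  assumes "real_distribution \<sigma>" "0 < Im w"
  shows "integrable \<sigma> (\<lambda>x. (cmod (of_real x / (w - of_real x)))\<^sup>2)"
proof (rule integrable_bounded_real_distribution[OF assms(1)])
  show "AE x in \<sigma>. norm ((cmod (complex_of_real x / (w - of_real x)))\<^sup>2) \<le> (1 + cmod w / Im w)\<^sup>2"
  proof (rule AE_I2)
    fix x
    show "norm ((cmod (complex_of_real x / (w - of_real x)))\<^sup>2) \<le> (1 + cmod w / Im w)\<^sup>2"
      using power_mono[OF norm_kernel_le[OF assms(2), of x], of 2] by simp
  qed
qed simp

text \<open>\<open>w * x * (cnj w - x)\<close> has imaginary part \<open>- x^2 * Im w\<close>, so
  each kernel contributes exactly \<open>- Im w\<close> times its squared modulus. In particular,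
  for \<open>t \<ge> 0\<close> the map never raises the imaginary part.\<close>

lemma Im_poisson_K:
  assumes \<sigma>: "real_distribution \<sigma>" and w: "0 < Im w"
  shows "Im (poisson_K t \<sigma> w) = Im w * (1 - t * second_moment_kernel \<sigma> w)"
proof -
  have "w \<noteq> 0" using w by auto
  note int = integrable_kernel[OF \<sigma> w]
  have w_Psi: "w * Psi \<sigma> (1 / w) = (LINT x|\<sigma>. w * (of_real x / (w - of_real x)))"
    unfolding Psi_inverse[OF \<open>w \<noteq> 0\<close>] by (rule integral_mult_right_zero[symmetric])
  have "Im (w * Psi \<sigma> (1 / w)) = (LINT x|\<sigma>. Im (w * (of_real x / (w - of_real x))))"
    unfolding w_Psi by (rule integral_Im[symmetric]) (intro integrable_mult_right int)
  also have "\<dots> = (LINT x|\<sigma>. - Im w * (cmod (of_real x / (w - of_real x)))\<^sup>2)"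
  proof (rule Bochner_Integration.integral_cong[OF refl])
    fix x
    have "w * (of_real x / (w - of_real x)) = w * of_real x * cnj (w - of_real x) / of_real ((cmod (w - of_real x))\<^sup>2)"
      by (simp add: complex_div_cnj[of _ "w - of_real x"])
    then show "Im (w * (of_real x / (w - of_real x))) = - Im w * (cmod (of_real x / (w - of_real x)))\<^sup>2"
      by (simp add: Im_divide_of_real norm_divide power_divide) (simp add: power2_eq_square algebra_simps)
  qed
  also have "\<dots> = - Im w * second_moment_kernel \<sigma> w"
    unfolding second_moment_kernel_def by (rule integral_mult_right_zero)
  finally have Im_Psi: "Im (w * Psi \<sigma> (1 / w)) = - Im w * second_moment_kernel \<sigma> w" .
  have "poisson_K t \<sigma> w = w + of_real t * (w * Psi \<sigma> (1 / w))"
    by (simp add: poisson_K_def algebra_simps)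
  then have "Im (poisson_K t \<sigma> w) = Im w + t * Im (w * Psi \<sigma> (1 / w))"
    by (simp only: Im_complex_of_real plus_complex.sel times_complex.sel Re_complex_of_real)
  then show ?thesis unfolding Im_Psi by (simp add: algebra_simps)
qed

lemma t_second_moment_kernel_less_1:
  assumes "real_distribution \<sigma>" "0 < Im w" "0 < Im (poisson_K t \<sigma> w)"
  shows "t * second_moment_kernel \<sigma> w < 1"
  using assms by (simp add: Im_poisson_K zero_less_mult_iff)

lemma second_moment_kernel_nonneg: "0 \<le> second_moment_kernel \<sigma> w"
  unfolding second_moment_kernel_def by simp

lemma norm_integral_kernel_product_le:
  assumes \<sigma>: "real_distribution \<sigma>" and v: "0 < Im v" and w: "0 < Im w"
  shows "cmod (LINT x|\<sigma>. of_real x / (v - of_real x) * (of_real x / (w - of_real x)))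
    \<le> (second_moment_kernel \<sigma> v + second_moment_kernel \<sigma> w) / 2"
proof -
  note intv = integrable_kernel_square[OF \<sigma> v] and intw = integrable_kernel_square[OF \<sigma> w]
  have "cmod (LINT x|\<sigma>. of_real x / (v - of_real x) * (of_real x / (w - of_real x)))
     \<le> (LINT x|\<sigma>. cmod (of_real x / (v - of_real x) * (of_real x / (w - of_real x))))"
    by (rule integral_norm_bound)
  also have "\<dots> \<le> (LINT x|\<sigma>. ((cmod (of_real x / (v - of_real x)))\<^sup>2 + (cmod (of_real x / (w - of_real x)))\<^sup>2) / 2)"
  proof (rule integral_mono')
    fix x
    show "cmod (of_real x / (v - of_real x) * (of_real x / (w - of_real x)))
      \<le> ((cmod (of_real x / (v - of_real x)))\<^sup>2 + (cmod (of_real x / (w - of_real x)))\<^sup>2) / 2"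
      unfolding norm_mult
      using sum_squares_bound[of "cmod (of_real x / (v - of_real x))" "cmod (of_real x / (w - of_real x))"]
      by simp
  qed (use intv intw in auto)
  also have "\<dots> = (second_moment_kernel \<sigma> v + second_moment_kernel \<sigma> w) / 2"
    unfolding second_moment_kernel_def using intv intw by simp
  finally show ?thesis .
qed

lemma norm_Psi_inverse_le:
  assumes \<sigma>: "real_distribution \<sigma>" and w: "0 < Im w"
  shows "cmod (Psi \<sigma> (1 / w)) \<le> (1 + second_moment_kernel \<sigma> w) / 2"
proof -
  interpret real_distribution \<sigma> by fact
  note intw = integrable_kernel_square[OF \<sigma> w]
  have "w \<noteq> 0" using w by auto
  have "cmod (Psi \<sigma> (1 / w)) \<le> (LINT x|\<sigma>. cmod (of_real x / (w - of_real x)))"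
    unfolding Psi_inverse[OF \<open>w \<noteq> 0\<close>] by (rule integral_norm_bound)
  also have "\<dots> \<le> (LINT x|\<sigma>. (1 + (cmod (of_real x / (w - of_real x)))\<^sup>2) / 2)"
  proof (rule integral_mono')
    fix x
    show "cmod (of_real x / (w - of_real x)) \<le> (1 + (cmod (of_real x / (w - of_real x)))\<^sup>2) / 2"
      using sum_squares_bound[of 1 "cmod (of_real x / (w - of_real x))"] by simp
  qed (use intw in auto)
  also have "\<dots> = (1 + second_moment_kernel \<sigma> w) / 2"
    unfolding second_moment_kernel_def using intw prob_space by simp
  finally show ?thesis .
qed

text \<open>The chord identity \<open>K v - K w = (v - w) (1 - t I)\<close> replaces an integration
  of the derivative along a segment, which might leave the domain. The mixed integral
  \<open>I\<close> is bounded by the mean of the two second moments, and \<open>t\<close> times each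
  of them is below 1.\<close>

lemma poisson_K_inj_on:
  assumes \<sigma>: "real_distribution \<sigma>" and t: "0 \<le> t"
  shows "inj_on (poisson_K t \<sigma>) {w. 0 < Im w \<and> 0 < Im (poisson_K t \<sigma> w)}"
proof (rule inj_onI, rule ccontr)
  fix v w assume "v \<in> {w. 0 < Im w \<and> 0 < Im (poisson_K t \<sigma> w)}" "w \<in> {w. 0 < Im w \<and> 0 < Im (poisson_K t \<sigma> w)}"
    and eq: "poisson_K t \<sigma> v = poisson_K t \<sigma> w" and "v \<noteq> w"
  then have v: "0 < Im v" "0 < Im (poisson_K t \<sigma> v)" and w: "0 < Im w" "0 < Im (poisson_K t \<sigma> w)" by auto
  have nz: "v \<noteq> 0" "w \<noteq> 0" using v w by auto
  define I where "I = (LINT x|\<sigma>. of_real x / (v - of_real x) * (of_real x / (w - of_real x)))"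
  note intv = integrable_kernel[OF \<sigma> v(1)] and intw = integrable_kernel[OF \<sigma> w(1)]
  have "v * Psi \<sigma> (1 / v) - w * Psi \<sigma> (1 / w)
     = (LINT x|\<sigma>. v * (of_real x / (v - of_real x)) - w * (of_real x / (w - of_real x)))"
    unfolding Psi_inverse[OF nz(1)] Psi_inverse[OF nz(2)] integral_mult_right_zero[symmetric]
    by (rule Bochner_Integration.integral_diff[symmetric]) (intro integrable_mult_right intv intw)+
  also have "\<dots> = (LINT x|\<sigma>. (w - v) * (of_real x / (v - of_real x) * (of_real x / (w - of_real x))))"
  proof (rule Bochner_Integration.integral_cong[OF refl])
    fix x
    have "v - of_real x \<noteq> 0" "w - of_real x \<noteq> 0" using v w by (auto simp: complex_eq_iff)
    then show "v * (of_real x / (v - of_real x)) - w * (of_real x / (w - of_real x)) =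
        (w - v) * (of_real x / (v - of_real x) * (of_real x / (w - of_real x)))"
      by (simp add: diff_frac_eq) (simp add: algebra_simps)
  qed
  also have "\<dots> = (w - v) * I" unfolding I_def by (rule integral_mult_right_zero)
  finally have diff: "v * Psi \<sigma> (1 / v) - w * Psi \<sigma> (1 / w) = (w - v) * I" .
  have "(v - w) * (1 - of_real t * I) = v - w + of_real t * ((w - v) * I)" by (simp add: algebra_simps)
  also have "\<dots> = poisson_K t \<sigma> v - poisson_K t \<sigma> w"
    unfolding diff[symmetric] by (simp add: poisson_K_def algebra_simps)
  also have "\<dots> = 0" using eq by simp
  finally have "(v - w) * (1 - of_real t * I) = 0" .
  then have "of_real t * I = 1" using \<open>v \<noteq> w\<close> by simp
  then have "1 = cmod (of_real t * I)" by simp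
  also have "\<dots> = t * cmod I" using t by (simp add: norm_mult)
  also have "\<dots> \<le> t * ((second_moment_kernel \<sigma> v + second_moment_kernel \<sigma> w) / 2)"
    unfolding I_def using t by (intro mult_left_mono norm_integral_kernel_product_le \<sigma> v w)
  also have "\<dots> = (t * second_moment_kernel \<sigma> v + t * second_moment_kernel \<sigma> w) / 2"
    by (simp add: algebra_simps)
  also have "\<dots> < 1"
    using t_second_moment_kernel_less_1[OF \<sigma> v] t_second_moment_kernel_less_1[OF \<sigma> w] by simp
  finally show False by simp
qed

text \<open>Properness at infinity. By \<open>2 a \<le> 1 + a^2\<close> the modulus of
  \<open>of_real t * Psi \<sigma> (1 / w)\<close> is at most \<open>(1 + t) / 2\<close>, which
  leaves \<open>(1 - t) / 2\<close> of \<open>cmod w\<close>; the bound becomes vacuous at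
  \<open>t = 1\<close>.\<close>

lemma norm_poisson_K_ge:
  assumes \<sigma>: "real_distribution \<sigma>" and t: "0 \<le> t"
    and w: "0 < Im w" "0 < Im (poisson_K t \<sigma> w)"
  shows "(1 - t) / 2 * cmod w \<le> cmod (poisson_K t \<sigma> w)"
proof -
  have "cmod (of_real t * Psi \<sigma> (1 / w)) = t * cmod (Psi \<sigma> (1 / w))" using t by (simp add: norm_mult)
  also have "\<dots> \<le> t * ((1 + second_moment_kernel \<sigma> w) / 2)"
    using t by (intro mult_left_mono norm_Psi_inverse_le \<sigma> w)
  also have "\<dots> = (t + t * second_moment_kernel \<sigma> w) / 2" by (simp add: algebra_simps)
  also have "\<dots> \<le> (t + 1) / 2" using t_second_moment_kernel_less_1[OF \<sigma> w] by simp
  finally have "1 - (t + 1) / 2 \<le> 1 - cmod (of_real t * Psi \<sigma> (1 / w))" by simp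
  also have "\<dots> \<le> cmod (1 + of_real t * Psi \<sigma> (1 / w))"
    using norm_triangle_ineq2[of 1 "- (of_real t * Psi \<sigma> (1 / w))"] by simp
  finally have "(1 - t) / 2 \<le> cmod (1 + of_real t * Psi \<sigma> (1 / w))" by (simp add: field_simps)
  then have "cmod w * ((1 - t) / 2) \<le> cmod w * cmod (1 + of_real t * Psi \<sigma> (1 / w))"
    by (rule mult_left_mono) simp
  then show ?thesis by (simp add: poisson_K_def norm_mult mult.commute)
qed

lemma poisson_K_holomorphic_upper:
  "\<sigma> \<in> P_plus \<Longrightarrow> poisson_K t \<sigma> holomorphic_on upper_half_plane"
  by (rule poisson_K_holomorphic) (auto simp: upper_half_plane_def complex_nonneg_Reals_iff)

lemma open_poisson_K_domain:
  assumes "\<sigma> \<in> P_plus"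
  shows "open {w. 0 < Im w \<and> 0 < Im (poisson_K t \<sigma> w)}"
proof -
  have "open (poisson_K t \<sigma> -` upper_half_plane \<inter> upper_half_plane)"
    using holomorphic_on_imp_continuous_on[OF poisson_K_holomorphic_upper[OF assms, of t]]
      continuous_on_open_vimage[OF upper_half_plane_open] upper_half_plane_open by blast
  also have "poisson_K t \<sigma> -` upper_half_plane \<inter> upper_half_plane = {w. 0 < Im w \<and> 0 < Im (poisson_K t \<sigma> w)}"
    by (auto simp: upper_half_plane_def)
  finally show ?thesis .
qed

lemma Psi_inverse_small_on_cone:
  assumes "\<sigma> \<in> P_plus"
  obtains M where "0 < M" "\<And>w. M < Im w - Re w \<Longrightarrow> cmod (Psi \<sigma> (1 / w)) < 1 / 2"
proof -
  obtain R where R: "0 < R"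
    "\<And>w. R < cmod w \<Longrightarrow> (\<And>x. 0 \<le> x \<Longrightarrow> cmod w \<le> 2 * cmod (w - of_real x)) \<Longrightarrow> cmod (Psi \<sigma> (1 / w)) < 1 / 2"
    using Psi_inverse_tendsto_0[OF assms, of 2 "1 / 2"] by auto
  \<comment> \<open>\<open>Im w - Re w \<le> 2 * cmod w\<close>, whence the threshold
    \<open>2 * R\<close>.\<close>
  show thesis
  proof (rule that[of "2 * R"])
    fix w assume w: "2 * R < Im w - Re w"
    then have "R < cmod w" using abs_Re_le_cmod[of w] abs_Im_le_cmod[of w] by linarith
    then show "cmod (Psi \<sigma> (1 / w)) < 1 / 2"
      using R w by (intro R(2) norm_le_twice_norm_diff) auto
  qed (use R in simp)
qed

text \<open>The image is open by injectivity and relatively closed by properness: preimages of a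
  convergent sequence stay bounded, and their imaginary parts dominate those of the images, so their
  limit points stay in the upper half-plane. Connectedness does the rest.\<close>

lemma poisson_K_surj:
  assumes \<sigma>: "\<sigma> \<in> P_plus" and t: "0 \<le> t" "t < 1"
  shows "poisson_K t \<sigma> ` {w. 0 < Im w \<and> 0 < Im (poisson_K t \<sigma> w)} = upper_half_plane"
proof -
  define K where "K = poisson_K t \<sigma>"
  define \<Omega> where "\<Omega> = {w. 0 < Im w \<and> 0 < Im (K w)}"
  note rd = P_plusD(1)[OF \<sigma>]
  have hol: "K holomorphic_on upper_half_plane" unfolding K_def by (rule poisson_K_holomorphic_upper[OF \<sigma>])
  note cont = holomorphic_on_imp_continuous_on[OF hol]
  have "open \<Omega>" unfolding \<Omega>_def K_def by (rule open_poisson_K_domain[OF \<sigma>])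
  have \<Omega>_sub: "\<Omega> \<subseteq> upper_half_plane" by (auto simp: \<Omega>_def upper_half_plane_def)
  have inj: "inj_on K \<Omega>" unfolding K_def \<Omega>_def by (rule poisson_K_inj_on[OF rd t(1)])
  have open_im: "open (K ` \<Omega>)"
    by (rule open_mapping_thm3[OF holomorphic_on_subset[OF hol \<Omega>_sub] \<open>open \<Omega>\<close> inj])
  have im_sub: "K ` \<Omega> \<subseteq> upper_half_plane" by (auto simp: \<Omega>_def upper_half_plane_def)
  obtain M where M: "0 < M" "\<And>w. M < Im w - Re w \<Longrightarrow> cmod (Psi \<sigma> (1 / w)) < 1 / 2"
    by (rule Psi_inverse_small_on_cone[OF \<sigma>]) blast
  \<comment> \<open>A point high on the imaginary axis shows that the image is not empty.\<close>
  define w0 where "w0 = \<i> * complex_of_real (2 * M)"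
  have "w0 \<in> trunc_cone (1 / 2) M" "M < Im w0 - Re w0" using M(1) by (auto simp: w0_def trunc_cone_def)
  then have "K w0 \<in> upper_half_plane"
    unfolding K_def using poisson_K_upper M t by auto
  then have "w0 \<in> \<Omega>" using M(1) by (simp add: \<Omega>_def upper_half_plane_def w0_def)
  have "closedin (top_of_set upper_half_plane) (K ` \<Omega>)"
    unfolding closedin_limpt
  proof (intro conjI im_sub allI impI)
    fix z assume "z islimpt K ` \<Omega> \<and> z \<in> upper_half_plane"
    then have z: "0 < Im z" and "z islimpt K ` \<Omega>" by (auto simp: upper_half_plane_def)
    then obtain f where f: "\<And>n. f n \<in> K ` \<Omega>" "f \<longlonglongrightarrow> z"
      unfolding islimpt_sequential by blast
    have "\<exists>w. w \<in> \<Omega> \<and> f n = K w" for n using f(1)[of n] by auto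
    then obtain v where v: "\<And>n. v n \<in> \<Omega>" "\<And>n. f n = K (v n)" by metis
    have "Bseq f" using f(2) by (auto intro: convergent_imp_Bseq convergentI)
    then obtain B where B: "\<And>n. cmod (f n) \<le> B" unfolding Bseq_def by blast
    have "cmod (v n) \<le> 2 * B / (1 - t)" for n
    proof -
      have "(1 - t) / 2 * cmod (v n) \<le> B"
        using norm_poisson_K_ge[OF rd t(1), of "v n"] v[of n] B[of n] by (auto simp: \<Omega>_def K_def)
      then show ?thesis using t by (simp add: field_simps)
    qed
    then have "bounded (range v)" by (auto simp: bounded_iff)
    then obtain l r where r: "strict_mono r" "(v \<circ> r) \<longlonglongrightarrow> l"
      using bounded_imp_convergent_subsequence by blast
    have Im_v: "Im (f n) \<le> Im (v n)" for n
    proof -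
      have "Im (v n) * (1 - t * second_moment_kernel \<sigma> (v n)) \<le> Im (v n) * 1"
        using v(1)[of n] t second_moment_kernel_nonneg[of \<sigma> "v n"]
        by (intro mult_left_mono) (auto simp: \<Omega>_def)
      then show ?thesis using Im_poisson_K[OF rd, of "v n" t] v[of n] by (simp add: K_def \<Omega>_def)
    qed
    have fr: "(f \<circ> r) \<longlonglongrightarrow> z" by (rule LIMSEQ_subseq_LIMSEQ[OF f(2) r(1)])
    have "Im z \<le> Im l"
      by (rule LIMSEQ_le[OF tendsto_Im[OF fr] tendsto_Im[OF r(2)]]) (use Im_v in auto)
    then have l: "0 < Im l" using z by simp
    then have "isCont K l"
      using cont by (simp add: continuous_on_eq_continuous_at upper_half_plane_open) (simp add: upper_half_plane_def)
    then have "(\<lambda>n. K ((v \<circ> r) n)) \<longlonglongrightarrow> K l" using r(2) by (rule isCont_tendsto_compose)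
    then have "(f \<circ> r) \<longlonglongrightarrow> K l" by (simp add: v(2) o_def)
    then have "K l = z" using fr LIMSEQ_unique by blast
    then show "z \<in> K ` \<Omega>" using l z by (auto simp: \<Omega>_def)
  qed
  moreover have "openin (top_of_set upper_half_plane) (K ` \<Omega>)"
    using open_im im_sub by (simp add: open_subset)
  ultimately have "K ` \<Omega> = {} \<or> K ` \<Omega> = upper_half_plane"
    using upper_half_plane_connected unfolding connected_clopen by blast
  then show ?thesis using \<open>w0 \<in> \<Omega>\<close> by (auto simp: K_def \<Omega>_def)
qed

text \<open>For the inverse \<open>F\<close>, the inequality \<open>Im z \<le> Im (F z)\<close>
  yields both the sign of the imaginary part of \<open>1 / F z\<close> and the bound
  \<open>1 / Im z\<close>. The normalisation reduces to the decay of
  \<open>Psi \<sigma> (1 / F z)\<close> along the imaginary axis.\<close>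

theorem ex_free_poisson:
  assumes \<sigma>: "\<sigma> \<in> P_plus" and t: "0 \<le> t" "t < 1"
  obtains \<nu> where "real_distribution \<nu>"
    "\<And>w. 0 < Im w \<Longrightarrow> 0 < Im (poisson_K t \<sigma> w) \<Longrightarrow> F_transform \<nu> (poisson_K t \<sigma> w) = w"
proof -
  define K where "K = poisson_K t \<sigma>"
  define \<Omega> where "\<Omega> = {w. 0 < Im w \<and> 0 < Im (K w)}"
  note rd = P_plusD(1)[OF \<sigma>]
  have hol: "K holomorphic_on upper_half_plane" unfolding K_def by (rule poisson_K_holomorphic_upper[OF \<sigma>])
  have \<Omega>_sub: "\<Omega> \<subseteq> upper_half_plane" by (auto simp: \<Omega>_def upper_half_plane_def)
  have "open \<Omega>" unfolding \<Omega>_def K_def by (rule open_poisson_K_domain[OF \<sigma>])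
  have inj: "inj_on K \<Omega>" unfolding K_def \<Omega>_def by (rule poisson_K_inj_on[OF rd t(1)])
  have surj: "K ` \<Omega> = upper_half_plane" unfolding K_def \<Omega>_def by (rule poisson_K_surj[OF \<sigma> t])
  obtain F where F: "F holomorphic_on upper_half_plane" "\<And>w. w \<in> \<Omega> \<Longrightarrow> F (K w) = w"
    using holomorphic_has_inverse[OF holomorphic_on_subset[OF hol \<Omega>_sub] \<open>open \<Omega>\<close> inj] surj by metis
  have F_in: "F z \<in> \<Omega>" "K (F z) = z" if "0 < Im z" for z
  proof -
    have "z \<in> K ` \<Omega>" using that surj by (simp add: upper_half_plane_def)
    then obtain w where "w \<in> \<Omega>" "z = K w" by blast
    then show "F z \<in> \<Omega>" "K (F z) = z" using F(2) by auto
  qed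
  have Im_F: "Im z \<le> Im (F z)" if z: "0 < Im z" for z
  proof -
    have w: "0 < Im (F z)" using F_in(1)[OF z] by (simp add: \<Omega>_def)
    have "Im z = Im (F z) * (1 - t * second_moment_kernel \<sigma> (F z))"
      using Im_poisson_K[OF rd w, of t] F_in(2)[OF z] by (simp add: K_def)
    also have "\<dots> \<le> Im (F z) * 1"
      using w t second_moment_kernel_nonneg[of \<sigma> "F z"] by (intro mult_left_mono) auto
    finally show ?thesis by simp
  qed
  define G where "G z = 1 / F z" for z
  have F_nz: "F z \<noteq> 0" if "0 < Im z" for z using Im_F[OF that] that by auto
  have hol_G: "G holomorphic_on upper_half_plane"
    unfolding G_def by (intro holomorphic_intros F) (use F_nz in \<open>auto simp: upper_half_plane_def\<close>)
  have neg_G: "Im (G z) \<le> 0" if "0 < Im z" for z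
    using Im_F[OF that] that by (simp add: G_def Im_divide divide_nonpos_nonneg)
  have bound_G: "cmod (G z) \<le> 1 / Im z" if "0 < Im z" for z
    using Im_F[OF that] that abs_Im_le_cmod[of "F z"]
    by (auto simp: G_def norm_divide intro!: frac_le)
  have iyG: "y * - Im (G (\<i> * of_real y)) = 1 + t * Re (Psi \<sigma> (1 / F (\<i> * of_real y)))" if y: "0 < y" for y
  proof -
    define w where "w = F (\<i> * of_real y)"
    have "K w = \<i> * of_real y" using F_in(2)[of "\<i> * of_real y"] y by (simp add: w_def)
    then have "w * (1 + of_real t * Psi \<sigma> (1 / w)) = \<i> * of_real y" by (simp add: K_def poisson_K_def)
    moreover have "w \<noteq> 0" using F_nz[of "\<i> * of_real y"] y by (simp add: w_def)
    ultimately have "\<i> * of_real y * G (\<i> * of_real y) = 1 + of_real t * Psi \<sigma> (1 / w)"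
      by (simp add: G_def field_simps flip: w_def)
    then have "Re (\<i> * of_real y * G (\<i> * of_real y)) = Re (1 + of_real t * Psi \<sigma> (1 / w))" by simp
    then show ?thesis by (simp add: w_def)
  qed
  have "((\<lambda>y. y * - Im (G (\<i> * of_real y))) \<longlongrightarrow> 1) at_top"
  proof (rule tendstoI)
    fix e :: real assume "0 < e"
    \<comment> \<open>From \<open>(1 - t) / 2 * cmod w \<le> y\<close> and
      \<open>y \<le> Im w\<close>: the inverse stays in a sector away from the positive axis, where
      \<open>Psi \<sigma> (1 / w)\<close> decays.\<close>
    define C where "C = 2 / (1 - t)"
    have C: "0 < C" using t by (simp add: C_def)
    obtain R where R: "0 < R"
      "\<And>w. R < cmod w \<Longrightarrow> (\<And>x. 0 \<le> x \<Longrightarrow> cmod w \<le> C * cmod (w - of_real x)) \<Longrightarrow> cmod (Psi \<sigma> (1 / w)) < e"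
      by (rule Psi_inverse_tendsto_0[OF \<sigma> C \<open>0 < e\<close>]) blast
    show "\<forall>\<^sub>F y in at_top. dist (y * - Im (G (\<i> * of_real y))) 1 < e"
      using eventually_gt_at_top[of R]
    proof eventually_elim
      case (elim y)
      then have y: "0 < y" using R by simp
      define w where "w = F (\<i> * of_real y)"
      have w: "w \<in> \<Omega>" "K w = \<i> * of_real y" "y \<le> Im w"
        using F_in[of "\<i> * of_real y"] Im_F[of "\<i> * of_real y"] y by (auto simp: w_def)
      have "(1 - t) / 2 * cmod w \<le> y"
        using norm_poisson_K_ge[OF rd t(1), of w] w y by (simp add: \<Omega>_def K_def norm_mult)
      then have "cmod w \<le> C * y" using t by (simp add: C_def field_simps)
      also have "\<dots> \<le> C * Im w" using w C by simp
      finally have cw: "cmod w \<le> C * Im w" .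
      have "cmod (Psi \<sigma> (1 / w)) < e"
      proof (rule R(2))
        show "R < cmod w" using elim w abs_Im_le_cmod[of w] by linarith
        fix x
        have "Im w \<le> cmod (w - of_real x)" using abs_Im_le_norm_diff_of_real[of w x] by linarith
        then show "cmod w \<le> C * cmod (w - of_real x)" using cw C by (meson mult_left_mono less_imp_le order_trans)
      qed
      have "dist (y * - Im (G (\<i> * of_real y))) 1 = t * \<bar>Re (Psi \<sigma> (1 / w))\<bar>"
        unfolding iyG[OF y] using t by (simp add: dist_norm abs_mult w_def)
      also have "\<dots> \<le> 1 * cmod (Psi \<sigma> (1 / w))"
        using t abs_Re_le_cmod by (intro mult_mono) auto
      also have "\<dots> < e" using \<open>cmod (Psi \<sigma> (1 / w)) < e\<close> by simp
      finally show ?case .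
    qed
  qed
  then obtain \<nu> where \<nu>: "real_distribution \<nu>" "\<And>z. 0 < Im z \<Longrightarrow> cauchy_transform \<nu> z = G z"
    using ex_cauchy_transform_eq[OF hol_G neg_G bound_G] by blast
  show thesis
  proof (rule that[OF \<nu>(1)])
    fix w assume "0 < Im w" "0 < Im (poisson_K t \<sigma> w)"
    then show "F_transform \<nu> (poisson_K t \<sigma> w) = w"
      using F(2)[of w] by (simp add: F_transform_def \<nu>(2) G_def \<Omega>_def K_def)
  qed
qed

section \<open>Free infinite divisibility and the Levy measure\<close>

lemma Psi_holomorphic_lower:
  assumes "\<sigma> \<in> P_plus"
  shows "Psi \<sigma> holomorphic_on lower_half_plane"
proof -
  have inv: "0 < Im (1 / z)" "z \<noteq> 0" if "z \<in> lower_half_plane" for z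
    using that by (auto simp: lower_half_plane_def Im_divide divide_simps sum_power2_gt_zero_iff)
  have "(cauchy_transform \<sigma> \<circ> (\<lambda>z. 1 / z)) holomorphic_on lower_half_plane"
    by (rule holomorphic_on_compose_gen[OF _ cauchy_transform_holomorphic_upper[OF P_plusD(1)[OF assms]]])
       (use inv in \<open>auto simp: upper_half_plane_def intro!: holomorphic_intros\<close>)
  then have "(\<lambda>z. 1 / z * cauchy_transform \<sigma> (1 / z) - 1) holomorphic_on lower_half_plane"
    by (intro holomorphic_intros) (use inv in \<open>auto simp: o_def\<close>)
  then show ?thesis
  proof (rule holomorphic_transform)
    fix z assume z: "z \<in> lower_half_plane"
    have "1 / z \<notin> \<real>\<^sub>\<ge>\<^sub>0" using inv(1)[OF z] by (auto simp: complex_nonneg_Reals_iff)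
    then have "1 + Psi \<sigma> (1 / (1 / z)) = 1 / z * cauchy_transform \<sigma> (1 / z)"
      by (rule one_plus_Psi_P_plus[OF assms])
    then show "1 / z * cauchy_transform \<sigma> (1 / z) - 1 = Psi \<sigma> z" by (simp add: algebra_simps)
  qed
qed

text \<open>One threshold \<open>M\<close> serves all rates \<open>t\<close>, since
  \<open>is_free_add_conv\<close> asks for the cumulant transforms of both summands and of the
  result on the same cone.\<close>

locale free_poisson_square =
  fixes \<sigma> \<rho> :: "real measure" and M :: real
  assumes \<sigma>: "\<sigma> \<in> P_plus" "\<sigma> \<noteq> dirac0"
    and conv: "is_free_mult_conv \<sigma> marchenko_pastur \<rho>"
    and M: "0 < M" "\<And>w. M < Im w - Re w \<Longrightarrow> cmod (Psi \<sigma> (1 / w)) < 1 / 2"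
begin

lemma small_on_cone:
  "w \<in> trunc_cone (1 / 2) (2 * M) \<Longrightarrow> M < Im w - Re w \<and> cmod (Psi \<sigma> (1 / w)) < 1 / 2"
  using trunc_cone_half[of w "2 * M"] M by auto

lemma rho_P_plus: "\<rho> \<in> P_plus"
  by (rule is_free_mult_conv_P_plus(1)[OF conv marchenko_pastur_P_plus \<sigma>(2) marchenko_pastur_neq_dirac0])

lemma free_cumulant_on_rho:
  assumes "\<And>z. Im z < 0 \<Longrightarrow> C z = Psi \<sigma> z"
  shows "free_cumulant_on \<rho> (1 / 2) (2 * M) C"
proof (rule free_cumulant_on_poisson[OF \<sigma>(1), where t = 1])
  fix w assume "w \<in> trunc_cone (1 / 2) (2 * M)"
  then have w: "M < Im w - Re w" "cmod (Psi \<sigma> (1 / w)) < 1 / 2" using small_on_cone by auto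
  then show "cmod (Psi \<sigma> (1 / w)) < 1 / 2" by simp
  show "F_transform \<rho> (poisson_K 1 \<sigma> w) = w"
    using M(2) w(1) by (intro F_transform_poisson_K[OF \<sigma> conv M(1)]) auto
qed (use M assms in auto)

lemma free_cumulant_ext_rho:
  assumes "\<And>z. Im z < 0 \<Longrightarrow> C z = Psi \<sigma> z"
  shows "free_cumulant_ext \<rho> C"
proof -
  have "C holomorphic_on lower_half_plane"
    by (rule holomorphic_transform[OF Psi_holomorphic_lower[OF \<sigma>(1)]])
       (simp add: assms lower_half_plane_def)
  then show ?thesis
    using free_cumulant_on_rho[OF assms] unfolding free_cumulant_ext_def by blast
qed

text \<open>For \<open>t < 1\<close> the law comes from the global inverse, at \<open>t = 1\<close>
  it is \<rho> itself. The middle conclusion records this choice, so that the family ends in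
  \<rho>.\<close>

lemma ex_free_cumulant_on:
  assumes t: "0 \<le> t" "t \<le> 1"
  obtains \<nu> where "real_distribution \<nu>" "t = 1 \<Longrightarrow> \<nu> = \<rho>"
    "\<And>C. (\<And>z. Im z < 0 \<Longrightarrow> C z = of_real t * Psi \<sigma> z) \<Longrightarrow> free_cumulant_on \<nu> (1 / 2) (2 * M) C"
proof (cases "t = 1")
  case True
  show ?thesis
    by (rule that[of \<rho>]) (use True free_cumulant_on_rho P_plusD(1)[OF rho_P_plus] in auto)
next
  case False
  with t have "t < 1" by simp
  then obtain \<nu> where \<nu>: "real_distribution \<nu>"
    "\<And>w. 0 < Im w \<Longrightarrow> 0 < Im (poisson_K t \<sigma> w) \<Longrightarrow> F_transform \<nu> (poisson_K t \<sigma> w) = w"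
    using ex_free_poisson[OF \<sigma>(1) t(1)] by blast
  show ?thesis
  proof (rule that[OF \<nu>(1)])
    fix C assume C: "\<And>z. Im z < 0 \<Longrightarrow> C z = of_real t * Psi \<sigma> z"
    show "free_cumulant_on \<nu> (1 / 2) (2 * M) C"
    proof (rule free_cumulant_on_poisson[OF \<sigma>(1) t _ _ _ C])
      fix w assume w: "w \<in> trunc_cone (1 / 2) (2 * M)"
      then show small: "cmod (Psi \<sigma> (1 / w)) < 1 / 2" using small_on_cone by auto
      have "0 < Im (poisson_K t \<sigma> w)"
        using poisson_K_upper[OF w _ t small] M(1) by (simp add: upper_half_plane_def)
      moreover have "0 < Im w" using trunc_cone_half[OF w] M(1) by simp
      ultimately show "F_transform \<nu> (poisson_K t \<sigma> w) = w" by (intro \<nu>(2))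
    qed (use M(1) in simp)
  qed (use False in simp)
qed

text \<open>The laws \<open>\<tau> t\<close> behave like a convolution semigroup along the fractions
  \<open>k / n\<close> and end in \<open>\<tau> 1 = \<rho>\<close>; the root of order
  \<open>n\<close> is \<open>\<tau> (1 / n)\<close>.\<close>

lemma rho_free_infinitely_divisible: "free_infinitely_divisible \<rho>"
proof -
  have "\<forall>t. \<exists>\<nu>. 0 \<le> t \<and> t \<le> 1 \<longrightarrow> real_distribution \<nu> \<and> (t = 1 \<longrightarrow> \<nu> = \<rho>) \<and>
      (\<forall>C. (\<forall>z. Im z < 0 \<longrightarrow> C z = of_real t * Psi \<sigma> z) \<longrightarrow> free_cumulant_on \<nu> (1 / 2) (2 * M) C)"
    by (metis ex_free_cumulant_on)
  then obtain \<tau> where \<tau>: "\<And>t. 0 \<le> t \<Longrightarrow> t \<le> 1 \<Longrightarrow> real_distribution (\<tau> t)" "\<tau> 1 = \<rho>"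
    "\<And>t C. 0 \<le> t \<Longrightarrow> t \<le> 1 \<Longrightarrow> (\<And>z. Im z < 0 \<Longrightarrow> C z = of_real t * Psi \<sigma> z)
      \<Longrightarrow> free_cumulant_on (\<tau> t) (1 / 2) (2 * M) C"
    by (metis order_refl zero_le_one)
  have power: "is_free_add_power (\<tau> (1 / real n)) k (\<tau> (real k / real n))" if "1 \<le> k" "k \<le> n" for k n
    using that
  proof (induction k rule: nat_induct_at_least)
    case base
    then show ?case using is_free_add_power.one[of "\<tau> (1 / real n)"] by simp
  next
    case (Suc k)
    then have n: "0 < real n" "k < n" by auto
    define C where "C = (\<lambda>s z. complex_of_real s * Psi \<sigma> z)"
    have "free_cumulant_on (\<tau> (real k / real n)) (1 / 2) (2 * M) (C (real k / real n))"
      "free_cumulant_on (\<tau> (1 / real n)) (1 / 2) (2 * M) (C (1 / real n))"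
      by (rule \<tau>(3); use n in \<open>simp add: C_def\<close>)+
    moreover have "free_cumulant_on (\<tau> (real (Suc k) / real n)) (1 / 2) (2 * M)
        (\<lambda>z. C (real k / real n) z + C (1 / real n) z)"
    proof (rule \<tau>(3))
      have "real (Suc k) / real n = real k / real n + 1 / real n"
        by (simp add: add_divide_distrib)
      then show "C (real k / real n) z + C (1 / real n) z = of_real (real (Suc k) / real n) * Psi \<sigma> z" for z
        by (simp only: C_def of_real_add distrib_right)
    qed (use n in simp_all)
    ultimately have "is_free_add_conv (\<tau> (real k / real n)) (\<tau> (1 / real n)) (\<tau> (real (Suc k) / real n))"
      unfolding is_free_add_conv_def using n \<tau>(1) by (intro conjI exI) auto
    with Suc show ?case by (intro is_free_add_power.Suc) auto
  qed
  have "\<exists>\<nu>. real_distribution \<nu> \<and> is_free_add_power \<nu> n \<rho>" if "1 \<le> n" for n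
    using power[OF that order_refl] that \<tau>(1)[of "1 / real n"] \<tau>(2) by auto
  then show ?thesis
    using P_plusD(1)[OF rho_P_plus] by (simp add: free_infinitely_divisible_def)
qed

text \<open>The kernel vanishes at 0, so an atom of \<sigma> there can be removed without changing
  the integral. The factor \<open>c\<close> covers both uses: 1 for the Levy measure, a reciprocal
  mass for a normalised jump law.\<close>

lemma integral_kernel_restrict:
  assumes z: "Im z < 0" and c: "0 \<le> c"
  shows "(LINT x|density \<sigma> (\<lambda>x. ennreal (c * indicator {0<..} x)). (1 / (1 - z * of_real x) - 1)) = of_real c * Psi \<sigma> z"
proof -
  interpret real_distribution \<sigma> by (rule P_plusD(1)[OF \<sigma>(1)])
  have "(LINT x|density \<sigma> (\<lambda>x. ennreal (c * indicator {0<..} x)). (1 / (1 - z * of_real x) - 1))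
     = (LINT x|\<sigma>. (c * indicator {0<..} x) *\<^sub>R (1 / (1 - z * of_real x) - 1))"
    by (rule integral_density) (use c in auto)
  also have "\<dots> = (LINT x|\<sigma>. of_real c * (z * of_real x / (1 - z * of_real x)))"
  proof (rule integral_cong_AE)
    show "AE x in \<sigma>. (c * indicator {0<..} x) *\<^sub>R (1 / (1 - z * of_real x) - 1)
       = of_real c * (z * of_real x / (1 - z * of_real x))"
      using P_plusD(2)[OF \<sigma>(1)]
    proof eventually_elim
      case (elim x)
      show ?case
      proof (cases "x = 0")
        case False
        then have "1 - z * of_real x \<noteq> 0" using z by (auto simp: complex_eq_iff)
        then have "1 / (1 - z * of_real x) - 1 = z * of_real x / (1 - z * of_real x)"
          by (simp add: field_simps)
        then show ?thesis using elim False by (simp add: scaleR_conv_of_real)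
      qed simp
    qed
  qed simp_all
  also have "\<dots> = of_real c * Psi \<sigma> z" unfolding Psi_def by (rule integral_mult_right_zero)
  finally show ?thesis .
qed

text \<open>\<sigma> may charge 0, which a jump law must not. It is therefore conditioned on the
  open half-line, and the remaining mass \<open>c\<close> becomes the rate, positive because
  \<sigma> is not the point mass at 0.\<close>

lemma rho_free_compound_poisson: "free_compound_poisson \<rho>"
proof -
  interpret real_distribution \<sigma> by (rule P_plusD(1)[OF \<sigma>(1)])
  define c where "c = measure \<sigma> {0<..}"
  define N where "N = density \<sigma> (\<lambda>x. ennreal (1 / c * indicator {0<..} x))"
  have "c \<noteq> 0"
  proof
    assume "c = 0"
    then have "AE x in \<sigma>. x \<notin> {0<..}"
      by (subst AE_iff_measurable[of "{0<..}"]) (auto simp: c_def emeasure_eq_measure)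
    then have "AE x in \<sigma>. x = 0" using P_plusD(2)[OF \<sigma>(1)] by eventually_elim auto
    then show False using dirac0_if_AE_zero[OF P_plusD(1)[OF \<sigma>(1)]] \<sigma>(2) by simp
  qed
  then have c: "0 < c" using measure_nonneg[of \<sigma> "{0<..}"] by (simp add: c_def less_le)
  have "emeasure N (space N) = (\<integral>\<^sup>+x. ennreal (1 / c) * indicator {0<..} x \<partial>\<sigma>)"
    unfolding N_def using c
    by (subst emeasure_density) (auto intro!: nn_integral_cong simp: ennreal_mult split: split_indicator)
  also have "\<dots> = ennreal (1 / c) * ennreal c"
    by (subst nn_integral_cmult_indicator) (auto simp: emeasure_eq_measure c_def)
  also have "\<dots> = 1" using c by (simp flip: ennreal_mult)
  finally have "real_distribution N"
    by (auto simp: real_distribution_def real_distribution_axioms_def N_def intro: prob_spaceI)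
  moreover have "measure N {0} = 0"
    unfolding N_def measure_def by (subst emeasure_density) (auto simp: nn_integral_0_iff_AE split: split_indicator)
  moreover have "free_cumulant_ext \<rho> (\<lambda>z. of_real c * (LINT x|N. (1 / (1 - z * of_real x) - 1)))"
    unfolding N_def using c by (intro free_cumulant_ext_rho, subst integral_kernel_restrict) auto
  ultimately show ?thesis
    using c P_plusD(1)[OF rho_P_plus] unfolding free_compound_poisson_def by blast
qed

text \<open>The drift is 0 and the Levy measure is the restriction of \<sigma> to the open
  half-line; its total mass is at most 1, which bounds the integral of
  \<open>min 1 x\<close>.\<close>

lemma rho_free_regular: "free_regular \<rho>"
proof -
  interpret real_distribution \<sigma> by (rule P_plusD(1)[OF \<sigma>(1)])
  define N where "N = density \<sigma> (\<lambda>x. ennreal (1 * indicator {0<..} x))"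
  have sets_N: "sets N = sets borel" by (simp add: N_def)
  have "emeasure N {..0} = 0"
    unfolding N_def by (subst emeasure_density) (auto simp: nn_integral_0_iff_AE split: split_indicator)
  moreover have "(\<integral>\<^sup>+x\<in>{0<..}. ennreal (min 1 x) \<partial>N) < \<infinity>"
  proof -
    have "(\<integral>\<^sup>+x\<in>{0<..}. ennreal (min 1 x) \<partial>N) \<le> (\<integral>\<^sup>+x. 1 \<partial>\<sigma>)"
      unfolding N_def
    proof (subst nn_integral_density)
      show "(\<integral>\<^sup>+x. ennreal (1 * indicator {0<..} x) * (ennreal (min 1 x) * indicator {0<..} x) \<partial>\<sigma>) \<le> (\<integral>\<^sup>+x. 1 \<partial>\<sigma>)"
      proof (rule nn_integral_mono)
        fix x :: real
        show "ennreal (1 * indicator {0<..} x) * (ennreal (min 1 x) * indicator {0<..} x) \<le> 1"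
          by (cases "0 < x") (simp_all add: ennreal_le_1)
      qed
    qed simp_all
    also have "\<dots> = 1" using emeasure_space_1 by simp
    finally show ?thesis by (rule le_less_trans) simp
  qed
  moreover have "free_cumulant_ext \<rho>
      (\<lambda>z. of_real 0 * z + (LINT x:{0..}|N. (1 / (1 - z * of_real x) - 1)))"
  proof (rule free_cumulant_ext_rho)
    fix z :: complex assume z: "Im z < 0"
    have "(LINT x:{0..}|N. (1 / (1 - z * of_real x) - 1)) = (LINT x|N. (1 / (1 - z * of_real x) - 1))"
      unfolding set_lebesgue_integral_def
    proof (rule integral_cong_AE)
      have "AE x in N. x \<in> {0..}"
        unfolding N_def by (subst AE_density) (auto split: split_indicator)
      then show "AE x in N. indicator {0..} x *\<^sub>R (1 / (1 - z * of_real x) - 1) = 1 / (1 - z * of_real x) - 1"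
        by eventually_elim simp
    qed (simp_all add: measurable_cong_sets[OF sets_N refl])
    also have "\<dots> = Psi \<sigma> z" unfolding N_def by (subst integral_kernel_restrict[OF z]) simp_all
    finally show "of_real 0 * z + (LINT x:{0..}|N. (1 / (1 - z * of_real x) - 1)) = Psi \<sigma> z" by simp
  qed
  ultimately show ?thesis
    unfolding free_regular_def using sets_N
    by (intro conjI rho_free_infinitely_divisible exI[of _ 0] exI[of _ N]) auto
qed

end

theorem proposition19:
  fixes \<sigma>bar \<sigma> \<mu> :: "real measure"
  assumes "\<sigma>bar \<in> P_plus" and "\<sigma>bar \<noteq> dirac0"
    and "is_free_mult_conv \<sigma>bar \<sigma>bar \<sigma>"
    and "is_free_mult_conv \<sigma>bar wigner \<mu>"
  shows "is_free_mult_conv \<sigma> marchenko_pastur (square_image \<mu>) \<and>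
    free_infinitely_divisible (square_image \<mu>) \<and>
    free_compound_poisson (square_image \<mu>) \<and>
    free_regular (square_image \<mu>)"
proof -
  have conv: "is_free_mult_conv \<sigma> marchenko_pastur (square_image \<mu>)"
    by (rule is_free_mult_conv_square_image[OF assms(2-4)])
  note \<sigma> = is_free_mult_conv_P_plus[OF assms(3,1,2,2)]
  obtain M where "0 < M" "\<And>w. M < Im w - Re w \<Longrightarrow> cmod (Psi \<sigma> (1 / w)) < 1 / 2"
    by (rule Psi_inverse_small_on_cone[OF \<sigma>(1)]) blast
  then interpret free_poisson_square \<sigma> "square_image \<mu>" M
    by unfold_locales (use \<sigma> conv in auto)
  show ?thesis
    using conv rho_free_infinitely_divisible rho_free_compound_poisson rho_free_regular by simp
qed

end
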